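(* Let $N\ge 2$ and let $\Omega\subset\mathbb{R}^N$ be a bounded domain with boundary $\partial\Omega$ of class $C^{1,1}$. Let $f\in C(\partial\Omega)$ and suppose that it changes sign, i.e. the sets $\mathcal{S}^+=\{x\in\partial\Omega:f(x)>0\}$ and $\mathcal{S}^-=\{x\in\partial\Omega:f(x)<0\}$ are non-empty, and suppose also that $\overline{\mathcal{S}}=\partial\Omega$, where $\mathcal{S}=\mathcal{S}^+\cup\mathcal{S}^-$. Let $$G=\{x\in\overline{\Omega}:d_{\mathcal{S}^+}(x)=d_{\mathcal{S}^-}(x)\},$$ $$G_{reg}=\{x\in G: x\text{ has a unique closest point on }\partial\Omega\},\qquad G_{sing}=G\setminus G_{reg}.$$ Assume that $G_{reg}$ is the finite union of $k$ disjoint $(N-1)$-dimensional surfaces of class $C^1$ and that the $(N-1)$-dimensional Hausdorff measure of $G_{sing}$ is zero. Let $u=u(x,t)$ be the solution of $$u_t=\Delta u\ \text{ in }\Omega\times(0,\infty),\quad u=0\ \text{ on }\Omega\times\{0\},\quad u=f\ \text{ on }\partial\Omega\times(0,\infty).$$ Let $D$ be a domain with $\overline{D}\subset\Omega$ such that $\Gamma=\partial D$ is of class $C^1$ and satisfies the interior sphere condition. Then there exist no $b\in(0,\infty]$ and no function $c:(0,b)\to\mathbb{R}$ such that $$u(x,t)=c(t)\quad\text{for }(x,t)\in\Gamma\times(0,b).$$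
   Context: Distance $d_{\mathcal{T}}$ for $\mathcal{T}\subseteq\partial\Omega$ (Euclidean length, paths inside $\Omega$): for $x\in\overline{\Omega}$ and $\gamma\in H^1_{loc}([0,\infty);\mathbb{R}^N)$ with $\gamma(0)=x$, let $T_x=\inf\{\tau>0:\gamma(\tau)\in\mathbb{R}^N\setminus\Omega\}$ ($+\infty$ if the set is empty). Then $$d_{\mathcal{T}}(x)=\inf\Bigl\{\int_0^{T_x}|\gamma'(t)|\,dt:\ \gamma(0)=x,\ T_x<\infty,\ \gamma(T_x)\in\mathcal{T}\Bigr\}.$$ Interior sphere condition for $\partial D$: for every $x\in\partial D$ there is a ball $B\subset D$ with $x\in\partial B$. The solution $u$ is the bounded classical solution, continuous on $\overline{\Omega}\times[0,\infty)$ except on $\partial\Omega\times\{0\}$. *)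

theory Defs
  imports "HOL-Analysis.Analysis"
begin

definition domain :: "'a::euclidean_space set \<Rightarrow> bool" where
  "domain \<Omega> \<longleftrightarrow> open \<Omega> \<and> connected \<Omega> \<and> \<Omega> \<noteq> {}"


definition C1_on :: "'a::euclidean_space set \<Rightarrow> ('a \<Rightarrow> 'b::euclidean_space) \<Rightarrow> bool" where
  "C1_on U F \<longleftrightarrow> (\<exists>F'. (\<forall>x\<in>U. (F has_derivative blinfun_apply (F' x)) (at x)) \<and> continuous_on U F')"

definition C11 :: "('a::euclidean_space \<Rightarrow> 'b::euclidean_space) \<Rightarrow> bool" where
  "C11 F \<longleftrightarrow> (\<exists>F' L. (\<forall>x. (F has_derivative blinfun_apply (F' x)) (at x)) \<and> L-lipschitz_on UNIV F')"

text \<open>Near each of its boundary points the set is the strict epigraph of a function in the class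
  \<open>P\<close>, in suitably rotated coordinates. The function lives on the hyperplane orthogonal to the
  unit vector \<open>\<nu>\<close>; it is given as a function \<open>h\<close> on the whole space, of which only the values on
  that hyperplane matter. Conversely a function of class C1 or C1,1 on the hyperplane extends to
  the whole space, constantly along \<open>\<nu>\<close>.\<close>
definition boundary_of_class :: "(('a::euclidean_space \<Rightarrow> real) \<Rightarrow> bool) \<Rightarrow> 'a set \<Rightarrow> bool" where
  "boundary_of_class P \<Omega> \<longleftrightarrow>
     (\<forall>x\<in>frontier \<Omega>. \<exists>r>0. \<exists>\<nu> h. norm \<nu> = 1 \<and> P h \<and>
        \<Omega> \<inter> ball x r = {y \<in> ball x r. h (y - (y \<bullet> \<nu>) *\<^sub>R \<nu>) < y \<bullet> \<nu>})"

definition C1_boundary :: "'a::euclidean_space set \<Rightarrow> bool" where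
  "C1_boundary = boundary_of_class (C1_on UNIV)"

definition C11_boundary :: "'a::euclidean_space set \<Rightarrow> bool" where
  "C11_boundary = boundary_of_class C11"

definition interior_sphere_condition :: "'a::euclidean_space set \<Rightarrow> bool" where
  "interior_sphere_condition D \<longleftrightarrow>
     (\<forall>x\<in>frontier D. \<exists>y r. 0 < r \<and> ball y r \<subseteq> D \<and> x \<in> sphere y r)"


definition C1_diffeomorphism ::
    "'a::euclidean_space set \<Rightarrow> 'a set \<Rightarrow> ('a \<Rightarrow> 'a) \<Rightarrow> ('a \<Rightarrow> 'a) \<Rightarrow> bool" where
  "C1_diffeomorphism U V \<Phi> \<Psi> \<longleftrightarrow>
     open U \<and> open V \<and> \<Phi> ` U = V \<and> \<Psi> ` V = U \<and>
     (\<forall>x\<in>U. \<Psi> (\<Phi> x) = x) \<and> (\<forall>y\<in>V. \<Phi> (\<Psi> y) = y) \<and> C1_on U \<Phi> \<and> C1_on V \<Psi>"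

text \<open>Embedded surfaces of codimension one, possibly with boundary; neither closed nor connected in
  general. Boundary points must be admitted: a point of \<open>G\<^sub>r\<^sub>e\<^sub>g\<close> has its closest point in
  \<open>\<partial>\<Omega>\<close> again in \<open>G\<^sub>r\<^sub>e\<^sub>g\<close>, so that for a ball and its upper and lower hemispheres, for instance,
  \<open>G\<^sub>r\<^sub>e\<^sub>g\<close> is the closed equatorial disc without its centre.\<close>
definition C1_hypersurface :: "'a::euclidean_space set \<Rightarrow> bool" where
  "C1_hypersurface M \<longleftrightarrow>
     (\<forall>x\<in>M. \<exists>U V \<Phi> \<Psi>. x \<in> U \<and> C1_diffeomorphism U V \<Phi> \<Psi> \<and>
        (\<exists>e1\<in>Basis. \<exists>e2\<in>Basis. e1 \<noteq> e2 \<and>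
           (\<Phi> ` (M \<inter> U) = {y\<in>V. y \<bullet> e1 = 0} \<or>
            \<Phi> ` (M \<inter> U) = {y\<in>V. y \<bullet> e1 = 0 \<and> 0 \<le> y \<bullet> e2})))"


text \<open>Boundedness of the covering sets is needed because \<open>diameter\<close> is unspecified on unbounded
  sets. The definition is meant for \<open>m \<ge> 1\<close>: for \<open>m = 0\<close> an empty covering set would count
  with weight 1 instead of 0.\<close>
definition hausdorff_content :: "nat \<Rightarrow> real \<Rightarrow> 'a::euclidean_space set \<Rightarrow> ennreal" where
  "hausdorff_content m \<delta> A =
     (INF U \<in> {U :: nat \<Rightarrow> 'a set. A \<subseteq> (\<Union>i. U i) \<and> (\<forall>i. bounded (U i) \<and> diameter (U i) \<le> \<delta>)}.
        \<Sum>i. ennreal (unit_ball_vol (real m) * (diameter (U i) / 2) ^ m))"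

definition hausdorff_measure :: "nat \<Rightarrow> 'a::euclidean_space set \<Rightarrow> ennreal" where
  "hausdorff_measure m A = (SUP \<delta>\<in>{0<..}. hausdorff_content m \<delta> A)"


text \<open>\<open>g\<close> is the weak derivative of \<open>\<gamma>\<close> on \<open>(0,\<infinity>)\<close>, tested with compactly supported
  C1 functions \<open>\<phi>\<close>.\<close>
definition weak_derivative :: "(real \<Rightarrow> 'a::euclidean_space) \<Rightarrow> (real \<Rightarrow> 'a) \<Rightarrow> bool" where
  "weak_derivative \<gamma> g \<longleftrightarrow>
     (\<forall>\<phi> \<phi>' :: real \<Rightarrow> real. \<forall>K. compact K \<longrightarrow> K \<subseteq> {0<..} \<longrightarrow> (\<forall>t. t \<notin> K \<longrightarrow> \<phi> t = 0) \<longrightarrow>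
        (\<forall>t. (\<phi> has_real_derivative \<phi>' t) (at t)) \<longrightarrow> continuous_on UNIV \<phi>' \<longrightarrow>
        (LINT t:{0<..}|lborel. \<phi>' t *\<^sub>R \<gamma> t) = - (LINT t:{0<..}|lborel. \<phi> t *\<^sub>R g t))"

text \<open>\<open>\<gamma>\<close> is the continuous representative of an element of \<open>H\<^sup>1\<^sub>l\<^sub>o\<^sub>c([0,\<infinity>))\<close> and \<open>g\<close> is (a
  representative of) its derivative. That \<open>\<gamma>\<close> is locally square integrable follows from
  continuity. Values at negative times are irrelevant.\<close>
definition H1_loc_with_derivative :: "(real \<Rightarrow> 'a::euclidean_space) \<Rightarrow> (real \<Rightarrow> 'a) \<Rightarrow> bool" where
  "H1_loc_with_derivative \<gamma> g \<longleftrightarrow>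
     continuous_on {0..} \<gamma> \<and> set_borel_measurable lborel {0..} g \<and>
     (\<forall>R. set_integrable lborel {0..R} (\<lambda>t. (norm (g t))\<^sup>2)) \<and> weak_derivative \<gamma> g"

definition exit_time :: "'a::euclidean_space set \<Rightarrow> (real \<Rightarrow> 'a) \<Rightarrow> ereal" where
  "exit_time \<Omega> \<gamma> = Inf {ereal \<tau> | \<tau>. 0 < \<tau> \<and> \<gamma> \<tau> \<notin> \<Omega>}"

definition path_distance :: "'a::euclidean_space set \<Rightarrow> 'a set \<Rightarrow> 'a \<Rightarrow> ennreal" where
  "path_distance \<Omega> \<T> x =
     Inf {(\<integral>\<^sup>+t\<in>{0..T}. ennreal (norm (g t)) \<partial>lborel) | \<gamma> g T.
            H1_loc_with_derivative \<gamma> g \<and> \<gamma> 0 = x \<and> exit_time \<Omega> \<gamma> = ereal T \<and> \<gamma> T \<in> \<T>}"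


definition unique_closest_point :: "'a::euclidean_space set \<Rightarrow> 'a \<Rightarrow> bool" where
  "unique_closest_point A x \<longleftrightarrow> (\<exists>!y. y \<in> A \<and> (\<forall>z\<in>A. dist x y \<le> dist x z))"


text \<open>\<open>u\<close> is C2 in space and C1 in time and solves the heat equation; \<open>ut\<close>, \<open>Du i\<close> and
  \<open>D2u i j\<close> are the partial derivatives.\<close>
definition classical_heat_equation :: "'a::euclidean_space set \<Rightarrow> ('a \<Rightarrow> real \<Rightarrow> real) \<Rightarrow> bool" where
  "classical_heat_equation \<Omega> u \<longleftrightarrow>
     (\<exists>ut Du D2u.
        (\<forall>x\<in>\<Omega>. \<forall>t>0.
           ((\<lambda>s. u x s) has_real_derivative ut x t) (at t) \<and>
           (\<forall>i\<in>Basis. ((\<lambda>s. u (x + s *\<^sub>R i) t) has_real_derivative Du i x t) (at 0)) \<and>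
           (\<forall>i\<in>Basis. \<forall>j\<in>Basis.
              ((\<lambda>s. Du i (x + s *\<^sub>R j) t) has_real_derivative D2u i j x t) (at 0)) \<and>
           ut x t = (\<Sum>i\<in>Basis. D2u i i x t)) \<and>
        continuous_on (\<Omega> \<times> {0<..}) (\<lambda>(x, t). ut x t) \<and>
        (\<forall>i\<in>Basis. continuous_on (\<Omega> \<times> {0<..}) (\<lambda>(x, t). Du i x t)) \<and>
        (\<forall>i\<in>Basis. \<forall>j\<in>Basis. continuous_on (\<Omega> \<times> {0<..}) (\<lambda>(x, t). D2u i j x t)))"

definition heat_solution ::
    "'a::euclidean_space set \<Rightarrow> ('a \<Rightarrow> real) \<Rightarrow> ('a \<Rightarrow> real \<Rightarrow> real) \<Rightarrow> bool" where
  "heat_solution \<Omega> f u \<longleftrightarrow>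
     classical_heat_equation \<Omega> u \<and>
     (\<forall>x\<in>\<Omega>. u x 0 = 0) \<and>
     (\<forall>x\<in>frontier \<Omega>. \<forall>t>0. u x t = f x) \<and>
     continuous_on (closure \<Omega> \<times> {0..} - frontier \<Omega> \<times> {0}) (\<lambda>(x, t). u x t) \<and>
     bounded ((\<lambda>(x, t). u x t) ` (closure \<Omega> \<times> {0..} - frontier \<Omega> \<times> {0}))"

end

theory Submission
  imports Defs
begin

text \<open>
The boundary values \<open>f\<close> do not depend on time, and this makes \<open>t \<mapsto> u x t\<close> real analytic on
\<open>(0,\<infinity>)\<close> for every \<open>x \<in> \<Omega>\<close>: its difference from the time-independent equilibrium evolves
by the semigroup of a self-adjoint operator. If \<open>u\<close> is spatially constant on \<open>\<Gamma> = frontier D\<close> during an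
interval \<open>(0,b)\<close>, then for \<open>x, y \<in> \<Gamma>\<close> the function \<open>t \<mapsto> u x t - u y t\<close> vanishes on \<open>(0,b)\<close>, hence
for all \<open>t > 0\<close> (\<open>equality_for_all_times\<close>). Letting \<open>t \<rightarrow> \<infinity>\<close>, the temperature converges uniformly to
an equilibrium \<open>h\<close>, harmonic in \<open>\<Omega>\<close> and equal to \<open>f\<close> on the boundary (\<open>equilibrium\<close>), and \<open>h\<close> is
constant on \<open>\<Gamma>\<close>. By the maximum principle \<open>h\<close> is constant in \<open>D\<close> (\<open>limit_maximum_principle\<close>), by
unique continuation in \<open>\<Omega>\<close> (\<open>unique_continuation\<close>), by continuity on the closure of \<open>\<Omega>\<close>. So \<open>f\<close> is
constant, which contradicts its change of sign.

Both analytic continuations, in time and in space, work with finite differences instead of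
derivatives. If a sequence starts with \<open>r\<close> zeros and its \<open>r\<close>-th differences are at most \<open>E\<close>, then
its \<open>i\<close>-th term is at most \<open>E * 2 ^ i\<close> (\<open>extrapolation_bound\<close>). When \<open>k\<close>-th differences over a
fixed total length decay like \<open>q ^ k\<close> with \<open>4 * q < 1\<close>, this forces a function that vanishes on an
interval to vanish a little further on.

The decay in time (\<open>time_difference_bound\<close>) is where self-adjointness enters. A solution \<open>w\<close> with
zero boundary values is the limit of a random walk on a grid that is killed outside \<open>\<Omega>\<close>; its
transition operator is a symmetric contraction, and for the square \<open>S\<close> of such an operator
\<open>(I - S) S\<^sup>n\<close> has norm at most \<open>1 / (n + 1)\<close>, so that its \<open>k\<close>-th power has norm at most
\<open>1 / (n + 1) ^ k\<close>. The passage from the \<open>\<ell>\<^sup>2\<close> norm to the value at a point costs a factor that stays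
bounded as the mesh \<open>h\<close> tends to zero: in dimension \<open>N\<close> there are of order \<open>1 / h ^ N\<close> grid points, and
after a fixed time the walk occupies each of them with probability at most of order \<open>h ^ N\<close>.

The decay in space (\<open>iterated_difference_bound\<close>) iterates a gradient estimate, which comes from
comparing \<open>u\<close> with its mirror image in a hyperplane. The equilibrium is never differentiated: it
enters only as the uniform limit of solutions of the heat equation (\<open>caloric_limit\<close>), and its
properties follow from comparison principles for these.
\<close>

section \<open>Continuation by finite differences\<close>

definition dif :: "(nat \<Rightarrow> real) \<Rightarrow> nat \<Rightarrow> real" where
  "dif c i = c (Suc i) - c i"

lemma dif_diff: "(dif ^^ r) (\<lambda>i. c i - d i) j = (dif ^^ r) c j - (dif ^^ r) d j"
  by (induction r arbitrary: j) (auto simp: dif_def)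

lemma dif_shift: "(dif ^^ r) (\<lambda>i. c (p + i)) j = (dif ^^ r) c (p + j)"
  by (induction r arbitrary: j) (auto simp: dif_def)

lemma abs_dif_le:
  assumes "\<And>i. i \<le> r + j \<Longrightarrow> \<bar>c i\<bar> \<le> B"
  shows "\<bar>(dif ^^ r) c j\<bar> \<le> 2 ^ r * B"
  using assms
proof (induction r arbitrary: j)
  case (Suc r)
  have "\<bar>(dif ^^ r) c (Suc j)\<bar> \<le> 2 ^ r * B" "\<bar>(dif ^^ r) c j\<bar> \<le> 2 ^ r * B"
    by (auto intro!: Suc)
  then show ?case by (simp add: dif_def[of "(dif ^^ r) c"])
qed simp

text \<open>A sequence with small \<open>r\<close>-th differences is close to a polynomial of degree less than \<open>r\<close>, and
\<open>r\<close> zeros make that polynomial zero. The induction on \<open>r\<close> sums the bound for the differences;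
the powers of two reproduce themselves under summation. The bound \<open>m\<close> keeps track of how far the
sequence is controlled, because in space it is defined only inside a domain.\<close>

lemma extrapolation_bound:
  assumes "\<And>i. i \<le> m \<Longrightarrow> \<bar>(dif ^^ r) c i\<bar> \<le> E" and "\<And>i. i < r \<Longrightarrow> c i = 0" and "i \<le> m + r"
  shows "\<bar>c i\<bar> \<le> E * 2 ^ i"
  using assms
proof (induction r arbitrary: c i)
  case 0
  then have "\<bar>c i\<bar> \<le> E" by simp
  then have "E * 1 \<le> E * 2 ^ i" by (intro mult_left_mono) auto
  then show ?case using \<open>\<bar>c i\<bar> \<le> E\<close> by simp
next
  case (Suc r)
  have d: "\<bar>dif c j\<bar> \<le> E * 2 ^ j" if "j \<le> m + r" for j
  proof (rule Suc.IH[OF _ _ that])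
    show "\<bar>(dif ^^ r) (dif c) i\<bar> \<le> E" if "i \<le> m" for i
      using Suc.prems(1)[OF that] by (simp only: funpow_Suc_right o_apply)
    show "dif c i = 0" if "i < r" for i
      using Suc.prems(2) that by (simp add: dif_def)
  qed
  have E: "0 \<le> E" using Suc.prems(1)[of 0] by simp
  have "i \<le> m + Suc r \<longrightarrow> \<bar>c i\<bar> \<le> E * 2 ^ i" for i
  proof (induction i)
    case 0
    show ?case using E Suc.prems(2)[of 0] by simp
  next
    case (Suc i)
    then show ?case using d[of i] by (auto simp: dif_def[of c])
  qed
  then show ?case using Suc.prems(3) by blast
qed

lemma zero_if_geometric_bound:
  fixes x C q :: real
  assumes "\<And>k::nat. k \<ge> 1 \<Longrightarrow> \<bar>x\<bar> \<le> C * q ^ k" and "0 \<le> q" "q < 1"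
  shows "x = 0"
proof -
  have "(\<lambda>k. C * q ^ k) \<longlonglongrightarrow> C * 0"
    using assms by (intro tendsto_mult tendsto_const LIMSEQ_power_zero) auto
  then have "\<bar>x\<bar> \<le> C * 0"
    by (rule tendsto_lowerbound) (use assms(1) in \<open>auto simp: eventually_sequentially\<close>)
  then show ?thesis by simp
qed

text \<open>The nodes are \<open>t\<^sub>0 - a + i * a / k\<close>: the first \<open>k + 1\<close> lie in the zero set, and node number \<open>2 * k\<close>
is \<open>t\<^sub>0 + a\<close>. Extrapolation multiplies the bound \<open>C / 5 ^ k\<close> by \<open>2 ^ (2 * k)\<close>, and \<open>4 / 5 < 1\<close>.\<close>

lemma vanishing_extends_past:
  fixes g :: "real \<Rightarrow> real"
  assumes bnd: "\<And>k t. k \<ge> 1 \<Longrightarrow> 5 * a < t \<Longrightarrow>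
      \<bar>(dif ^^ Suc k) (\<lambda>i. g (t + real i * (a / real k))) 0\<bar> \<le> C / 5 ^ k"
    and zero: "\<And>t. 0 < t \<Longrightarrow> t \<le> t\<^sub>0 \<Longrightarrow> g t = 0" and a: "0 < a" "6 * a < t\<^sub>0"
  shows "g (t\<^sub>0 + a) = 0"
proof (rule zero_if_geometric_bound)
  fix k :: nat assume k: "k \<ge> 1"
  let ?s = "a / real k"
  let ?c = "\<lambda>i. g (t\<^sub>0 - a + real i * ?s)"
  have b: "\<bar>(dif ^^ Suc k) ?c i\<bar> \<le> C / 5 ^ k" for i
  proof -
    have "5 * a < t\<^sub>0 - a + real i * ?s"
      using a by (smt (verit) divide_nonneg_nonneg mult_nonneg_nonneg of_nat_0_le_iff)
    from bnd[OF k this]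
    have "\<bar>(dif ^^ Suc k) (\<lambda>j. ?c (i + j)) 0\<bar> \<le> C / 5 ^ k"
      by (simp add: algebra_simps add_divide_distrib del: funpow.simps)
    then show ?thesis using dif_shift[of "Suc k" ?c i 0] by simp
  qed
  have z: "?c i = 0" if "i < Suc k" for i
  proof -
    have "real i * ?s \<le> real k * ?s" using that a by (intro mult_right_mono) auto
    moreover have "real k * ?s = a" using k by simp
    ultimately have "t\<^sub>0 - a + real i * ?s \<le> t\<^sub>0" by linarith
    moreover have "0 \<le> real i * ?s" using a by simp
    then have "0 < t\<^sub>0 - a + real i * ?s" using a by linarith
    ultimately show ?thesis by (intro zero)
  qed
  have "\<bar>?c (2 * k)\<bar> \<le> C / 5 ^ k * 2 ^ (2 * k)"
    by (rule extrapolation_bound[of "2 * k" "Suc k"]) (use b z in auto)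
  also have "C / 5 ^ k * 2 ^ (2 * k) = C * (4 / 5) ^ k"
    by (simp add: power_mult power_divide)
  also have "t\<^sub>0 - a + real (2 * k) * ?s = t\<^sub>0 + a" using k by simp
  finally show "\<bar>g (t\<^sub>0 + a)\<bar> \<le> C * (4 / 5) ^ k" .
qed auto

text \<open>Each application of the previous lemma enlarges the zero set by a fixed factor; \<open>8 / 7\<close> is
admissible because \<open>6 * (8 / 7 - 1) < 1\<close>.\<close>

lemma vanishing_for_all_times:
  fixes g :: "real \<Rightarrow> real"
  assumes bnd: "\<And>a. 0 < a \<Longrightarrow> \<exists>C. \<forall>k\<ge>1. \<forall>t>5 * a.
      \<bar>(dif ^^ Suc k) (\<lambda>i. g (t + real i * (a / real k))) 0\<bar> \<le> C / 5 ^ k"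
    and zero: "\<And>t. 0 < t \<Longrightarrow> t \<le> b \<Longrightarrow> g t = 0" and "0 < b" "0 < t"
  shows "g t = 0"
proof -
  have step: "\<forall>t. 0 < t \<and> t \<le> b * (8 / 7) ^ j \<longrightarrow> g t = 0" for j
  proof (induction j)
    case 0
    then show ?case using zero by simp
  next
    case (Suc j)
    define t\<^sub>0 where "t\<^sub>0 = b * (8 / 7) ^ j"
    have t0: "0 < t\<^sub>0" using \<open>0 < b\<close> by (simp add: t\<^sub>0_def)
    show ?case
    proof (intro allI impI)
      fix t assume t: "0 < t \<and> t \<le> b * (8 / 7) ^ Suc j"
      show "g t = 0"
      proof (cases "t \<le> t\<^sub>0")
        case True
        then show ?thesis using Suc t by (simp add: t\<^sub>0_def)
      next
        case False
        define a where "a = t - t\<^sub>0"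
        have "0 < a" using False by (simp add: a_def)
        have "t \<le> t\<^sub>0 * (8 / 7)" using t by (simp add: t\<^sub>0_def)
        then have "6 * a < t\<^sub>0" using t0 by (simp add: a_def)
        obtain C where C: "\<And>k t. k \<ge> 1 \<Longrightarrow> 5 * a < t \<Longrightarrow>
            \<bar>(dif ^^ Suc k) (\<lambda>i. g (t + real i * (a / real k))) 0\<bar> \<le> C / 5 ^ k"
          using bnd[OF \<open>0 < a\<close>] by blast
        have "g (t\<^sub>0 + a) = 0"
          by (rule vanishing_extends_past[OF C]) (use Suc \<open>0 < a\<close> \<open>6 * a < t\<^sub>0\<close> in \<open>auto simp: t\<^sub>0_def\<close>)
        then show ?thesis by (simp add: a_def)
      qed
    qed
  qed
  obtain j where "t / b < (8 / 7) ^ j" using real_arch_pow[of "8/7" "t / b"] by auto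
  then have "t \<le> b * (8 / 7) ^ j" using \<open>0 < b\<close> by (simp add: field_simps)
  then show ?thesis using step \<open>0 < t\<close> by blast
qed

section \<open>Powers of symmetric contractions\<close>

text \<open>The sequence models \<open>\<beta> j = \<parallel>M\<^sup>j v\<parallel>\<^sup>2\<close>. Its second differences decrease, so that summing them
twice backwards from \<open>J = 2 * n\<close> gives \<open>d J * (J + 1) * (J + 2) / 2 \<le> \<beta> 0\<close>.\<close>

lemma second_difference_decay:
  fixes \<beta> :: "nat \<Rightarrow> real"
  assumes pos: "\<And>j. 0 \<le> \<beta> j" and dec: "\<And>j. \<beta> (Suc j) \<le> \<beta> j"
    and d: "\<And>j. \<beta> j - 2 * \<beta> (Suc j) + \<beta> (Suc (Suc j)) = d j" and ddec: "\<And>j. d (Suc j) \<le> d j"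
  shows "d (2 * n) * (real n + 1)\<^sup>2 \<le> \<beta> 0"
proof -
  define J where "J = 2 * n"
  have dJ: "d J \<le> d j" if "j \<le> J" for j
    using lift_Suc_antimono_le[of d, OF ddec that] .
  have "p \<le> J + 1 \<Longrightarrow> d J * p \<le> \<beta> (J + 1 - p) - \<beta> (Suc (J + 1 - p)) \<and>
      d J * (real p * (real p + 1) / 2) \<le> \<beta> (J + 1 - p)" for p
  proof (induction p)
    case 0
    then show ?case using pos dec by simp
  next
    case (Suc p)
    then have e: "J + 1 - p = Suc (J - p)" "J + 1 - Suc p = J - p" by auto
    have IH: "d J * p \<le> \<beta> (Suc (J - p)) - \<beta> (Suc (Suc (J - p)))"
      "d J * (real p * (real p + 1) / 2) \<le> \<beta> (Suc (J - p))"
      using Suc e by auto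
    have 1: "d J * (real p + 1) \<le> \<beta> (J - p) - \<beta> (Suc (J - p))"
      using IH(1) d[of "J - p"] dJ[of "J - p"] by (simp add: algebra_simps)
    moreover have "d J * ((real p + 1) * (real p + 1 + 1) / 2) \<le> \<beta> (J - p)"
    proof -
      have "d J * ((real p + 1) * (real p + 1 + 1) / 2)
          = d J * (real p * (real p + 1) / 2) + d J * (real p + 1)"
        by (simp add: field_simps)
      then show ?thesis using IH(2) 1 by linarith
    qed
    ultimately show ?case unfolding e by (simp add: add.commute)
  qed
  \<comment> \<open>For \<open>p = J + 1\<close> the summation has reached the index \<open>0\<close>.\<close>
  from this[of "J + 1"] have *: "d J * ((real J + 1) * (real J + 2) / 2) \<le> \<beta> 0" by (simp add: algebra_simps)
  show ?thesis
  proof (cases "d J \<le> 0")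
    case True
    then have "d J * (real n + 1)\<^sup>2 \<le> 0" by (simp add: mult_nonpos_nonneg)
    then show ?thesis using pos[of 0] by (simp add: J_def)
  next
    case False
    have "(real n + 1)\<^sup>2 \<le> (real J + 1) * (real J + 2) / 2"
      by (simp add: J_def power2_eq_square algebra_simps)
    then have "d J * (real n + 1)\<^sup>2 \<le> d J * ((real J + 1) * (real J + 2) / 2)"
      using False by (intro mult_left_mono) auto
    then show ?thesis using * by (simp add: J_def)
  qed
qed

text \<open>A self-adjoint operator of norm at most one on \<open>\<ell>\<^sup>2(X)\<close>, acting on functions on the whole type so
that the set \<open>X\<close> may vary; only values on \<open>X\<close> enter the norms.\<close>

locale symmetric_contraction =
  fixes X :: "'b set" and M :: "('b \<Rightarrow> real) \<Rightarrow> 'b \<Rightarrow> real"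
  assumes fin: "finite X"
    and lin: "M (\<lambda>x. v x - w x) = (\<lambda>x. M v x - M w x)"
    and sym: "(\<Sum>x\<in>X. M v x * w x) = (\<Sum>x\<in>X. v x * M w x)"
    and contr: "(\<Sum>x\<in>X. (M v x)\<^sup>2) \<le> (\<Sum>x\<in>X. (v x)\<^sup>2)"
begin

lemma pow_lin: "(M ^^ j) (\<lambda>x. v x - w x) = (\<lambda>x. (M ^^ j) v x - (M ^^ j) w x)"
  by (induction j) (auto simp: lin)

lemma pow_sym: "(\<Sum>x\<in>X. (M ^^ j) v x * w x) = (\<Sum>x\<in>X. v x * (M ^^ j) w x)"
proof (induction j arbitrary: w)
  case (Suc j)
  have "(\<Sum>x\<in>X. (M ^^ Suc j) v x * w x) = (\<Sum>x\<in>X. v x * (M ^^ j) (M w) x)"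
    by (simp add: sym Suc)
  then show ?case by (simp add: funpow_swap1)
qed simp

lemma pow_contr: "(\<Sum>x\<in>X. ((M ^^ j) v x)\<^sup>2) \<le> (\<Sum>x\<in>X. (v x)\<^sup>2)"
  by (induction j) (auto intro: order_trans[OF contr])

lemma pow_symmetric_contraction: "symmetric_contraction X (M ^^ m)"
  by unfold_locales (auto simp: fin pow_lin pow_sym pow_contr)

text \<open>For \<open>S = M\<^sup>2\<close> the bound says that \<open>(S - I) S\<^sup>n\<close> has norm at most \<open>1 / (n + 1)\<close>. Squaring \<open>M\<close>
makes the operator positive, and replaces the spectral theorem: symmetry turns
the inner product of \<open>M\<^sup>j v\<close> with \<open>S M\<^sup>j v\<close> into \<open>\<parallel>M M\<^sup>j v\<parallel>\<^sup>2\<close>, so that \<open>\<parallel>M\<^sup>j (S - I) v\<parallel>\<^sup>2\<close> is a second difference of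
\<open>\<parallel>M\<^sup>j v\<parallel>\<^sup>2\<close>.\<close>

lemma one_step_decay:
  "(\<Sum>x\<in>X. ((M ^^ (2 * n)) (\<lambda>x. M (M v) x - v x) x)\<^sup>2) * (real n + 1)\<^sup>2 \<le> (\<Sum>x\<in>X. (v x)\<^sup>2)"
proof -
  define \<beta> where "\<beta> j = (\<Sum>x\<in>X. ((M ^^ j) v x)\<^sup>2)" for j
  define d where "d j = (\<Sum>x\<in>X. ((M ^^ j) (\<lambda>x. M (M v) x - v x) x)\<^sup>2)" for j
  have "d (2 * n) * (real n + 1)\<^sup>2 \<le> \<beta> 0"
  proof (rule second_difference_decay)
    show "0 \<le> \<beta> j" for j by (auto simp: \<beta>_def intro: sum_nonneg)
    show "\<beta> (Suc j) \<le> \<beta> j" for j by (auto simp: \<beta>_def intro: contr)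
    show "d (Suc j) \<le> d j" for j by (auto simp: d_def intro: contr)
    show "\<beta> j - 2 * \<beta> (Suc j) + \<beta> (Suc (Suc j)) = d j" for j
    proof -
      let ?a = "(M ^^ j) v"
      have "(\<Sum>x\<in>X. ?a x * M (M ?a) x) = (\<Sum>x\<in>X. M ?a x * M ?a x)" by (simp add: sym)
      moreover
      have "d j = (\<Sum>x\<in>X. (M (M ?a) x - ?a x)\<^sup>2)"
        (is "_ = ?D") by (simp add: d_def pow_lin funpow_swap1)
      moreover have "?D = (\<Sum>x\<in>X. (M (M ?a) x)\<^sup>2) - 2 * (\<Sum>x\<in>X. ?a x * M (M ?a) x) + (\<Sum>x\<in>X. (?a x)\<^sup>2)"
        by (simp add: power2_diff sum.distrib sum_subtractf sum_distrib_left mult_ac)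
      ultimately show ?thesis
        by (simp add: \<beta>_def power2_eq_square)
    qed
  qed
  then show ?thesis by (simp add: \<beta>_def d_def)
qed

definition incr :: "('b \<Rightarrow> real) \<Rightarrow> 'b \<Rightarrow> real" where
  "incr v = (\<lambda>x. M (M v) x - v x)"

lemma pow_incr_commute: "(M ^^ j) (incr v) = incr ((M ^^ j) v)"
  by (simp add: incr_def pow_lin funpow_swap1)

lemma pow_incr_pow_commute: "(M ^^ j) ((incr ^^ k) v) = (incr ^^ k) ((M ^^ j) v)"
  by (induction k) (auto simp: pow_incr_commute)

text \<open>The \<open>k\<close>-th power of the previous bound, as all powers of \<open>M\<close> commute. This exponential gain in
\<open>k\<close> is the operator form of time analyticity.\<close>

lemma difference_power_decay:
  "(\<Sum>x\<in>X. ((M ^^ (2 * (n * k))) ((incr ^^ k) v) x)\<^sup>2) * (real n + 1) ^ (2 * k) \<le> (\<Sum>x\<in>X. (v x)\<^sup>2)"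
proof (induction k)
  case (Suc k)
  let ?z = "(M ^^ (2 * (n * k))) ((incr ^^ k) v)"
  have e: "(M ^^ (2 * (n * Suc k))) ((incr ^^ Suc k) v) = (M ^^ (2 * n)) (incr ?z)"
    by (simp add: pow_incr_commute funpow_add algebra_simps)
  have "(\<Sum>x\<in>X. ((M ^^ (2 * n)) (incr ?z) x)\<^sup>2) * (real n + 1)\<^sup>2 \<le> (\<Sum>x\<in>X. (?z x)\<^sup>2)"
    using one_step_decay[of n ?z] by (simp add: incr_def)
  then have "(\<Sum>x\<in>X. ((M ^^ (2 * n)) (incr ?z) x)\<^sup>2) * (real n + 1)\<^sup>2 * (real n + 1) ^ (2 * k)
      \<le> (\<Sum>x\<in>X. (?z x)\<^sup>2) * (real n + 1) ^ (2 * k)"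
    by (intro mult_right_mono) auto
  with Suc show ?case unfolding e by (simp add: power_add algebra_simps power2_eq_square)
qed auto

lemma dif_pow:
  "(dif ^^ k) (\<lambda>i. (M ^^ (2 * i)) v x) i = (M ^^ (2 * i)) ((incr ^^ k) v) x"
proof (induction k arbitrary: i)
  case (Suc k)
  have "(dif ^^ Suc k) (\<lambda>i. (M ^^ (2 * i)) v x) i
     = (M ^^ (2 * Suc i)) ((incr ^^ k) v) x - (M ^^ (2 * i)) ((incr ^^ k) v) x"
    by (simp add: dif_def[of "(dif ^^ k) _"] Suc del: mult_Suc_right)
  also have "\<dots> = (M ^^ (2 * i)) (incr ((incr ^^ k) v)) x"
    unfolding pow_incr_commute by (simp add: incr_def)
  finally show ?case by simp
qed simp

end

section \<open>The killed random walk on a grid\<close>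

definition signs :: "'a set \<Rightarrow> ('a \<Rightarrow> real) set" where
  "signs B = PiE B (\<lambda>_. {-1, 1})"

text \<open>One time step of a walk that moves by \<open>\<plusminus>h\<close> in all directions of \<open>B\<close> at once, so that its law is a
product over the coordinates.\<close>

definition avg :: "real \<Rightarrow> 'a::euclidean_space set \<Rightarrow> ('a \<Rightarrow> real) \<Rightarrow> 'a \<Rightarrow> real" where
  "avg h B v x = (\<Sum>g\<in>signs B. v (x + h *\<^sub>R (\<Sum>j\<in>B. g j *\<^sub>R j))) / 2 ^ card B"

text \<open>Reading \<open>v\<close> as zero outside \<open>X\<close> kills the walk there: the discrete form of zero boundary values.\<close>

definition walk :: "real \<Rightarrow> 'a::euclidean_space set \<Rightarrow> ('a \<Rightarrow> real) \<Rightarrow> 'a \<Rightarrow> real" where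
  "walk h X v x = (if x \<in> X then avg h Basis (\<lambda>y. if y \<in> X then v y else 0) x else 0)"

lemma finite_signs: "finite B \<Longrightarrow> finite (signs B)"
  by (auto simp: signs_def intro!: finite_PiE)

lemma card_signs: "finite B \<Longrightarrow> card (signs B) = 2 ^ card B"
  by (simp add: signs_def card_PiE numeral_2_eq_2)

lemma avg_mono:
  assumes "\<And>g. g \<in> signs B \<Longrightarrow> v (x + h *\<^sub>R (\<Sum>j\<in>B. g j *\<^sub>R j)) \<le> w (x + h *\<^sub>R (\<Sum>j\<in>B. g j *\<^sub>R j))"
  shows "avg h B v x \<le> avg h B w x"
  unfolding avg_def by (intro divide_right_mono sum_mono assms) auto

lemma avg_const: "finite B \<Longrightarrow> avg h B (\<lambda>_. c) x = c"
  by (simp add: avg_def card_signs)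

lemma avg_diff: "avg h B (\<lambda>y. v y - w y) x = avg h B v x - avg h B w x"
  by (simp add: avg_def sum_subtractf diff_divide_distrib)

lemma avg_square_le:
  assumes "finite B"
  shows "(avg h B v x)\<^sup>2 \<le> avg h B (\<lambda>y. (v y)\<^sup>2) x"
proof -
  let ?a = "\<lambda>g. v (x + h *\<^sub>R (\<Sum>j\<in>B. g j *\<^sub>R j))"
  have "(\<Sum>g\<in>signs B. ?a g)\<^sup>2 \<le> (\<Sum>g\<in>signs B. (?a g)\<^sup>2) * card (signs B)"
    by (rule sum_squared_le_sum_of_squares)
  then have "(\<Sum>g\<in>signs B. ?a g)\<^sup>2 / (2 ^ card B)\<^sup>2 \<le> (\<Sum>g\<in>signs B. (?a g)\<^sup>2) * 2 ^ card B / (2 ^ card B)\<^sup>2"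
    by (intro divide_right_mono) (auto simp: card_signs assms)
  then show ?thesis by (simp add: avg_def power_divide power2_eq_square)
qed

text \<open>The pairs of points of \<open>X\<close> that are joined by a step are counted once from each end; reversing a
step negates all its signs.\<close>

lemma walk_symmetric:
  fixes X :: "'a::euclidean_space set"
  assumes "finite X"
  shows "(\<Sum>x\<in>X. walk h X v x * w x) = (\<Sum>x\<in>X. v x * walk h X w x)"
proof -
  let ?S = "signs (Basis :: 'a set)"
  define e :: "('a \<Rightarrow> real) \<Rightarrow> 'a" where "e g = h *\<^sub>R (\<Sum>j\<in>Basis. g j *\<^sub>R j)" for g
  define A where "A = {(x, g). x \<in> X \<and> g \<in> ?S \<and> x + e g \<in> X}"
  define neg :: "('a \<Rightarrow> real) \<Rightarrow> 'a \<Rightarrow> real" where "neg g = restrict (\<lambda>j. - g j) Basis" for g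
  have e_neg: "e (neg g) = - e g" for g
    by (simp add: e_def neg_def sum_negf)
  have neg_S: "neg g \<in> ?S" if "g \<in> ?S" for g
    using that by (fastforce simp: signs_def neg_def PiE_iff)
  have neg_neg: "neg (neg g) = g" if "g \<in> ?S" for g
    using that by (fastforce simp: signs_def neg_def PiE_iff extensional_def)
  have fS: "finite ?S" by (simp add: finite_signs)
  have *: "(\<Sum>x\<in>X. walk h X v x * w x) = (\<Sum>(x, g)\<in>A. v (x + e g) * w x) / 2 ^ DIM('a)" for v w
  proof -
    have "(\<Sum>x\<in>X. walk h X v x * w x)
        = (\<Sum>x\<in>X. \<Sum>g\<in>?S. (if x + e g \<in> X then v (x + e g) * w x else 0)) / 2 ^ DIM('a)"
      by (simp add: walk_def avg_def e_def sum_distrib_right sum_divide_distrib if_distrib[of "\<lambda>z. z * _"]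
          if_distrib[of "\<lambda>z. z / _"] cong: if_cong)
    also have "(\<Sum>x\<in>X. \<Sum>g\<in>?S. (if x + e g \<in> X then v (x + e g) * w x else 0))
        = (\<Sum>(x, g)\<in>X \<times> ?S. (if x + e g \<in> X then v (x + e g) * w x else 0))"
      by (rule sum.cartesian_product)
    also have "\<dots> = (\<Sum>(x, g)\<in>A. v (x + e g) * w x)"
      by (rule sum.mono_neutral_cong_right) (use assms fS in \<open>auto simp: A_def split: if_splits\<close>)
    finally show ?thesis .
  qed
  have "(\<Sum>(x, g)\<in>A. v (x + e g) * w x) = (\<Sum>(x, g)\<in>A. w (x + e g) * v x)"
    by (rule sum.reindex_bij_witness[of _ "\<lambda>(x, g). (x + e g, neg g)" "\<lambda>(x, g). (x + e g, neg g)"])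
      (auto simp: A_def e_neg neg_S neg_neg)
  then show ?thesis using *[of v w] *[of w v] by (simp add: mult.commute)
qed

lemma walk_one_le: "walk h X (\<lambda>_. 1) (x::'a::euclidean_space) \<le> 1"
proof -
  have "avg h Basis (\<lambda>y. if y \<in> X then 1 else 0) x \<le> avg h Basis (\<lambda>_. 1) x"
    by (rule avg_mono) auto
  then show ?thesis by (simp add: walk_def avg_const)
qed

lemma walk_nonneg: "(\<And>x. 0 \<le> v x) \<Longrightarrow> 0 \<le> walk h X v x"
  by (auto simp: walk_def avg_def intro!: divide_nonneg_nonneg sum_nonneg)

lemma sum_walk_le:
  assumes "finite X" and "\<And>x. 0 \<le> v x"
  shows "(\<Sum>x\<in>X. walk h X v x) \<le> (\<Sum>x\<in>X. v x)"
proof -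
  have "(\<Sum>x\<in>X. walk h X v x) = (\<Sum>x\<in>X. v x * walk h X (\<lambda>_. 1) x)"
    using walk_symmetric[OF assms(1), of h v "\<lambda>_. 1"] by simp
  also have "\<dots> \<le> (\<Sum>x\<in>X. v x)"
    using assms(2) by (intro sum_mono mult_left_le walk_one_le) auto
  finally show ?thesis .
qed

text \<open>Contraction follows from Jensen's inequality for the average, and from the fact that the walk does
not increase total mass.\<close>

lemma walk_symmetric_contraction:
  assumes "finite X"
  shows "symmetric_contraction X (walk h X)"
proof
  show "walk h X (\<lambda>x. v x - w x) = (\<lambda>x. walk h X v x - walk h X w x)" for v w
  proof -
    have "(\<lambda>y. if y \<in> X then v y - w y else 0)
        = (\<lambda>y. (if y \<in> X then v y else 0) - (if y \<in> X then w y else 0))" by auto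
    then show ?thesis by (auto simp: walk_def avg_diff)
  qed
  show "(\<Sum>x\<in>X. (walk h X v x)\<^sup>2) \<le> (\<Sum>x\<in>X. (v x)\<^sup>2)" for v
  proof -
    have "(\<Sum>x\<in>X. (walk h X v x)\<^sup>2) \<le> (\<Sum>x\<in>X. walk h X (\<lambda>y. (v y)\<^sup>2) x)"
    proof (rule sum_mono)
      fix x assume "x \<in> X"
      have "(avg h Basis (\<lambda>y. if y \<in> X then v y else 0) x)\<^sup>2
          \<le> avg h Basis (\<lambda>y. (if y \<in> X then v y else 0)\<^sup>2) x"
        by (rule avg_square_le) simp
      then show "(walk h X v x)\<^sup>2 \<le> walk h X (\<lambda>y. (v y)\<^sup>2) x"
        by (simp add: walk_def if_distrib[of "\<lambda>z. z\<^sup>2"] cong: if_cong)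
    qed
    also have "\<dots> \<le> (\<Sum>x\<in>X. (v x)\<^sup>2)" by (rule sum_walk_le) (auto simp: assms)
    finally show ?thesis .
  qed
qed (auto simp: assms walk_symmetric)

text \<open>The probability that a sum of \<open>n\<close> independent fair signs equals \<open>r\<close>.\<close>

definition coin :: "nat \<Rightarrow> real \<Rightarrow> real" where
  "coin n r = (\<Sum>j\<le>n. real (n choose j) * of_bool (r = 2 * real j - real n)) / 2 ^ n"

lemma coin_Suc: "coin (Suc n) r = (coin n (r - 1) + coin n (r + 1)) / 2"
proof -
  let ?b = "\<lambda>j. of_bool (r = 2 * real j - real (Suc n)) :: real"
  have "(\<Sum>j\<le>Suc n. real (Suc n choose j) * ?b j)
      = ?b 0 + (\<Sum>j\<le>n. (real (n choose j) + real (n choose Suc j)) * ?b (Suc j))"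
    by (subst sum.atMost_Suc_shift) simp
  also have "\<dots> = (\<Sum>j\<le>n. real (n choose j) * ?b (Suc j))
      + (\<Sum>j\<le>Suc n. real (n choose j) * ?b j)"
    by (subst sum.atMost_Suc_shift) (simp add: sum.distrib algebra_simps)
  also have "(\<Sum>j\<le>Suc n. real (n choose j) * ?b j) = (\<Sum>j\<le>n. real (n choose j) * ?b j)" by simp
  also have "(\<Sum>j\<le>n. real (n choose j) * ?b j)
      = (\<Sum>j\<le>n. real (n choose j) * of_bool (r + 1 = 2 * real j - real n))"
    by (intro sum.cong) (auto simp: of_bool_def)
  also have "(\<Sum>j\<le>n. real (n choose j) * ?b (Suc j))
      = (\<Sum>j\<le>n. real (n choose j) * of_bool (r - 1 = 2 * real j - real n))"
    by (intro sum.cong) (auto simp: of_bool_def)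
  finally show ?thesis by (simp add: coin_def field_simps)
qed

lemma coin_nonneg: "0 \<le> coin n r"
  by (auto simp: coin_def intro!: divide_nonneg_nonneg sum_nonneg)

text \<open>The quantity \<open>c\<^sub>m\<^sup>2 * (2 * m + 1)\<close>, with \<open>c\<^sub>m\<close> the left-hand side, decreases in \<open>m\<close>.\<close>

lemma central_binomial_upper: "real ((2 * m) choose m) / 4 ^ m \<le> 1 / sqrt (real (2 * m + 1))"
proof -
  define c where "c m = real ((2 * m) choose m) / 4 ^ m" for m
  have c_Suc: "c (Suc m) = c m * ((2 * real m + 1) / (2 * real m + 2))" for m
  proof -
    have *: "real ((2 * m) choose m) = fact (2 * m) / (fact m * fact m)" for m
      by (subst binomial_fact) (auto simp: mult_2)
    have 1: "(fact (2 * Suc m) :: real) = (2 * real m + 2) * (2 * real m + 1) * fact (2 * m)"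
      by (simp add: algebra_simps)
    have 2: "(fact (Suc m) :: real) = (real m + 1) * fact m" by (simp add: algebra_simps)
    have 3: "(2 * real m + 2) * (2 * real m + 1) * f / (((real m + 1) * g) * ((real m + 1) * g)) / (4 * p)
        = f / (g * g) / p * ((2 * real m + 1) / (2 * real m + 2))" if "g \<noteq> 0" "p \<noteq> 0" for f g p
      using that by (simp add: divide_simps) (simp add: algebra_simps)
    show ?thesis unfolding c_def * 1 2 power_Suc by (rule 3) auto
  qed
  have "(c m)\<^sup>2 * (2 * real m + 1) \<le> 1"
  proof (induction m)
    case 0
    then show ?case by (simp add: c_def)
  next
    case (Suc m)
    have "(c (Suc m))\<^sup>2 * (2 * real (Suc m) + 1)
        = ((c m)\<^sup>2 * (2 * real m + 1)) * ((2 * real m + 1) * (2 * real m + 3) / (2 * real m + 2)\<^sup>2)"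
      by (simp add: c_Suc power_divide power_mult_distrib power2_eq_square)
    also have "\<dots> \<le> 1 * 1"
    proof (rule mult_mono)
      show "(2 * real m + 1) * (2 * real m + 3) / (2 * real m + 2)\<^sup>2 \<le> 1"
        by (subst divide_le_eq_1_pos) (auto simp: power2_eq_square algebra_simps add_pos_nonneg)
    qed (use Suc in auto)
    finally show ?case by simp
  qed
  then have "(c m * sqrt (2 * real m + 1))\<^sup>2 \<le> 1\<^sup>2" by (simp add: power_mult_distrib)
  then have "c m * sqrt (2 * real m + 1) \<le> 1" by (rule power2_le_imp_le) simp
  then show ?thesis by (simp add: c_def field_simps)
qed

lemma coin_le:
  assumes "even n" shows "coin n r \<le> 1 / sqrt (real (n + 1))"
proof -
  obtain m where n: "n = 2 * m" using assms by blast
  let ?J = "{j. j \<le> n \<and> r = 2 * real j - real n}"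
  have "card ?J \<le> 1"
    by (rule card_le_Suc0_iff_eq[THEN iffD2, unfolded One_nat_def[symmetric]])
       auto
  have "(\<Sum>j\<le>n. real (n choose j) * of_bool (r = 2 * real j - real n))
      \<le> (\<Sum>j\<le>n. real (n choose m) * of_bool (r = 2 * real j - real n))"
    using binomial_maximum[of n] by (intro sum_mono mult_right_mono) (auto simp: n)
  also have "\<dots> = real (n choose m) * card ?J"
  proof -
    have "(\<Sum>j\<le>n. of_bool (r = 2 * real j - real n) :: real) = card ?J"
      by (subst sum_of_bool_eq) (auto intro!: arg_cong[where f=card])
    then show ?thesis by (simp flip: sum_distrib_left)
  qed
  also have "\<dots> \<le> real (n choose m)"
    using \<open>card ?J \<le> 1\<close> by (intro mult_left_le) auto
  finally have "coin n r \<le> real ((2 * m) choose m) / 4 ^ m"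
    unfolding coin_def by (auto simp: n power_mult intro!: divide_right_mono)
  also note central_binomial_upper
  finally show ?thesis by (simp add: n)
qed

text \<open>The transition probability from \<open>x\<^sub>0\<close> to \<open>y\<close> in \<open>n\<close> steps on the whole grid.\<close>

definition grid_kernel :: "real \<Rightarrow> 'a::euclidean_space \<Rightarrow> nat \<Rightarrow> 'a \<Rightarrow> real" where
  "grid_kernel h x\<^sub>0 n y = (\<Prod>i\<in>Basis. coin n ((y - x\<^sub>0) \<bullet> i / h))"

lemma avg_grid_kernel:
  fixes x\<^sub>0 :: "'a::euclidean_space"
  assumes "h > 0"
  shows "avg h Basis (grid_kernel h x\<^sub>0 n) y = grid_kernel h x\<^sub>0 (Suc n) y"
proof -
  let ?r = "\<lambda>i. (y - x\<^sub>0) \<bullet> i / h"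
  have inner: "(y + h *\<^sub>R (\<Sum>j\<in>Basis. g j *\<^sub>R j) - x\<^sub>0) \<bullet> i / h = ?r i + g i" if "i \<in> Basis" for g i
    using that assms by (simp add: inner_diff_left inner_add_left field_simps)
  have "(\<Sum>g\<in>signs Basis. grid_kernel h x\<^sub>0 n (y + h *\<^sub>R (\<Sum>j\<in>Basis. g j *\<^sub>R j)))
      = (\<Sum>g\<in>signs Basis. \<Prod>i\<in>Basis. coin n (?r i + g i))"
    unfolding grid_kernel_def by (intro sum.cong prod.cong refl) (simp add: inner)
  also have "\<dots> = (\<Prod>i\<in>Basis. \<Sum>\<epsilon>\<in>{-1, 1}. coin n (?r i + \<epsilon>))"
    unfolding signs_def by (rule prod_sum_PiE[symmetric]) auto
  also have "\<dots> = (\<Prod>i\<in>Basis. 2 * coin (Suc n) (?r i))"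
    by (intro prod.cong) (auto simp: coin_Suc)
  also have "\<dots> = 2 ^ DIM('a) * grid_kernel h x\<^sub>0 (Suc n) y"
    by (simp add: prod.distrib grid_kernel_def)
  finally show ?thesis by (simp add: avg_def)
qed

lemma grid_kernel_le:
  fixes x\<^sub>0 :: "'a::euclidean_space"
  assumes "even n"
  shows "grid_kernel h x\<^sub>0 n y \<le> (1 / sqrt (real (n + 1))) ^ DIM('a)"
proof -
  have "grid_kernel h x\<^sub>0 n y \<le> (\<Prod>i\<in>(Basis::'a set). 1 / sqrt (real (n + 1)))"
    unfolding grid_kernel_def using coin_le[OF assms] by (intro prod_mono) (auto simp: coin_nonneg)
  then show ?thesis by simp
qed

definition delta :: "'a \<Rightarrow> 'a \<Rightarrow> real" where
  "delta x\<^sub>0 y = of_bool (y = x\<^sub>0)"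

text \<open>Killing can only decrease the transition probabilities.\<close>

lemma walk_pow_delta_le:
  fixes x\<^sub>0 :: "'a::euclidean_space"
  assumes "h > 0"
  shows "(walk h X ^^ n) (delta x\<^sub>0) y \<le> grid_kernel h x\<^sub>0 n y"
proof (induction n arbitrary: y)
  case 0
  have "grid_kernel h x\<^sub>0 0 y = delta x\<^sub>0 y"
  proof -
    have "grid_kernel h x\<^sub>0 0 y = (\<Prod>i\<in>Basis. of_bool ((y - x\<^sub>0) \<bullet> i = 0))"
      using assms unfolding grid_kernel_def by (intro prod.cong) (auto simp: coin_def)
    also have "\<dots> = of_bool (\<forall>i\<in>Basis. (y - x\<^sub>0) \<bullet> i = 0)"
      by (auto simp: prod_zero_iff intro: prod.neutral)
    also have "(\<forall>i\<in>Basis. (y - x\<^sub>0) \<bullet> i = 0) \<longleftrightarrow> y - x\<^sub>0 = 0"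
      by (auto simp: euclidean_all_zero_iff)
    finally show ?thesis by (simp add: delta_def)
  qed
  then show ?case by simp
next
  case (Suc n)
  have nn: "0 \<le> grid_kernel h x\<^sub>0 n z" for n z
    by (auto simp: grid_kernel_def intro!: prod_nonneg coin_nonneg)
  have "walk h X ((walk h X ^^ n) (delta x\<^sub>0)) y \<le> avg h Basis (grid_kernel h x\<^sub>0 n) y"
  proof (cases "y \<in> X")
    case True
    have "avg h Basis (\<lambda>z. if z \<in> X then (walk h X ^^ n) (delta x\<^sub>0) z else 0) y
        \<le> avg h Basis (grid_kernel h x\<^sub>0 n) y"
      using Suc nn by (intro avg_mono) auto
    then show ?thesis using True by (simp add: walk_def)
  next
    case False
    then show ?thesis by (simp add: walk_def avg_grid_kernel[OF assms] nn)
  qed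
  then show ?case by (simp add: avg_grid_kernel[OF assms])
qed

text \<open>The mass is at most one, and after \<open>n\<close> steps no point carries more than order \<open>n powr (- N / 2)\<close>
of it. For even \<open>n\<close> the largest binomial coefficient is the central one.\<close>

lemma walk_pow_delta_norm:
  fixes x\<^sub>0 :: "'a::euclidean_space"
  assumes "h > 0" "finite X" "even n"
  shows "(\<Sum>x\<in>X. ((walk h X ^^ n) (delta x\<^sub>0) x)\<^sup>2) \<le> (1 / sqrt (real (n + 1))) ^ DIM('a)"
proof -
  let ?v = "\<lambda>n. (walk h X ^^ n) (delta x\<^sub>0)" and ?c = "(1 / sqrt (real (n + 1))) ^ DIM('a)"
  have nn: "0 \<le> ?v n x" for n x
    by (induction n arbitrary: x) (auto simp: delta_def intro: walk_nonneg)
  have s: "(\<Sum>x\<in>X. ?v n x) \<le> 1" for n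
  proof (induction n)
    case 0
    then show ?case using assms by (simp add: delta_def sum_of_bool_eq card_le_Suc0_iff_eq)
  next
    case (Suc n)
    then show ?case using sum_walk_le[OF assms(2), of "?v n" h] nn by (auto intro: order_trans)
  qed
  have "(\<Sum>x\<in>X. (?v n x)\<^sup>2) \<le> (\<Sum>x\<in>X. ?c * ?v n x)"
    unfolding power2_eq_square
    by (intro sum_mono mult_right_mono nn order_trans[OF walk_pow_delta_le grid_kernel_le] assms)
  also have "\<dots> = ?c * (\<Sum>x\<in>X. ?v n x)" by (simp add: sum_distrib_left)
  also have "\<dots> \<le> ?c" using s by (intro mult_left_le) auto
  finally show ?thesis .
qed

lemma abs_le_if_square_le: "x\<^sup>2 \<le> y\<^sup>2 \<Longrightarrow> 0 \<le> y \<Longrightarrow> \<bar>x\<bar> \<le> (y::real)"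
  using abs_le_square_iff[of x y] by simp

text \<open>Of the \<open>2 * m * (5 * k)\<close> steps that lead to the first term of the difference, the last
\<open>2 * m * k\<close> are moved by symmetry to the point mass at \<open>x\<^sub>0\<close>, where they produce the smoothing
factor; the others give the decay \<open>5 ^ (- k)\<close> for \<open>n = 4\<close>. The block of \<open>2 * m\<close> steps is the
operator \<open>S\<close>.\<close>

lemma walk_difference_bound:
  fixes x\<^sub>0 :: "'a::euclidean_space"
  assumes "h > 0" "finite X" "x\<^sub>0 \<in> X" and q: "\<And>x. x \<in> X \<Longrightarrow> \<bar>q x\<bar> \<le> K"
  shows "\<bar>(dif ^^ k) (\<lambda>i. (walk h X ^^ (2 * m * k + 2 * m * i)) q x\<^sub>0) (4 * k)\<bar>
     \<le> K * sqrt ((1 / sqrt (real (2 * m * k + 1))) ^ DIM('a) * real (card X)) / 5 ^ k"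
proof -
  let ?W = "walk h X" and ?M = "walk h X ^^ m"
  interpret W: symmetric_contraction X ?W by (rule walk_symmetric_contraction[OF assms(2)])
  interpret M: symmetric_contraction X ?M by (rule W.pow_symmetric_contraction)
  define z where "z = (?M ^^ (2 * (4 * k))) ((M.incr ^^ k) q)"
  have 1: "(?W ^^ (2 * m * k + 2 * m * i)) q = (?M ^^ (2 * i)) ((?M ^^ (2 * k)) q)" for i
  proof -
    have "2 * m * k + 2 * m * i = m * (2 * i) + m * (2 * k)" by simp
    then show ?thesis by (simp only: funpow_add o_apply funpow_mult)
  qed
  have commute: "(?M ^^ i) ((?M ^^ j) v) = (?M ^^ j) ((?M ^^ i) v)" for i j v
    by (metis add.commute comp_apply funpow_add)
  have "(dif ^^ k) (\<lambda>i. (?W ^^ (2 * m * k + 2 * m * i)) q x\<^sub>0) (4 * k)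
      = (?M ^^ (2 * (4 * k))) ((M.incr ^^ k) ((?M ^^ (2 * k)) q)) x\<^sub>0"
    unfolding 1 by (rule M.dif_pow)
  also have "\<dots> = (?M ^^ (2 * k)) z x\<^sub>0"
    unfolding z_def M.pow_incr_pow_commute[symmetric] by (subst commute) (rule refl)
  also have "\<dots> = (\<Sum>x\<in>X. delta x\<^sub>0 x * (?M ^^ (2 * k)) z x)"
  proof -
    have "(\<Sum>x\<in>X. delta x\<^sub>0 x * (?M ^^ (2 * k)) z x) = (\<Sum>x\<in>{x\<^sub>0}. delta x\<^sub>0 x * (?M ^^ (2 * k)) z x)"
      by (rule sum.mono_neutral_right) (use assms in \<open>auto simp: delta_def\<close>)
    then show ?thesis by (simp add: delta_def)
  qed
  also have "\<dots> = (\<Sum>x\<in>X. (?M ^^ (2 * k)) (delta x\<^sub>0) x * z x)" by (rule M.pow_sym[symmetric])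
  finally have eq: "(dif ^^ k) (\<lambda>i. (?W ^^ (2 * m * k + 2 * m * i)) q x\<^sub>0) (4 * k) = \<dots>" .
  have d: "(\<Sum>x\<in>X. ((?M ^^ (2 * k)) (delta x\<^sub>0) x)\<^sup>2) \<le> (1 / sqrt (real (2 * m * k + 1))) ^ DIM('a)"
    using walk_pow_delta_norm[OF assms(1,2), of "m * (2 * k)" x\<^sub>0] by (simp add: funpow_mult mult_ac)
  have "(\<Sum>x\<in>X. (z x)\<^sup>2) * 5 ^ (2 * k) \<le> (\<Sum>x\<in>X. (q x)\<^sup>2)"
    using M.difference_power_decay[of 4 k q] by (simp add: z_def)
  also have "\<dots> \<le> (\<Sum>x\<in>X. K\<^sup>2)"
    using q by (intro sum_mono) (metis abs_ge_zero power2_abs power_mono)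
  finally have z: "(\<Sum>x\<in>X. (z x)\<^sup>2) \<le> K\<^sup>2 * card X / (5 ^ k)\<^sup>2"
    by (subst pos_le_divide_eq) (auto simp: mult_ac simp flip: power_mult)
  have "(\<Sum>x\<in>X. (?M ^^ (2 * k)) (delta x\<^sub>0) x * z x)\<^sup>2
      \<le> (\<Sum>x\<in>X. ((?M ^^ (2 * k)) (delta x\<^sub>0) x)\<^sup>2) * (\<Sum>x\<in>X. (z x)\<^sup>2)"
    by (rule Cauchy_Schwarz_ineq_sum)
  also have "\<dots> \<le> (1 / sqrt (real (2 * m * k + 1))) ^ DIM('a) * (K\<^sup>2 * card X / (5 ^ k)\<^sup>2)"
    by (intro mult_mono d z sum_nonneg) auto
  also have "\<dots> = (K * sqrt ((1 / sqrt (real (2 * m * k + 1))) ^ DIM('a) * real (card X)) / 5 ^ k)\<^sup>2"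
    by (simp add: power_mult_distrib power_divide)
  finally show ?thesis
    unfolding eq using q[OF assms(3)] by (intro abs_le_if_square_le) auto
qed

section \<open>Consistency of the grid with the heat equation\<close>

text \<open>The equation \<open>ut x t = (\<Sum>i\<in>Basis. D2 i x t)\<close> is kept apart from the existence of the
derivatives, so that the predicate also applies to barriers, which satisfy only an inequality.\<close>

definition heat_data ::
  "'a::euclidean_space set \<Rightarrow> ('a \<Rightarrow> real \<Rightarrow> real) \<Rightarrow> ('a \<Rightarrow> real \<Rightarrow> real) \<Rightarrow>
     ('a \<Rightarrow> 'a \<Rightarrow> real \<Rightarrow> real) \<Rightarrow> ('a \<Rightarrow> 'a \<Rightarrow> real \<Rightarrow> real) \<Rightarrow> bool" where
  "heat_data U u ut D1 D2 \<longleftrightarrow> (\<forall>x\<in>U. \<forall>t>0.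
     ((\<lambda>s. u x s) has_real_derivative ut x t) (at t) \<and>
     (\<forall>i\<in>Basis. ((\<lambda>s. u (x + s *\<^sub>R i) t) has_real_derivative D1 i x t) (at 0) \<and>
        ((\<lambda>s. D1 i (x + s *\<^sub>R i) t) has_real_derivative D2 i x t) (at 0)))"

lemma heat_dataD:
  assumes "heat_data U u ut D1 D2" "0 < t"
  shows "x \<in> U \<Longrightarrow> ((\<lambda>s. u x s) has_real_derivative ut x t) (at t)"
    and "i \<in> Basis \<Longrightarrow> x + s *\<^sub>R i \<in> U \<Longrightarrow> ((\<lambda>s. u (x + s *\<^sub>R i) t) has_real_derivative D1 i (x + s *\<^sub>R i) t) (at s)"
    and "i \<in> Basis \<Longrightarrow> x + s *\<^sub>R i \<in> U \<Longrightarrow> ((\<lambda>s. D1 i (x + s *\<^sub>R i) t) has_real_derivative D2 i (x + s *\<^sub>R i) t) (at s)"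
proof -
  have *: "((\<lambda>r. F (x + r *\<^sub>R i)) has_real_derivative D) (at s)"
    if "((\<lambda>r. F (x + s *\<^sub>R i + r *\<^sub>R i)) has_real_derivative D) (at 0)" for F :: "'a \<Rightarrow> real" and D
  proof -
    have "((\<lambda>r. F (x + (s + r) *\<^sub>R i)) has_real_derivative D) (at 0)"
      using that by (simp add: scaleR_add_left add.assoc)
    then show ?thesis using DERIV_shift[of "\<lambda>r. F (x + r *\<^sub>R i)" D 0 s] by (simp add: add.commute)
  qed
  show "x \<in> U \<Longrightarrow> ((\<lambda>s. u x s) has_real_derivative ut x t) (at t)"
    using assms by (simp add: heat_data_def)
  show "i \<in> Basis \<Longrightarrow> x + s *\<^sub>R i \<in> U \<Longrightarrow> ((\<lambda>s. u (x + s *\<^sub>R i) t) has_real_derivative D1 i (x + s *\<^sub>R i) t) (at s)"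
    by (rule *[of "\<lambda>y. u y t"]) (use assms in \<open>simp add: heat_data_def\<close>)
  show "i \<in> Basis \<Longrightarrow> x + s *\<^sub>R i \<in> U \<Longrightarrow> ((\<lambda>s. D1 i (x + s *\<^sub>R i) t) has_real_derivative D2 i (x + s *\<^sub>R i) t) (at s)"
    by (rule *[of "\<lambda>y. D1 i y t"]) (use assms in \<open>simp add: heat_data_def\<close>)
qed

text \<open>Second-order Taylor expansion in both directions; the odd terms cancel.\<close>

lemma symmetric_difference_bound:
  fixes f f' f'' :: "real \<Rightarrow> real"
  assumes h: "0 < h" and f: "\<And>s. \<bar>s\<bar> \<le> h \<Longrightarrow> (f has_real_derivative f' s) (at s)"
    and f': "\<And>s. \<bar>s\<bar> \<le> h \<Longrightarrow> (f' has_real_derivative f'' s) (at s)"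
    and L: "\<And>s. \<bar>s\<bar> \<le> h \<Longrightarrow> \<bar>f'' s - L\<bar> \<le> \<omega>"
  shows "\<bar>(f h + f (- h)) / 2 - f 0 - h\<^sup>2 / 2 * L\<bar> \<le> h\<^sup>2 / 2 * \<omega>"
proof -
  define d where "d m = (if m = 0 then f else if m = 1 then f' else f'')" for m :: nat
  have T: "\<exists>t. (if x < 0 then x < t \<and> t < 0 else 0 < t \<and> t < x) \<and>
       f x = (\<Sum>m<2. d m 0 / fact m * (x - 0) ^ m) + d 2 t / fact 2 * (x - 0) ^ 2"
    if "x = h \<or> x = - h" for x
    by (rule Taylor[where a = "- h" and b = h]) (use h that f f' in \<open>auto simp: d_def less_2_cases_iff\<close>)
  obtain a where a: "\<bar>a\<bar> \<le> h" "f h = f 0 + f' 0 * h + f'' a / 2 * h\<^sup>2"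
  proof -
    obtain a where "0 < a" "a < h" "f h = f 0 + f' 0 * h + f'' a / 2 * h\<^sup>2"
      using T[of h] h by (auto simp: d_def numeral_2_eq_2)
    then show ?thesis by (intro that[of a]) auto
  qed
  obtain b where b: "\<bar>b\<bar> \<le> h" "f (- h) = f 0 - f' 0 * h + f'' b / 2 * h\<^sup>2"
  proof -
    obtain b where "- h < b" "b < 0" "f (- h) = f 0 - f' 0 * h + f'' b / 2 * h\<^sup>2"
      using T[of "- h"] h by (auto simp: d_def numeral_2_eq_2)
    then show ?thesis by (intro that[of b]) auto
  qed
  have e: "(f h + f (- h)) / 2 - f 0 - h\<^sup>2 / 2 * L = h\<^sup>2 / 2 * (((f'' a - L) + (f'' b - L)) / 2)"
    unfolding a(2) b(2) by (simp add: field_simps)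
  have "\<bar>((f'' a - L) + (f'' b - L)) / 2\<bar> \<le> \<omega>"
    using abs_triangle_ineq[of "f'' a - L" "f'' b - L"] L[OF a(1)] L[OF b(1)] by simp
  then show ?thesis unfolding e abs_mult by (intro mult_mono) auto
qed

lemma norm_signs_le:
  assumes "g \<in> signs B" "B \<subseteq> (Basis :: 'a::euclidean_space set)"
  shows "norm (\<Sum>j\<in>B. g j *\<^sub>R j) \<le> real (card B)"
proof -
  have "norm (\<Sum>j\<in>B. g j *\<^sub>R j) \<le> (\<Sum>j\<in>B. 1)"
    by (rule sum_norm_le) (use assms in \<open>auto simp: signs_def PiE_iff subset_iff\<close>)
  then show ?thesis by simp
qed

lemma abs_avg_le:
  assumes "finite B" "\<And>g. g \<in> signs B \<Longrightarrow> \<bar>v (x + h *\<^sub>R (\<Sum>j\<in>B. g j *\<^sub>R j))\<bar> \<le> c"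
  shows "\<bar>avg h B v x\<bar> \<le> c"
proof -
  have "avg h B v x \<le> avg h B (\<lambda>_. c) x" "avg h B (\<lambda>_. - c) x \<le> avg h B v x"
    using assms(2) by (intro avg_mono; force simp: abs_le_iff)+
  then show ?thesis by (simp add: avg_const assms(1))
qed

lemma avg_insert:
  assumes "finite B" "i \<notin> B"
  shows "avg h (insert i B) v x = avg h B (\<lambda>y. (v (y + h *\<^sub>R i) + v (y - h *\<^sub>R i)) / 2) x"
proof -
  have s: "(\<Sum>j\<in>insert i B. (g(i := e)) j *\<^sub>R j) = (\<Sum>j\<in>B. g j *\<^sub>R j) + e *\<^sub>R i" for g e
    using assms by (simp add: add.commute) (intro sum.cong, auto)
  have "(\<Sum>g\<in>signs (insert i B). v (x + h *\<^sub>R (\<Sum>j\<in>insert i B. g j *\<^sub>R j)))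
     = (\<Sum>(e, g)\<in>{-1, 1} \<times> signs B. v (x + h *\<^sub>R (\<Sum>j\<in>insert i B. (g(i := e)) j *\<^sub>R j)))"
    unfolding signs_def PiE_insert_eq
    by (subst sum.reindex) (use assms inj_combinator[of i B "\<lambda>_. {-1, 1 :: real}"] in \<open>auto simp: o_def case_prod_unfold\<close>)
  also have "\<dots> = (\<Sum>e\<in>{-1, 1}. \<Sum>g\<in>signs B. v (x + h *\<^sub>R (\<Sum>j\<in>insert i B. (g(i := e)) j *\<^sub>R j)))"
    by (rule sum.cartesian_product[symmetric])
  also have "\<dots> = (\<Sum>g\<in>signs B. v (x + h *\<^sub>R (\<Sum>j\<in>B. g j *\<^sub>R j) + h *\<^sub>R i)
      + v (x + h *\<^sub>R (\<Sum>j\<in>B. g j *\<^sub>R j) - h *\<^sub>R i))"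
    unfolding s by (simp add: sum.distrib algebra_simps)
  finally show ?thesis using assms by (simp add: avg_def flip: sum_divide_distrib)
qed

text \<open>Averaging one coordinate after the other reduces the claim to dimension one: the average over
\<open>insert i B\<close> differs from that over \<open>B\<close> by an average of symmetric second differences in the
direction \<open>i\<close>, taken at shifted points.\<close>

lemma avg_consistency:
  fixes x :: "'a::euclidean_space"
  assumes u: "heat_data U u ut D1 D2" "0 < t" and h: "0 < h"
    and "finite B" "B \<subseteq> Basis"
    and U: "\<And>y. dist x y \<le> h * real (card B) \<Longrightarrow> y \<in> U"
    and L: "\<And>y i. dist x y \<le> h * real (card B) \<Longrightarrow> i \<in> B \<Longrightarrow> \<bar>D2 i y t - L i\<bar> \<le> \<omega>"
  shows "\<bar>avg h B (\<lambda>y. u y t) x - u x t - h\<^sup>2 / 2 * (\<Sum>i\<in>B. L i)\<bar> \<le> real (card B) * (h\<^sup>2 / 2 * \<omega>)"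
  using assms(4-)
proof (induction B rule: finite_induct)
  case empty
  then show ?case by (simp add: avg_def signs_def)
next
  case (insert i B)
  have c: "h * real (card (insert i B)) = h * real (card B) + h" using insert by (simp add: algebra_simps)
  have IH: "\<bar>avg h B (\<lambda>y. u y t) x - u x t - h\<^sup>2 / 2 * (\<Sum>i\<in>B. L i)\<bar> \<le> real (card B) * (h\<^sup>2 / 2 * \<omega>)"
    using insert.prems h unfolding c by (intro insert.IH) auto
  define v where "v y = (u (y + h *\<^sub>R i) t + u (y - h *\<^sub>R i) t) / 2 - u y t - h\<^sup>2 / 2 * L i" for y
  have "\<bar>avg h B v x\<bar> \<le> h\<^sup>2 / 2 * \<omega>"
  proof (rule abs_avg_le)
    fix g assume g: "g \<in> signs B"
    define y where "y = x + h *\<^sub>R (\<Sum>j\<in>B. g j *\<^sub>R j)"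
    have "dist x y \<le> h * real (card B)"
      using norm_signs_le[OF g] insert.prems h by (simp add: y_def dist_norm)
    moreover have "dist y (y + s *\<^sub>R i) \<le> h" if "\<bar>s\<bar> \<le> h" for s
      using that insert.prems by (simp add: dist_norm)
    ultimately have near: "dist x (y + s *\<^sub>R i) \<le> h * real (card (insert i B))" if "\<bar>s\<bar> \<le> h" for s
      unfolding c using that dist_triangle[of x "y + s *\<^sub>R i" y] by fastforce
    have i: "i \<in> Basis" using insert.prems by auto
    have "\<bar>(u (y + h *\<^sub>R i) t + u (y + (- h) *\<^sub>R i) t) / 2 - u (y + 0 *\<^sub>R i) t - h\<^sup>2 / 2 * L i\<bar> \<le> h\<^sup>2 / 2 * \<omega>"
      by (rule symmetric_difference_bound[where f = "\<lambda>s. u (y + s *\<^sub>R i) t" and f' = "\<lambda>s. D1 i (y + s *\<^sub>R i) t"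
            and f'' = "\<lambda>s. D2 i (y + s *\<^sub>R i) t"])
        (use h near insert.prems heat_dataD[OF u] i in \<open>auto\<close>)
    then show "\<bar>v (x + h *\<^sub>R (\<Sum>j\<in>B. g j *\<^sub>R j))\<bar> \<le> h\<^sup>2 / 2 * \<omega>" by (simp add: v_def flip: y_def)
  qed fact
  moreover have "avg h (insert i B) (\<lambda>y. u y t) x = avg h B v x + avg h B (\<lambda>y. u y t) x + h\<^sup>2 / 2 * L i"
    unfolding avg_insert[OF insert.hyps] v_def avg_diff by (simp add: avg_const insert.hyps)
  moreover have "real (card (insert i B)) * (h\<^sup>2 / 2 * \<omega>) = real (card B) * (h\<^sup>2 / 2 * \<omega>) + h\<^sup>2 / 2 * \<omega>"
    "h\<^sup>2 / 2 * (\<Sum>i\<in>insert i B. L i) = h\<^sup>2 / 2 * L i + h\<^sup>2 / 2 * (\<Sum>i\<in>B. L i)"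
    using insert.hyps by (simp_all add: algebra_simps)
  ultimately show ?case using IH by linarith
qed

lemma grid_card:
  fixes X :: "'a::euclidean_space set"
  assumes h: "0 < h" and R: "\<And>x. x \<in> X \<Longrightarrow> norm x \<le> R" "norm x\<^sub>0 \<le> R"
    and grid: "\<And>x i. x \<in> X \<Longrightarrow> i \<in> Basis \<Longrightarrow> \<exists>z::int. x \<bullet> i = x\<^sub>0 \<bullet> i + h * of_int z"
  shows "finite X" "real (card X) \<le> (4 * R / h + 1) ^ DIM('a)"
proof -
  define M where "M = \<lfloor>2 * R / h\<rfloor>"
  define c where "c x = restrict (\<lambda>i. \<lfloor>(x \<bullet> i - x\<^sub>0 \<bullet> i) / h\<rfloor>) (Basis :: 'a set)" for x
  have M: "0 \<le> M" using order_trans[OF norm_ge_zero R(2)] h by (simp add: M_def)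
  let ?P = "PiE (Basis :: 'a set) (\<lambda>_. {-M..M})"
  have cX: "x \<bullet> i = x\<^sub>0 \<bullet> i + h * of_int (c x i)" "c x i \<in> {-M..M}" if x: "x \<in> X" and i: "i \<in> Basis" for x i
  proof -
    obtain z :: int where z: "x \<bullet> i = x\<^sub>0 \<bullet> i + h * of_int z" using grid[OF x i] by blast
    then have cz: "c x i = z" using h i by (simp add: c_def)
    have "\<bar>h * of_int z\<bar> \<le> 2 * R"
      using z R(1)[OF x] R(2) Basis_le_norm[OF i, of x] Basis_le_norm[OF i, of x\<^sub>0] by linarith
    then have "\<bar>real_of_int z\<bar> \<le> 2 * R / h" using h by (simp add: abs_mult field_simps)
    then have "of_int \<bar>z\<bar> \<le> 2 * R / h" by simp
    then have "\<bar>z\<bar> \<le> M" unfolding M_def by (rule le_floor_iff[THEN iffD2])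
    then show "c x i \<in> {-M..M}" using cz by auto
    show "x \<bullet> i = x\<^sub>0 \<bullet> i + h * of_int (c x i)" using z cz by simp
  qed
  have inj: "inj_on c X"
    by (rule inj_onI, rule euclidean_eqI) (metis cX(1))
  have sub: "c ` X \<subseteq> ?P" using cX(2) by (auto simp: PiE_iff c_def)
  have fP: "finite ?P" by (intro finite_PiE) auto
  show "finite X" using finite_subset[OF sub fP] inj by (rule finite_imageD)
  have "card X \<le> card ?P" using card_inj_on_le[OF inj sub fP] .
  also have "card ?P = nat (2 * M + 1) ^ DIM('a)" by (simp add: card_PiE)
  finally have "real (card X) \<le> real (nat (2 * M + 1)) ^ DIM('a)" by (metis of_nat_le_iff of_nat_power)
  also have "\<dots> \<le> (4 * R / h + 1) ^ DIM('a)"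
  proof (rule power_mono)
    have "of_int M \<le> 2 * R / h" unfolding M_def by (rule of_int_floor_le)
    then show "real (nat (2 * M + 1)) \<le> 4 * R / h + 1" using M by simp
  qed simp
  finally show "real (card X) \<le> (4 * R / h + 1) ^ DIM('a)" .
qed

section \<open>Finite differences in time at an interior point\<close>

text \<open>Bounded solutions with zero boundary values. Time \<open>0\<close> is left out, since solutions whose
boundary and initial values are incompatible are discontinuous there.\<close>

definition dirichlet_caloric :: "'a::euclidean_space set \<Rightarrow> ('a \<Rightarrow> real \<Rightarrow> real) \<Rightarrow> real \<Rightarrow> bool" where
  "dirichlet_caloric \<Omega> w K \<longleftrightarrow> (\<exists>wt D1 D2. heat_data \<Omega> w wt D1 D2 \<and>
     (\<forall>x\<in>\<Omega>. \<forall>t>0. wt x t = (\<Sum>i\<in>Basis. D2 i x t)) \<and>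
     continuous_on (\<Omega> \<times> {0<..}) (\<lambda>(x, t). wt x t) \<and>
     (\<forall>i\<in>Basis. continuous_on (\<Omega> \<times> {0<..}) (\<lambda>(x, t). D2 i x t))) \<and>
   continuous_on (closure \<Omega> \<times> {0<..}) (\<lambda>(x, t). w x t) \<and>
   (\<forall>x\<in>frontier \<Omega>. \<forall>t>0. w x t = 0) \<and> (\<forall>x\<in>closure \<Omega>. \<forall>t>0. \<bar>w x t\<bar> \<le> K)"

lemma closed_inner_core: "closed {x. ball x r \<subseteq> S}"
proof -
  have "- {x. ball x r \<subseteq> S} = (\<Union>y\<in>-S. ball y r)"
    by (auto simp: subset_iff dist_commute)
  then show ?thesis by (metis closed_def open_UN open_ball)
qed

text \<open>By compactness the points where \<open>w\<close> is not small at some time in \<open>[\<delta>, T]\<close> stay away from the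
boundary; so killing the walk near the boundary, instead of on it, changes little.\<close>

lemma small_near_boundary:
  fixes \<Omega> :: "'a::euclidean_space set"
  assumes \<Omega>: "open \<Omega>" "bounded \<Omega>" and w: "dirichlet_caloric \<Omega> w K"
    and "0 < \<delta>" "0 < \<eta>" "x\<^sub>0 \<in> \<Omega>"
  obtains r where "0 < r" "ball x\<^sub>0 r \<subseteq> \<Omega>"
    "\<And>x t. x \<in> \<Omega> \<Longrightarrow> \<not> ball x r \<subseteq> \<Omega> \<Longrightarrow> \<delta> \<le> t \<Longrightarrow> t \<le> T \<Longrightarrow> \<bar>w x t\<bar> \<le> \<eta>"
proof -
  have cl: "compact (closure \<Omega> \<times> {\<delta>..T})" using \<Omega> by (intro compact_Times) auto
  have cont: "continuous_on (closure \<Omega> \<times> {\<delta>..T}) (\<lambda>(x, t). w x t)"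
    using w \<open>0 < \<delta>\<close> unfolding dirichlet_caloric_def by (auto elim!: continuous_on_subset)
  define A where "A = closure \<Omega> \<times> {\<delta>..T} \<inter> (\<lambda>p. \<bar>(\<lambda>(x, t). w x t) p\<bar>) -` {\<eta>..}"
  have "closed A" unfolding A_def
    by (intro continuous_closed_preimage continuous_intros cont compact_imp_closed cl)
  moreover have "bounded A" using bounded_subset[OF compact_imp_bounded[OF cl]] by (auto simp: A_def)
  ultimately have "compact A" by (simp add: compact_eq_bounded_closed)
  then have cA: "compact (insert x\<^sub>0 (fst ` A))"
    by (intro compact_insert compact_continuous_image continuous_intros)
  have "insert x\<^sub>0 (fst ` A) \<subseteq> \<Omega>"
  proof -
    have "x \<in> \<Omega>" if "(x, t) \<in> A" for x t
    proof (rule ccontr)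
      assume "x \<notin> \<Omega>"
      then have "x \<in> frontier \<Omega>" using that \<Omega> by (auto simp: A_def frontier_def interior_open)
      then have "w x t = 0" using w that \<open>0 < \<delta>\<close> by (auto simp: dirichlet_caloric_def A_def)
      then show False using that \<open>0 < \<eta>\<close> by (auto simp: A_def)
    qed
    then show ?thesis using assms by auto
  qed
  then obtain r where r: "r > 0" "(\<Union>x\<in>insert x\<^sub>0 (fst ` A). cball x r) \<subseteq> \<Omega>"
    using compact_subset_open_imp_cball_epsilon_subset[OF cA \<Omega>(1)] by blast
  show ?thesis
  proof
    show "0 < r" by fact
    show "ball x\<^sub>0 r \<subseteq> \<Omega>" using r(2) ball_subset_cball[of x\<^sub>0 r] by auto
    fix x t assume x: "x \<in> \<Omega>" "\<not> ball x r \<subseteq> \<Omega>" and t: "\<delta> \<le> t" "t \<le> T"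
    show "\<bar>w x t\<bar> \<le> \<eta>"
    proof (rule ccontr)
      assume "\<not> \<bar>w x t\<bar> \<le> \<eta>"
      then have "(x, t) \<in> A" using x t closure_subset[of \<Omega>] by (auto simp: A_def)
      then have "cball x r \<subseteq> \<Omega>" using r(2) by (force simp: UN_subset_iff)
      then show False using x ball_subset_cball[of x r] by auto
    qed
  qed
qed

lemma uniform_modulus:
  fixes C :: "'a::euclidean_space set" and F :: "'i \<Rightarrow> 'a \<Rightarrow> real \<Rightarrow> real"
  assumes "compact C" "finite I" "0 < \<omega>"
    and "\<And>i. i \<in> I \<Longrightarrow> continuous_on (C \<times> {\<delta>..T}) (\<lambda>(x, t). F i x t)"
  obtains \<rho> where "0 < \<rho>" "\<And>i x y t s. i \<in> I \<Longrightarrow> x \<in> C \<Longrightarrow> y \<in> C \<Longrightarrow> t \<in> {\<delta>..T} \<Longrightarrow> s \<in> {\<delta>..T} \<Longrightarrow>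
     dist (x, t) (y, s) < \<rho> \<Longrightarrow> \<bar>F i x t - F i y s\<bar> \<le> \<omega>"
proof -
  have "\<exists>\<rho>>0. \<forall>x\<in>C. \<forall>y\<in>C. \<forall>t\<in>{\<delta>..T}. \<forall>s\<in>{\<delta>..T}. dist (x, t) (y, s) < \<rho> \<longrightarrow> \<bar>F i x t - F i y s\<bar> \<le> \<omega>"
    if "i \<in> I" for i
  proof -
    have "uniformly_continuous_on (C \<times> {\<delta>..T}) (\<lambda>(x, t). F i x t)"
      using that assms by (intro compact_uniformly_continuous compact_Times) auto
    from this[unfolded uniformly_continuous_on_def, rule_format, OF \<open>0 < \<omega>\<close>]
    show ?thesis by (fastforce simp: dist_real_def abs_minus_commute intro: less_imp_le)
  qed
  then obtain \<rho> where \<rho>: "\<And>i. i \<in> I \<Longrightarrow> 0 < \<rho> i"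
    "\<And>i x y t s. i \<in> I \<Longrightarrow> x \<in> C \<Longrightarrow> y \<in> C \<Longrightarrow> t \<in> {\<delta>..T} \<Longrightarrow> s \<in> {\<delta>..T} \<Longrightarrow>
     dist (x, t) (y, s) < \<rho> i \<Longrightarrow> \<bar>F i x t - F i y s\<bar> \<le> \<omega>"
    by metis
  show ?thesis
  proof (rule that[of "Min (insert 1 (\<rho> ` I))"])
    show "0 < Min (insert 1 (\<rho> ` I))" using assms(2) \<rho>(1) by auto
    fix i x y t s
    assume i: "i \<in> I" and *: "x \<in> C" "y \<in> C" "t \<in> {\<delta>..T}" "s \<in> {\<delta>..T}"
      and d: "dist (x, t) (y, s) < Min (insert 1 (\<rho> ` I))"
    have "Min (insert 1 (\<rho> ` I)) \<le> \<rho> i" using i assms(2) by auto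
    then show "\<bar>F i x t - F i y s\<bar> \<le> \<omega>" using \<rho>(2)[OF i *] d by linarith
  qed
qed

text \<open>The time step \<open>h\<^sup>2 / 2\<close> matches the mesh \<open>h\<close>. The error is of smaller order than the time
step, uniformly on the inner core, because the derivatives of \<open>w\<close> are uniformly continuous
there.\<close>

lemma grid_consistency:
  fixes \<Omega> :: "'a::euclidean_space set"
  assumes \<Omega>: "open \<Omega>" "bounded \<Omega>" and w: "dirichlet_caloric \<Omega> w K"
    and "0 < \<delta>" "0 < \<omega>" "0 < r"
  obtains h\<^sub>0 where "0 < h\<^sub>0" "\<And>h x t. 0 < h \<Longrightarrow> h < h\<^sub>0 \<Longrightarrow> ball x r \<subseteq> \<Omega> \<Longrightarrow> \<delta> \<le> t \<Longrightarrow> t + h\<^sup>2 / 2 \<le> T \<Longrightarrow>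
     \<bar>w x (t + h\<^sup>2 / 2) - avg h Basis (\<lambda>y. w y t) x\<bar> \<le> h\<^sup>2 / 2 * \<omega>"
proof -
  let ?N = "real DIM('a)"
  define \<kappa> where "\<kappa> = \<omega> / (?N + 1)"
  have "0 < ?N + 1" by linarith
  then have \<kappa>: "0 < \<kappa>" "(?N + 1) * \<kappa> = \<omega>" using \<open>0 < \<omega>\<close> by (simp_all add: \<kappa>_def)
  obtain wt D1 D2 where hd: "heat_data \<Omega> w wt D1 D2"
    and eq: "\<And>x t. x \<in> \<Omega> \<Longrightarrow> 0 < t \<Longrightarrow> wt x t = (\<Sum>i\<in>Basis. D2 i x t)"
    and cwt: "continuous_on (\<Omega> \<times> {0<..}) (\<lambda>(x, t). wt x t)"
    and cD2: "\<And>i. i \<in> Basis \<Longrightarrow> continuous_on (\<Omega> \<times> {0<..}) (\<lambda>(x, t). D2 i x t)"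
    using w unfolding dirichlet_caloric_def by blast
  define C where "C = {x. ball x (r / 2) \<subseteq> \<Omega>}"
  have C\<Omega>: "C \<subseteq> \<Omega>" using \<open>0 < r\<close> by (auto simp: C_def subset_iff)
  have "compact C"
    using closed_inner_core[of "r / 2" \<Omega>] bounded_subset[OF \<Omega>(2) C\<Omega>] by (simp add: C_def compact_eq_bounded_closed)
  \<comment> \<open>One modulus of continuity for the time derivative (\<open>None\<close>) and all second derivatives.\<close>
  define F where "F i = (case i of None \<Rightarrow> wt | Some i \<Rightarrow> D2 i)" for i
  have sub: "C \<times> {\<delta>..T} \<subseteq> \<Omega> \<times> {0<..}" using C\<Omega> \<open>0 < \<delta>\<close> by auto
  have cF: "continuous_on (C \<times> {\<delta>..T}) (\<lambda>(x, t). F i x t)" if "i \<in> insert None (Some ` Basis)" for i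
    using that continuous_on_subset[OF cwt sub] continuous_on_subset[OF cD2 sub]
    by (auto simp: F_def)
  obtain \<rho> where \<rho>: "0 < \<rho>" and mod: "\<And>i x y t s. i \<in> insert None (Some ` Basis) \<Longrightarrow> x \<in> C \<Longrightarrow> y \<in> C \<Longrightarrow>
     t \<in> {\<delta>..T} \<Longrightarrow> s \<in> {\<delta>..T} \<Longrightarrow> dist (x, t) (y, s) < \<rho> \<Longrightarrow> \<bar>F i x t - F i y s\<bar> \<le> \<kappa>"
    by (rule uniform_modulus[OF \<open>compact C\<close> _ \<kappa>(1) cF, where I = "insert None (Some ` Basis)"]) auto
  have modt: "\<bar>wt x t - wt x s\<bar> \<le> \<kappa>" if "x \<in> C" "t \<in> {\<delta>..T}" "s \<in> {\<delta>..T}" "\<bar>t - s\<bar> < \<rho>" for x t s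
    using mod[of None x x t s] that by (simp add: F_def dist_Pair_Pair dist_real_def)
  have modx: "\<bar>D2 i x t - D2 i y t\<bar> \<le> \<kappa>" if "i \<in> Basis" "x \<in> C" "y \<in> C" "t \<in> {\<delta>..T}" "dist x y < \<rho>" for i x y t
    using mod[of "Some i" x y t t] that by (simp add: F_def dist_Pair_Pair)
  define h\<^sub>0 where "h\<^sub>0 = min 1 (min (r / 2) \<rho> / ?N)"
  have N: "?N \<ge> 1" by (simp add: DIM_positive Suc_leI)
  show ?thesis
  proof
    show "0 < h\<^sub>0" using \<rho> \<open>0 < r\<close> by (simp add: h\<^sub>0_def)
    fix h x t assume h: "0 < h" "h < h\<^sub>0" and x: "ball x r \<subseteq> \<Omega>" and t: "\<delta> \<le> t" "t + h\<^sup>2 / 2 \<le> T"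
    have hN: "h * ?N < r / 2" "h * ?N < \<rho>" "h < 1" using h by (auto simp: h\<^sub>0_def pos_less_divide_eq)
    define \<tau> where "\<tau> = h\<^sup>2 / 2"
    have "h\<^sup>2 \<le> h" using h hN by (simp add: power2_eq_square mult_left_le)
    moreover have "h * 1 \<le> h * ?N" using N h by (intro mult_left_mono) auto
    ultimately have "h\<^sup>2 < \<rho>" using hN by linarith
    then have \<tau>: "0 < \<tau>" "\<tau> < \<rho>" using h \<rho> by (auto simp: \<tau>_def)
    have nearC: "y \<in> C" if "dist x y \<le> h * ?N" for y
    proof -
      have "ball y (r / 2) \<subseteq> ball x r"
        using that hN by (subst ball_subset_ball_iff) (auto simp: dist_commute)
      then show ?thesis using x by (auto simp: C_def)
    qed
    have xC: "x \<in> C" using nearC[of x] h by simp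
    then have x\<Omega>: "x \<in> \<Omega>" using C\<Omega> by auto
    have t0: "0 < t" using t \<open>0 < \<delta>\<close> by auto
    obtain z where z: "t < z" "z < t + \<tau>" "w x (t + \<tau>) - w x t = (t + \<tau> - t) * wt x z"
      using MVT2[of t "t + \<tau>" "w x" "wt x"] heat_dataD(1)[OF hd _ x\<Omega>] t0 \<tau> by auto
    have "\<bar>\<tau> * wt x z - \<tau> * wt x t\<bar> \<le> \<tau> * \<kappa>"
    proof -
      have "\<bar>wt x z - wt x t\<bar> \<le> \<kappa>" using z t \<tau> by (intro modt[OF xC]) (auto simp: \<tau>_def)
      then show ?thesis using \<tau> by (simp add: abs_mult flip: right_diff_distrib)
    qed
    then have 1: "\<bar>w x (t + \<tau>) - w x t - \<tau> * wt x t\<bar> \<le> \<tau> * \<kappa>" using z by simp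
    have "\<bar>avg h Basis (\<lambda>y. w y t) x - w x t - h\<^sup>2 / 2 * (\<Sum>i\<in>Basis. D2 i x t)\<bar> \<le> ?N * (h\<^sup>2 / 2 * \<kappa>)"
    proof (rule avg_consistency[OF hd t0 h(1)])
      fix y i assume d: "dist x y \<le> h * ?N" and i: "i \<in> (Basis :: 'a set)"
      show "\<bar>D2 i y t - D2 i x t\<bar> \<le> \<kappa>"
        using d hN t(1) t(2)[folded \<tau>_def] \<tau>(1) by (intro modx[OF i nearC[OF d] xC]) (auto simp: dist_commute)
    qed (use nearC C\<Omega> in auto)
    then have "\<bar>avg h Basis (\<lambda>y. w y t) x - w x t - \<tau> * wt x t\<bar> \<le> ?N * (\<tau> * \<kappa>)"
      by (simp add: eq[OF x\<Omega> t0] \<tau>_def)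
    moreover have "\<tau> * \<kappa> + ?N * (\<tau> * \<kappa>) = \<tau> * \<omega>" by (simp add: \<kappa>(2)[symmetric] algebra_simps)
    ultimately show "\<bar>w x (t + h\<^sup>2 / 2) - avg h Basis (\<lambda>y. w y t) x\<bar> \<le> h\<^sup>2 / 2 * \<omega>"
      using 1 unfolding \<tau>_def[symmetric] by linarith
  qed
qed

text \<open>The discrete maximum principle: in each step the error is averaged and grows by at most the
consistency error, while killed steps contribute at most the small values of \<open>w\<close> near the boundary.
The number of steps times the length of a step is at most \<open>T\<close>.\<close>

lemma grid_approximation:
  fixes \<Omega> :: "'a::euclidean_space set"
  assumes \<Omega>: "open \<Omega>" "bounded \<Omega>" and w: "dirichlet_caloric \<Omega> w K"
    and "0 < \<delta>" "0 < T" "0 < \<eta>" "x\<^sub>0 \<in> \<Omega>"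
  obtains h\<^sub>0 where "0 < h\<^sub>0" "\<And>h. 0 < h \<Longrightarrow> h < h\<^sub>0 \<Longrightarrow> \<exists>X. finite X \<and> x\<^sub>0 \<in> X \<and> X \<subseteq> \<Omega> \<and>
     (\<forall>x\<in>X. \<forall>i\<in>Basis. \<exists>z::int. x \<bullet> i = x\<^sub>0 \<bullet> i + h * of_int z) \<and>
     (\<forall>n. \<forall>x\<in>X. \<delta> + real n * (h\<^sup>2 / 2) \<le> T \<longrightarrow>
        \<bar>w x (\<delta> + real n * (h\<^sup>2 / 2)) - (walk h X ^^ n) (\<lambda>x. w x \<delta>) x\<bar> \<le> \<eta>)"
proof -
  obtain r where r: "0 < r" "ball x\<^sub>0 r \<subseteq> \<Omega>"
    and small: "\<And>x t. x \<in> \<Omega> \<Longrightarrow> \<not> ball x r \<subseteq> \<Omega> \<Longrightarrow> \<delta> \<le> t \<Longrightarrow> t \<le> T \<Longrightarrow> \<bar>w x t\<bar> \<le> \<eta> / 2"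
    using small_near_boundary[OF \<Omega> w \<open>0 < \<delta>\<close> _ \<open>x\<^sub>0 \<in> \<Omega>\<close>, of "\<eta> / 2" T] \<open>0 < \<eta>\<close> by auto
  define \<omega> where "\<omega> = \<eta> / (2 * T)"
  have \<omega>: "0 < \<omega>" "T * \<omega> = \<eta> / 2" using \<open>0 < \<eta>\<close> \<open>0 < T\<close> by (auto simp: \<omega>_def)
  obtain h\<^sub>1 where h1: "0 < h\<^sub>1" and cons: "\<And>h x t. 0 < h \<Longrightarrow> h < h\<^sub>1 \<Longrightarrow> ball x r \<subseteq> \<Omega> \<Longrightarrow> \<delta> \<le> t \<Longrightarrow> t + h\<^sup>2 / 2 \<le> T \<Longrightarrow>
     \<bar>w x (t + h\<^sup>2 / 2) - avg h Basis (\<lambda>y. w y t) x\<bar> \<le> h\<^sup>2 / 2 * \<omega>"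
    using grid_consistency[OF \<Omega> w \<open>0 < \<delta>\<close> \<omega>(1) r(1)] by blast
  show ?thesis
  proof
    show "0 < min h\<^sub>1 (r / real DIM('a))" using h1 r by simp
    fix h assume h: "0 < h" "h < min h\<^sub>1 (r / real DIM('a))"
    define X where "X = {x. ball x r \<subseteq> \<Omega> \<and> (\<forall>i\<in>Basis. \<exists>z::int. x \<bullet> i = x\<^sub>0 \<bullet> i + h * of_int z)}"
    have X\<Omega>: "X \<subseteq> \<Omega>" using r(1) by (auto simp: X_def subset_iff)
    have x0X: "x\<^sub>0 \<in> X" using r(2) by (auto simp: X_def intro!: exI[of _ 0])
    obtain R where R: "\<And>x. x \<in> \<Omega> \<Longrightarrow> norm x \<le> R" using \<Omega>(2) by (auto simp: bounded_iff)
    have finX: "finite X"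
      by (rule grid_card(1)[OF h(1), of _ R x\<^sub>0]) (use X\<Omega> R \<open>x\<^sub>0 \<in> \<Omega>\<close> in \<open>auto simp: X_def\<close>)
    have hN: "h * real DIM('a) < r" using h by (simp add: pos_less_divide_eq)
    define \<tau> where "\<tau> = h\<^sup>2 / 2"
    have "0 < \<tau>" using h by (simp add: \<tau>_def)
    define P where "P n = (walk h X ^^ n) (\<lambda>x. w x \<delta>)" for n
    have P_Suc: "P (Suc n) = walk h X (P n)" for n by (simp add: P_def)
    have err: "\<forall>x\<in>X. \<delta> + real n * \<tau> \<le> T \<longrightarrow> \<bar>w x (\<delta> + real n * \<tau>) - P n x\<bar> \<le> \<eta> / 2 + real n * (\<tau> * \<omega>)" for n
    proof (induction n)
      case 0
      then show ?case using \<open>0 < \<eta>\<close> by (simp add: P_def)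
    next
      case (Suc n)
      show ?case
      proof (intro ballI impI)
        fix x assume x: "x \<in> X" and T: "\<delta> + real (Suc n) * \<tau> \<le> T"
        define t where "t = \<delta> + real n * \<tau>"
        have tT: "\<delta> \<le> t" "t + \<tau> \<le> T" using T \<open>0 < \<tau>\<close> by (auto simp: t_def algebra_simps)
        have xr: "ball x r \<subseteq> \<Omega>" using x by (simp add: X_def)
        have 1: "\<bar>w x (t + \<tau>) - avg h Basis (\<lambda>y. w y t) x\<bar> \<le> \<tau> * \<omega>"
          using cons[of h x t] h xr tT by (simp add: \<tau>_def)
        have "\<bar>avg h Basis (\<lambda>y. w y t - (if y \<in> X then P n y else 0)) x\<bar> \<le> \<eta> / 2 + real n * (\<tau> * \<omega>)"
        proof (rule abs_avg_le)
          fix g :: "'a \<Rightarrow> real" assume g: "g \<in> signs Basis"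
          define y where "y = x + h *\<^sub>R (\<Sum>j\<in>Basis. g j *\<^sub>R j)"
          have "dist x y \<le> h * real DIM('a)"
            using norm_signs_le[OF g] h by (simp add: y_def dist_norm)
          then have y\<Omega>: "y \<in> \<Omega>" using hN xr by auto
          have "\<exists>z::int. y \<bullet> i = x\<^sub>0 \<bullet> i + h * of_int z" if i: "i \<in> Basis" for i
          proof -
            obtain z :: int where z: "x \<bullet> i = x\<^sub>0 \<bullet> i + h * of_int z" using x i by (auto simp: X_def)
            obtain s :: int where s: "g i = of_int s"
            proof -
              have "g i = of_int 1 \<or> g i = of_int (- 1)" using g i by (auto simp: signs_def PiE_iff)
              then show ?thesis using that by blast
            qed
            have "y \<bullet> i = x\<^sub>0 \<bullet> i + h * of_int (z + s)"
              using i z s by (simp add: y_def inner_add_left algebra_simps)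
            then show ?thesis by blast
          qed
          then have yX: "y \<in> X \<longleftrightarrow> ball y r \<subseteq> \<Omega>" by (auto simp: X_def)
          have nn: "0 \<le> real n * (\<tau> * \<omega>)" using \<open>0 < \<tau>\<close> \<omega> by simp
          have "\<bar>w y t - (if y \<in> X then P n y else 0)\<bar> \<le> \<eta> / 2 + real n * (\<tau> * \<omega>)"
          proof (cases "y \<in> X")
            case True
            then show ?thesis using Suc tT \<open>0 < \<tau>\<close> by (simp add: t_def)
          next
            case False
            then have "\<bar>w y t\<bar> \<le> \<eta> / 2" using yX tT \<open>0 < \<tau>\<close> by (intro small y\<Omega>) auto
            then show ?thesis using False nn by simp
          qed
          then show "\<bar>w (x + h *\<^sub>R (\<Sum>j\<in>Basis. g j *\<^sub>R j)) t - (if x + h *\<^sub>R (\<Sum>j\<in>Basis. g j *\<^sub>R j) \<in> X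
              then P n (x + h *\<^sub>R (\<Sum>j\<in>Basis. g j *\<^sub>R j)) else 0)\<bar> \<le> \<eta> / 2 + real n * (\<tau> * \<omega>)"
            unfolding y_def .
        qed simp
        then have 2: "\<bar>avg h Basis (\<lambda>y. w y t) x - P (Suc n) x\<bar> \<le> \<eta> / 2 + real n * (\<tau> * \<omega>)"
          using x by (simp add: avg_diff walk_def[of h X "P n"] P_Suc)
        have "\<delta> + real (Suc n) * \<tau> = t + \<tau>" by (simp add: t_def algebra_simps)
        moreover have "real (Suc n) * (\<tau> * \<omega>) = real n * (\<tau> * \<omega>) + \<tau> * \<omega>" by (simp add: algebra_simps)
        ultimately show "\<bar>w x (\<delta> + real (Suc n) * \<tau>) - P (Suc n) x\<bar> \<le> \<eta> / 2 + real (Suc n) * (\<tau> * \<omega>)"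
          using 1 2 abs_triangle_ineq[of "w x (t + \<tau>) - avg h Basis (\<lambda>y. w y t) x"
            "avg h Basis (\<lambda>y. w y t) x - P (Suc n) x"] by simp
      qed
    qed
    have "\<bar>w x (\<delta> + real n * \<tau>) - P n x\<bar> \<le> \<eta>" if "x \<in> X" "\<delta> + real n * \<tau> \<le> T" for x n
    proof -
      have "(real n * \<tau>) * \<omega> \<le> T * \<omega>" using that \<omega> \<open>0 < \<delta>\<close> by (intro mult_right_mono) auto
      then have "\<eta> / 2 + real n * (\<tau> * \<omega>) \<le> \<eta>" using \<omega>(2) by (simp add: mult.assoc)
      then show ?thesis using err[of n] that by (meson order_trans)
    qed
    then show "\<exists>X. finite X \<and> x\<^sub>0 \<in> X \<and> X \<subseteq> \<Omega> \<and>
     (\<forall>x\<in>X. \<forall>i\<in>Basis. \<exists>z::int. x \<bullet> i = x\<^sub>0 \<bullet> i + h * of_int z) \<and>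
     (\<forall>n. \<forall>x\<in>X. \<delta> + real n * (h\<^sup>2 / 2) \<le> T \<longrightarrow>
        \<bar>w x (\<delta> + real n * (h\<^sup>2 / 2)) - (walk h X ^^ n) (\<lambda>x. w x \<delta>) x\<bar> \<le> \<eta>)"
      using finX x0X X\<Omega> unfolding \<tau>_def P_def by (intro exI[of _ X]) (auto simp: X_def)
  qed
qed

text \<open>Time analyticity at \<open>x\<^sub>0\<close>, in the form needed for continuation: \<open>k\<close>-th differences with step
\<open>a / k\<close> are of order \<open>5 ^ (- k)\<close>. The constant depends on \<open>w\<close> only through its bound \<open>K\<close>; this is
essential, since the lemma is applied to the increments of \<open>u\<close> over the time \<open>a / k\<close>, which vary
with \<open>k\<close>. The bound comes from the walk with time steps \<open>a / (2 * m * k)\<close> as \<open>m \<rightarrow> \<infinity>\<close>. The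
time \<open>5 * a\<close> before \<open>t\<close> is spent as \<open>4 * a\<close> on decay and \<open>a\<close> on smoothing.\<close>

lemma time_difference_bound:
  fixes \<Omega> :: "'a::euclidean_space set"
  assumes \<Omega>: "open \<Omega>" "bounded \<Omega>" and "0 < a" "x\<^sub>0 \<in> \<Omega>"
  obtains C where "\<And>w k t. dirichlet_caloric \<Omega> w K \<Longrightarrow> k \<ge> 1 \<Longrightarrow> 5 * a < t \<Longrightarrow>
     \<bar>(dif ^^ k) (\<lambda>i. w x\<^sub>0 (t + real i * (a / real k))) 0\<bar> \<le> C / 5 ^ k"
proof -
  obtain R where R: "\<And>x. x \<in> \<Omega> \<Longrightarrow> norm x \<le> R" using \<Omega>(2) by (auto simp: bounded_iff)
  have R0: "0 \<le> R" using R[OF \<open>x\<^sub>0 \<in> \<Omega>\<close>] norm_ge_zero[of x\<^sub>0] by linarith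
  define C where "C = K * sqrt (((4 * R + 1) / sqrt (2 * a)) ^ DIM('a))"
  show ?thesis
  proof (rule that[of C], rule field_le_epsilon)
    fix w and k :: nat and t e :: real
    assume w: "dirichlet_caloric \<Omega> w K" and k: "k \<ge> 1" and t: "5 * a < t" and e: "0 < e"
    have wK: "\<bar>w x s\<bar> \<le> K" if "x \<in> \<Omega>" "0 < s" for x s
      using w that closure_subset[of \<Omega>] by (auto simp: dirichlet_caloric_def)
    have K0: "0 \<le> K" using wK[OF \<open>x\<^sub>0 \<in> \<Omega>\<close>, of 1] by linarith
    define \<delta> where "\<delta> = t - 5 * a"
    define \<eta> where "\<eta> = e / 2 ^ k"
    have \<delta>: "0 < \<delta>" "0 < t + a" "0 < \<eta>" using t e \<open>0 < a\<close> by (auto simp: \<delta>_def \<eta>_def)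
    obtain h\<^sub>0 where h0: "0 < h\<^sub>0" and approx: "\<And>h. 0 < h \<Longrightarrow> h < h\<^sub>0 \<Longrightarrow> \<exists>X. finite X \<and> x\<^sub>0 \<in> X \<and> X \<subseteq> \<Omega> \<and>
     (\<forall>x\<in>X. \<forall>i\<in>Basis. \<exists>z::int. x \<bullet> i = x\<^sub>0 \<bullet> i + h * of_int z) \<and>
     (\<forall>n. \<forall>x\<in>X. \<delta> + real n * (h\<^sup>2 / 2) \<le> t + a \<longrightarrow>
        \<bar>w x (\<delta> + real n * (h\<^sup>2 / 2)) - (walk h X ^^ n) (\<lambda>x. w x \<delta>) x\<bar> \<le> \<eta>)"
      using grid_approximation[OF \<Omega> w \<delta> \<open>x\<^sub>0 \<in> \<Omega>\<close>] by blast
    define \<epsilon> where "\<epsilon> = min 1 h\<^sub>0"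
    have "0 < \<epsilon>" using h0 by (simp add: \<epsilon>_def)
    obtain m :: nat where m: "2 * a / \<epsilon>\<^sup>2 < real m" using reals_Archimedean2 by blast
    have m0: "0 < real m" using m \<open>0 < a\<close> \<open>0 < \<epsilon>\<close> by (smt (verit) divide_pos_pos zero_less_power)
    define l where "l = 2 * m * k"
    have l0: "0 < real l" using m0 k by (simp add: l_def)
    \<comment> \<open>The mesh is chosen so that \<open>l\<close> time steps of length \<open>h\<^sup>2 / 2\<close> take the time \<open>a\<close>.\<close>
    define h where "h = sqrt (2 * a / real l)"
    have h: "0 < h" "h\<^sup>2 = 2 * a / real l" using \<open>0 < a\<close> l0 by (auto simp: h_def)
    have "m \<le> l" using k by (simp add: l_def)
    have "2 * a < \<epsilon>\<^sup>2 * real m" using m \<open>0 < \<epsilon>\<close> by (simp add: field_simps)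
    also have "\<dots> \<le> \<epsilon>\<^sup>2 * real l" using \<open>m \<le> l\<close> by (intro mult_left_mono) auto
    finally have "h\<^sup>2 < \<epsilon>\<^sup>2" using l0 by (simp add: h field_simps)
    then have "h < \<epsilon>" using \<open>0 < \<epsilon>\<close> by (simp add: power_less_imp_less_base)
    then have h1: "h < 1" "h < h\<^sub>0" by (auto simp: \<epsilon>_def)
    obtain X where X: "finite X" "x\<^sub>0 \<in> X" "X \<subseteq> \<Omega>"
      and grid': "\<forall>x\<in>X. \<forall>i\<in>Basis. \<exists>z::int. x \<bullet> i = x\<^sub>0 \<bullet> i + h * of_int z"
      and err': "\<forall>n. \<forall>x\<in>X. \<delta> + real n * (h\<^sup>2 / 2) \<le> t + a \<longrightarrow>
        \<bar>w x (\<delta> + real n * (h\<^sup>2 / 2)) - (walk h X ^^ n) (\<lambda>x. w x \<delta>) x\<bar> \<le> \<eta>"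
      using approx[OF h(1) h1(2)] by (elim exE conjE) (rule that; assumption)
    note grid = grid'[rule_format] and err = err'[rule_format]
    define c where "c i = (walk h X ^^ (2 * m * k + 2 * m * i)) (\<lambda>x. w x \<delta>) x\<^sub>0" for i
    define d where "d i = w x\<^sub>0 (t + real i * (a / real k))" for i
    have close: "\<bar>d i - c (4 * k + i)\<bar> \<le> \<eta>" if "i \<le> k" for i
    proof -
      define n where "n = 2 * m * k + 2 * m * (4 * k + i)"
      have "real n = real l * (5 + real i / real k)" using k by (simp add: n_def l_def field_simps)
      then have "real n * (h\<^sup>2 / 2) = (5 + real i / real k) * a" using l0 by (simp add: h)
      then have "\<delta> + real n * (h\<^sup>2 / 2) = t + real i * (a / real k)" by (simp add: \<delta>_def algebra_simps)
      moreover have "real i * (a / real k) \<le> a"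
      proof -
        have "real i * (a / real k) \<le> real k * (a / real k)"
          using that \<open>0 < a\<close> by (intro mult_right_mono) auto
        then show ?thesis using k by simp
      qed
      ultimately show ?thesis using err[of x\<^sub>0 n] X(2) by (simp add: c_def d_def n_def)
    qed
    \<comment> \<open>Taking \<open>k\<close>-th differences costs at most a factor \<open>2 ^ k\<close>, for which \<open>\<eta>\<close> was prepared.\<close>
    have "\<bar>(dif ^^ k) (\<lambda>i. d i - c (4 * k + i)) 0\<bar> \<le> 2 ^ k * \<eta>"
      by (rule abs_dif_le) (use close in auto)
    then have 1: "\<bar>(dif ^^ k) d 0 - (dif ^^ k) c (4 * k)\<bar> \<le> e"
      by (simp add: dif_diff dif_shift \<eta>_def)
    have "\<bar>(dif ^^ k) c (4 * k)\<bar> \<le> K * sqrt ((1 / sqrt (real (2 * m * k + 1))) ^ DIM('a) * real (card X)) / 5 ^ k"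
      unfolding c_def by (rule walk_difference_bound[OF h(1) X(1,2)]) (use wK X \<delta> in auto)
    also have "\<dots> \<le> C / 5 ^ k"
      unfolding C_def
    proof (intro divide_right_mono mult_left_mono real_sqrt_le_mono K0)
      \<comment> \<open>The powers of the mesh \<open>h\<close> in the kernel bound and in the number of grid points cancel.\<close>
      have "1 / sqrt (real (2 * m * k + 1)) \<le> 1 / sqrt (real l)"
        using l0 unfolding l_def by (intro frac_le real_sqrt_le_mono) auto
      also have "\<dots> = h / sqrt (2 * a)" using \<open>0 < a\<close> by (simp add: h_def real_sqrt_divide)
      finally have "(1 / sqrt (real (2 * m * k + 1))) ^ DIM('a) * real (card X)
          \<le> (h / sqrt (2 * a)) ^ DIM('a) * (4 * R / h + 1) ^ DIM('a)"
        using grid_card(2)[OF h(1), of X R x\<^sub>0] R X grid \<open>x\<^sub>0 \<in> \<Omega>\<close> h \<open>0 < a\<close> by (intro mult_mono power_mono) auto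
      also have "\<dots> = ((4 * R + h) / sqrt (2 * a)) ^ DIM('a)"
      proof -
        have "h / sqrt (2 * a) * (4 * R / h + 1) = (4 * R + h) / sqrt (2 * a)"
          using h(1) by (simp add: distrib_left add_divide_distrib)
        then show ?thesis by (metis power_mult_distrib)
      qed
      also have "\<dots> \<le> ((4 * R + 1) / sqrt (2 * a)) ^ DIM('a)"
        using h(1) h1 R0 \<open>0 < a\<close> by (intro power_mono divide_right_mono) auto
      finally show "(1 / sqrt (real (2 * m * k + 1))) ^ DIM('a) * real (card X)
          \<le> ((4 * R + 1) / sqrt (2 * a)) ^ DIM('a)" .
    qed auto
    finally show "\<bar>(dif ^^ k) (\<lambda>i. w x\<^sub>0 (t + real i * (a / real k))) 0\<bar> \<le> C / 5 ^ k + e"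
      using 1 unfolding d_def[symmetric] by linarith
  qed
qed

section \<open>Comparison principles\<close>

definition caloric :: "'a::euclidean_space set \<Rightarrow> ('a \<Rightarrow> real \<Rightarrow> real) \<Rightarrow> bool" where
  "caloric U u \<longleftrightarrow> (\<exists>ut D1 D2. heat_data U u ut D1 D2 \<and>
     (\<forall>x\<in>U. \<forall>t>0. ut x t = (\<Sum>i\<in>Basis. D2 i x t)))"

lemma heat_data_diff:
  assumes "heat_data U u ut D1 D2" "heat_data U v vt E1 E2"
  shows "heat_data U (\<lambda>x t. u x t - v x t) (\<lambda>x t. ut x t - vt x t)
     (\<lambda>i x t. D1 i x t - E1 i x t) (\<lambda>i x t. D2 i x t - E2 i x t)"
  using assms unfolding heat_data_def by (auto intro!: DERIV_diff)

lemma caloric_diff: "caloric U u \<Longrightarrow> caloric U v \<Longrightarrow> caloric U (\<lambda>x t. u x t - v x t)"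
  unfolding caloric_def
proof (elim exE conjE)
  fix ut D1 D2 vt E1 E2
  assume u: "heat_data U u ut D1 D2" "\<forall>x\<in>U. \<forall>t>0. ut x t = (\<Sum>i\<in>Basis. D2 i x t)"
    and v: "heat_data U v vt E1 E2" "\<forall>x\<in>U. \<forall>t>0. vt x t = (\<Sum>i\<in>Basis. E2 i x t)"
  show "\<exists>ut D1 D2. heat_data U (\<lambda>x t. u x t - v x t) ut D1 D2 \<and>
      (\<forall>x\<in>U. \<forall>t>0. ut x t = (\<Sum>i\<in>Basis. D2 i x t))"
    by (rule exI, rule exI, rule exI, rule conjI, rule heat_data_diff[OF u(1) v(1)])
       (simp add: u(2) v(2) sum_subtractf)
qed

lemma heat_data_subset: "heat_data U u ut D1 D2 \<Longrightarrow> V \<subseteq> U \<Longrightarrow> heat_data V u ut D1 D2"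
  unfolding heat_data_def by (simp add: subset_iff)

lemma caloric_subset:
  assumes "caloric U u" "V \<subseteq> U" shows "caloric V u"
proof -
  obtain ut D1 D2 where "heat_data U u ut D1 D2" "\<forall>x\<in>U. \<forall>t>0. ut x t = (\<Sum>i\<in>Basis. D2 i x t)"
    using assms(1) unfolding caloric_def by blast
  then have "heat_data V u ut D1 D2 \<and> (\<forall>x\<in>V. \<forall>t>0. ut x t = (\<Sum>i\<in>Basis. D2 i x t))"
    using assms(2) heat_data_subset[of U u ut D1 D2 V] by (simp add: subset_iff)
  then show ?thesis unfolding caloric_def by (intro exI)
qed

lemma caloric_const: "caloric U (\<lambda>x t. c)"
  unfolding caloric_def heat_data_def
  by (intro exI[of _ "\<lambda>x t. 0"] exI[of _ "\<lambda>i x t. 0"]) auto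

lemma caloric_minus:
  assumes "caloric U u" shows "caloric U (\<lambda>x t. - u x t)"
  using caloric_diff[OF caloric_const[of U 0] assms] by simp

lemma caloric_translate: "caloric U u \<Longrightarrow> caloric {x. x + z \<in> U} (\<lambda>x t. u (x + z) t)"
  unfolding caloric_def
proof (elim exE conjE)
  fix ut D1 D2 assume "heat_data U u ut D1 D2" "\<forall>x\<in>U. \<forall>t>0. ut x t = (\<Sum>i\<in>Basis. D2 i x t)"
  then show "\<exists>ut D1 D2. heat_data {x. x + z \<in> U} (\<lambda>x t. u (x + z) t) ut D1 D2 \<and>
       (\<forall>x\<in>{x. x + z \<in> U}. \<forall>t>0. ut x t = (\<Sum>i\<in>Basis. D2 i x t))"
    by (intro exI[of _ "\<lambda>x. ut (x + z)"] exI[of _ "\<lambda>i x. D1 i (x + z)"] exI[of _ "\<lambda>i x. D2 i (x + z)"])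
       (auto simp: heat_data_def add.assoc add.commute add.left_commute)
qed

text \<open>The usual argument: if \<open>v\<close> is somewhere positive, subtracting a small multiple of time leaves
a positive maximum, at an interior point and after \<open>t\<^sub>1\<close>, where \<open>v\<^sub>t\<close> is positive and no pure
second derivative is.\<close>

lemma weak_maximum_principle:
  fixes U :: "'a::euclidean_space set"
  assumes U: "open U" "bounded U" and "0 < t\<^sub>1"
    and hd: "heat_data U v vt D1 D2"
    and sub: "\<And>x t. x \<in> U \<Longrightarrow> t\<^sub>1 < t \<Longrightarrow> vt x t \<le> (\<Sum>i\<in>Basis. D2 i x t)"
    and cont: "continuous_on (closure U \<times> {0<..}) (\<lambda>(x, t). v x t)"
    and init: "\<And>x. x \<in> closure U \<Longrightarrow> v x t\<^sub>1 \<le> 0"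
    and bdry: "\<And>x t. x \<in> frontier U \<Longrightarrow> t\<^sub>1 \<le> t \<Longrightarrow> v x t \<le> 0"
    and x: "x \<in> closure U" and t: "t\<^sub>1 \<le> t"
  shows "v x t \<le> 0"
proof (rule ccontr)
  assume "\<not> v x t \<le> 0"
  \<comment> \<open>The slope \<open>\<epsilon>\<close> is small enough for \<open>z\<close> to stay positive at \<open>(x, t)\<close>.\<close>
  define \<epsilon> where "\<epsilon> = v x t / (2 * (t - t\<^sub>1 + 1))"
  have \<epsilon>: "0 < \<epsilon>" "\<epsilon> * (t - t\<^sub>1) < v x t"
  proof -
    show "0 < \<epsilon>" using t \<open>\<not> v x t \<le> 0\<close> by (auto simp: \<epsilon>_def intro!: divide_pos_pos)
    have "\<epsilon> * (t - t\<^sub>1) \<le> \<epsilon> * (t - t\<^sub>1 + 1)" using \<open>0 < \<epsilon>\<close> by simp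
    also have "\<dots> = v x t / 2" using t by (simp add: \<epsilon>_def divide_simps)
    finally show "\<epsilon> * (t - t\<^sub>1) < v x t" using \<open>\<not> v x t \<le> 0\<close> by simp
  qed
  define z where "z p = (\<lambda>(x, t). v x t) p - \<epsilon> * (snd p - t\<^sub>1)" for p
  let ?Q = "closure U \<times> {t\<^sub>1..t}"
  have "continuous_on ?Q (\<lambda>(x, t). v x t)" 
    by (rule continuous_on_subset[OF cont]) (use \<open>0 < t\<^sub>1\<close> in auto)
  then have "continuous_on ?Q z" unfolding z_def by (intro continuous_intros)
  moreover have "compact ?Q" using U by (intro compact_Times) auto
  moreover have "(x, t) \<in> ?Q" using x t by auto
  ultimately obtain p where p: "p \<in> ?Q" and zmax: "\<And>q. q \<in> ?Q \<Longrightarrow> z q \<le> z p"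
    using continuous_attains_sup[of ?Q z] by blast
  obtain y s where ys: "p = (y, s)" by (cases p)
  have y: "y \<in> closure U" "t\<^sub>1 \<le> s" "s \<le> t" using p by (auto simp: ys)
  have "0 < z (x, t)" using \<epsilon> by (simp add: z_def)
  then have "0 < z (y, s)" using zmax[of "(x, t)"] x t by (simp add: ys)
  moreover have "z (y, s) \<le> v y s" using y \<epsilon> by (simp add: z_def)
  ultimately have vpos: "0 < v y s" by simp
  have s1: "t\<^sub>1 < s" using vpos init[OF y(1)] y(2) by (cases "s = t\<^sub>1") auto
  have "y \<notin> frontier U" using bdry[of y s] y vpos by auto
  then have yU: "y \<in> U" using y(1) U by (auto simp: frontier_def interior_open)
  have s0: "0 < s" using s1 \<open>0 < t\<^sub>1\<close> by simp
  have "\<epsilon> \<le> vt y s"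
  proof (rule ccontr)
    assume "\<not> \<epsilon> \<le> vt y s"
    moreover have "((\<lambda>r. v y r - \<epsilon> * (r - t\<^sub>1)) has_real_derivative vt y s - \<epsilon>) (at s)"
      using heat_dataD(1)[OF hd s0 yU] by (auto intro!: derivative_eq_intros)
    ultimately obtain d where d: "0 < d" "\<And>h. 0 < h \<Longrightarrow> h < d \<Longrightarrow> z (y, s) < z (y, s - h)"
      using DERIV_neg_dec_left[of "\<lambda>r. v y r - \<epsilon> * (r - t\<^sub>1)" "vt y s - \<epsilon>" s] by (auto simp: z_def)
    define h where "h = min (d / 2) (s - t\<^sub>1)"
    have h: "0 < h" "h < d" "h \<le> s - t\<^sub>1" using d s1 by (auto simp: h_def)
    then have "z (y, s) < z (y, s - h)" by (intro d)
    moreover have "z (y, s - h) \<le> z (y, s)" using zmax[of "(y, s - h)"] y h by (simp add: ys)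
    ultimately show False by simp
  qed
  moreover have "D2 i y s \<le> 0" if i: "i \<in> Basis" for i
  proof (rule ccontr)
    assume "\<not> D2 i y s \<le> 0"
    obtain r where r: "0 < r" "ball y r \<subseteq> U" using U yU by (meson open_contains_ball)
    have in_U: "y + \<sigma> *\<^sub>R i \<in> U" if "\<bar>\<sigma>\<bar> < r" for \<sigma>
      using that r i by (auto simp: subset_iff dist_norm)
    have max: "v (y + \<sigma> *\<^sub>R i) s \<le> v (y + 0 *\<^sub>R i) s" if "\<bar>\<sigma>\<bar> < r" for \<sigma>
      using zmax[of "(y + \<sigma> *\<^sub>R i, s)"] in_U[OF that] closure_subset[of U] y by (auto simp: z_def ys)
    have D: "((\<lambda>\<sigma>. v (y + \<sigma> *\<^sub>R i) s) has_real_derivative D1 i (y + \<sigma> *\<^sub>R i) s) (at \<sigma>)" if "\<bar>\<sigma>\<bar> < r" for \<sigma>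
      using heat_dataD(2)[OF hd s0 i in_U[OF that]] .
    have "D1 i (y + 0 *\<^sub>R i) s = 0"
      by (rule DERIV_local_max[OF D r(1)]) (use max r in auto)
    moreover obtain d where d: "0 < d" "\<And>h. 0 < h \<Longrightarrow> h < d \<Longrightarrow> D1 i (y + 0 *\<^sub>R i) s < D1 i (y + (0 + h) *\<^sub>R i) s"
      using DERIV_pos_inc_right[OF heat_dataD(3)[OF hd s0 i, of y 0]] yU \<open>\<not> D2 i y s \<le> 0\<close> by auto
    define h where "h = min d r / 2"
    have h: "0 < h" "h < d" "h < r" using d r by (auto simp: h_def)
    obtain c where c: "0 < c" "c < h" "v (y + h *\<^sub>R i) s - v (y + 0 *\<^sub>R i) s = (h - 0) * D1 i (y + c *\<^sub>R i) s"
      using MVT2[of 0 h "\<lambda>\<sigma>. v (y + \<sigma> *\<^sub>R i) s" "\<lambda>\<sigma>. D1 i (y + \<sigma> *\<^sub>R i) s"] D h by force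
    ultimately have "0 < D1 i (y + c *\<^sub>R i) s" using d(2)[of c] h by simp
    then have "0 < (h - 0) * D1 i (y + c *\<^sub>R i) s" using h by simp
    then show False using c(3) max[of h] h by simp
  qed
  then have "(\<Sum>i\<in>Basis. D2 i y s) \<le> 0" by (intro sum_nonpos) auto
  ultimately show False using sub[OF yU s1] \<epsilon>(1) by linarith
qed

lemma norm_sq_along_line:
  assumes "i \<in> Basis"
  shows "(norm (x + s *\<^sub>R i - y))\<^sup>2 = (norm (x - y))\<^sup>2 + 2 * s * ((x - y) \<bullet> i) + s\<^sup>2"
  using assms unfolding power2_norm_eq_inner
  by (simp add: inner_add_left inner_add_right inner_diff_left inner_diff_right inner_commute algebra_simps power2_eq_square)

text \<open>A solution that is nonpositive on the boundary becomes nonpositive in the limit \<open>t \<rightarrow> \<infinity>\<close>. The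
barrier is \<open>exp (- \<mu> * (t - t\<^sub>1)) * (R\<^sup>2 + 1 - \<parallel>x - y\<^sub>0\<parallel>\<^sup>2)\<close>: its second factor lies between \<open>1\<close>
and \<open>R\<^sup>2 + 1\<close> and has Laplacian \<open>- 2 * N\<close>, so \<open>\<mu> = 2 * N / (R\<^sup>2 + 1)\<close> makes it a
supersolution.\<close>

lemma late_time_comparison:
  fixes U :: "'a::euclidean_space set"
  assumes U: "open U" "U \<subseteq> cball y\<^sub>0 R" and "0 < t\<^sub>1" "0 \<le> K"
    and v: "caloric U v"
    and cont: "continuous_on (closure U \<times> {0<..}) (\<lambda>(x, t). v x t)"
    and init: "\<And>x. x \<in> closure U \<Longrightarrow> v x t\<^sub>1 \<le> K"
    and bdry: "\<And>x t. x \<in> frontier U \<Longrightarrow> t\<^sub>1 \<le> t \<Longrightarrow> v x t \<le> 0"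
    and x: "x \<in> closure U" and t: "t\<^sub>1 \<le> t"
  shows "v x t \<le> K * (R\<^sup>2 + 1) * exp (- (2 * DIM('a) / (R\<^sup>2 + 1)) * (t - t\<^sub>1))"
proof -
  define \<mu> where "\<mu> = 2 * real DIM('a) / (R\<^sup>2 + 1)"
  define E where "E t = K * exp (- \<mu> * (t - t\<^sub>1))" for t
  define q where "q x = R\<^sup>2 + 1 - (norm (x - y\<^sub>0))\<^sup>2" for x
  have R1: "0 < R\<^sup>2 + 1" by (simp add: add_nonneg_pos)
  have E0: "0 \<le> E t" for t using \<open>0 \<le> K\<close> by (simp add: E_def)
  have clU: "closure U \<subseteq> cball y\<^sub>0 R" using U(2) closure_minimal by blast
  have q1: "1 \<le> q x" "q x \<le> R\<^sup>2 + 1" if "x \<in> closure U" for x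
  proof -
    have "norm (x - y\<^sub>0) \<le> R" using that clU by (auto simp: dist_norm norm_minus_commute)
    then show "1 \<le> q x" by (simp add: q_def power_mono)
  qed (simp add: q_def)
  obtain vt D1 D2 where hd: "heat_data U v vt D1 D2" and eq: "\<And>x t. x \<in> U \<Longrightarrow> 0 < t \<Longrightarrow> vt x t = (\<Sum>i\<in>Basis. D2 i x t)"
    using v unfolding caloric_def by blast
  have hdb: "heat_data U (\<lambda>x t. E t * q x) (\<lambda>x t. - \<mu> * E t * q x) (\<lambda>i x t. E t * (- 2 * ((x - y\<^sub>0) \<bullet> i))) (\<lambda>i x t. E t * - 2)"
    unfolding heat_data_def
  proof (intro ballI allI impI conjI)
    fix x t i assume "x \<in> U" and i: "i \<in> (Basis :: 'a set)"
    show "((\<lambda>s. E t * q (x + s *\<^sub>R i)) has_real_derivative E t * (- 2 * ((x - y\<^sub>0) \<bullet> i))) (at 0)"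
      unfolding q_def norm_sq_along_line[OF i] by (auto intro!: derivative_eq_intros)
    show "((\<lambda>s. E t * (- 2 * ((x + s *\<^sub>R i - y\<^sub>0) \<bullet> i))) has_real_derivative E t * - 2) (at 0)"
      using i unfolding inner_diff_left inner_add_left by (auto intro!: derivative_eq_intros)
  next
    fix x t
    show "((\<lambda>s. E s * q x) has_real_derivative - \<mu> * E t * q x) (at t)"
      unfolding E_def by (auto intro!: derivative_eq_intros)
  qed
  have "(\<lambda>x t. v x t - E t * q x) x t \<le> 0"
  proof (rule weak_maximum_principle[OF U(1) _ \<open>0 < t\<^sub>1\<close> heat_data_diff[OF hd hdb] _ _ _ _ x t])
    show "bounded U" using U(2) bounded_cball bounded_subset by blast
    fix x t assume "x \<in> U" "t\<^sub>1 < t"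
    have "\<mu> * q x \<le> \<mu> * (R\<^sup>2 + 1)"
      using q1(2)[of x] \<open>x \<in> U\<close> closure_subset[of U] R1 by (intro mult_left_mono) (auto simp: \<mu>_def)
    then have "\<mu> * q x \<le> 2 * DIM('a)" using R1 by (simp add: \<mu>_def)
    then have "E t * (\<mu> * q x) \<le> E t * (2 * DIM('a))" using E0 by (intro mult_left_mono) auto
    then show "vt x t - - \<mu> * E t * q x \<le> (\<Sum>i\<in>Basis. D2 i x t - E t * - 2)"
      using eq[OF \<open>x \<in> U\<close>, of t] \<open>t\<^sub>1 < t\<close> \<open>0 < t\<^sub>1\<close> by (simp add: sum.distrib algebra_simps)
  next
    have "continuous_on (closure U \<times> {0<..}) (\<lambda>p. (\<lambda>(x, t). v x t) p - E (snd p) * q (fst p))"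
      unfolding E_def q_def by (intro continuous_intros cont)
    then show "continuous_on (closure U \<times> {0<..}) (\<lambda>(x, t). v x t - E t * q x)"
      by (simp add: case_prod_unfold)
    show "v x t\<^sub>1 - E t\<^sub>1 * q x \<le> 0" if "x \<in> closure U" for x
    proof -
      have "K * 1 \<le> K * q x" using q1 that \<open>0 \<le> K\<close> by (intro mult_left_mono) auto
      then show ?thesis using init[OF that] by (simp add: E_def)
    qed
    show "v x t - E t * q x \<le> 0" if "x \<in> frontier U" "t\<^sub>1 \<le> t" for x t
    proof -
      have "0 \<le> E t * q x" using q1(1)[of x] E0[of t] that by (intro mult_nonneg_nonneg) (auto simp: frontier_def)
      then show ?thesis using bdry[OF that] by simp
    qed
  qed
  then have "v x t \<le> E t * q x" by simp
  also have "\<dots> \<le> E t * (R\<^sup>2 + 1)" using q1 x E0 by (intro mult_left_mono) auto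
  finally show ?thesis by (simp add: E_def \<mu>_def mult_ac)
qed

lemma decay_tendsto_0: "0 < \<mu> \<Longrightarrow> ((\<lambda>t. C * exp (- \<mu> * (t - t\<^sub>1))) \<longlongrightarrow> (0::real)) at_top"
proof -
  assume "0 < \<mu>"
  have "LIM t at_top. - \<mu> * (t - t\<^sub>1) :> at_bot"
    using \<open>0 < \<mu>\<close>
    by (intro filterlim_tendsto_neg_mult_at_bot[of _ "- \<mu>"] tendsto_const filterlim_at_top_mult_tendsto_pos)
       (auto intro!: filterlim_tendsto_add_at_top[of "\<lambda>_. - t\<^sub>1", simplified] filterlim_ident)
  then have "((\<lambda>t. exp (- \<mu> * (t - t\<^sub>1))) \<longlongrightarrow> 0) at_top" by (rule filterlim_compose[OF exp_at_bot])
  then show ?thesis by (rule tendsto_mult_right_zero)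
qed

section \<open>Equilibria as limits of solutions\<close>

text \<open>The functions \<open>h\<close> obtained in this way are harmonic. Keeping the approximating solution \<open>u\<close>
makes the class closed under translations and differences, and lets comparison principles for the
heat equation replace those for the Laplace equation.\<close>

definition caloric_limit :: "'a::euclidean_space set \<Rightarrow> ('a \<Rightarrow> real \<Rightarrow> real) \<Rightarrow> ('a \<Rightarrow> real) \<Rightarrow> bool" where
  "caloric_limit U u h \<longleftrightarrow> caloric U u \<and> continuous_on (U \<times> {0<..}) (\<lambda>(x, t). u x t) \<and>
     (\<forall>\<epsilon>>0. \<exists>T>0. \<forall>t\<ge>T. \<forall>x\<in>U. \<bar>u x t - h x\<bar> \<le> \<epsilon>)"

lemma caloric_limitE:
  assumes "caloric_limit U u h" "0 < \<epsilon>"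
  obtains T where "0 < T" "\<And>t x. t \<ge> T \<Longrightarrow> x \<in> U \<Longrightarrow> \<bar>u x t - h x\<bar> \<le> \<epsilon>"
proof -
  have "\<exists>T>0. \<forall>t\<ge>T. \<forall>x\<in>U. \<bar>u x t - h x\<bar> \<le> \<epsilon>" using assms by (simp add: caloric_limit_def)
  then show ?thesis using that by (elim exE conjE) simp
qed

lemma caloric_limit_tendsto:
  assumes "caloric_limit U u h" "x \<in> U" shows "(u x \<longlongrightarrow> h x) at_top"
proof (rule tendstoI)
  fix e :: real assume "0 < e"
  then have e2: "0 < e / 2" by simp
  obtain T where T: "0 < T" "\<And>t x. t \<ge> T \<Longrightarrow> x \<in> U \<Longrightarrow> \<bar>u x t - h x\<bar> \<le> e / 2"
    by (rule caloric_limitE[OF assms(1) e2]) (rule that, assumption, blast)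
  have "\<bar>u x t - h x\<bar> < e" if "t \<ge> T" for t using T(2)[OF that assms(2)] \<open>0 < e\<close> by linarith
  then show "\<forall>\<^sub>F t in at_top. dist (u x t) (h x) < e"
    unfolding eventually_at_top_linorder dist_real_def by blast
qed

lemma caloric_limit_subset: "caloric_limit U u h \<Longrightarrow> V \<subseteq> U \<Longrightarrow> caloric_limit V u h"
  unfolding caloric_limit_def
proof (elim conjE, intro conjI)
  assume V: "V \<subseteq> U"
  show "caloric U u \<Longrightarrow> caloric V u" using V by (rule caloric_subset[rotated])
  show "continuous_on (U \<times> {0<..}) (\<lambda>(x, t). u x t) \<Longrightarrow> continuous_on (V \<times> {0<..}) (\<lambda>(x, t). u x t)"
    by (rule continuous_on_subset) (use V in auto)
  show "\<forall>\<epsilon>>0. \<exists>T>0. \<forall>t\<ge>T. \<forall>x\<in>U. \<bar>u x t - h x\<bar> \<le> \<epsilon> \<Longrightarrow> \<forall>\<epsilon>>0. \<exists>T>0. \<forall>t\<ge>T. \<forall>x\<in>V. \<bar>u x t - h x\<bar> \<le> \<epsilon>"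
    using V by (meson subsetD)
qed

lemma caloric_limit_diff:
  assumes "caloric_limit U u h" "caloric_limit U v k"
  shows "caloric_limit U (\<lambda>x t. u x t - v x t) (\<lambda>x. h x - k x)"
  unfolding caloric_limit_def
proof (intro conjI allI impI)
  show "caloric U (\<lambda>x t. u x t - v x t)" using assms by (auto simp: caloric_limit_def intro: caloric_diff)
  have "continuous_on (U \<times> {0<..}) (\<lambda>p. (\<lambda>(x, t). u x t) p - (\<lambda>(x, t). v x t) p)"
    using assms by (intro continuous_intros) (auto simp: caloric_limit_def)
  then show "continuous_on (U \<times> {0<..}) (\<lambda>(x, t). u x t - v x t)" by (simp add: case_prod_unfold)
  fix e :: real assume "0 < e"
  then have e2: "0 < e / 2" by simp
  obtain T1 where T1: "0 < T1" "\<And>t x. t \<ge> T1 \<Longrightarrow> x \<in> U \<Longrightarrow> \<bar>u x t - h x\<bar> \<le> e / 2"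
    by (rule caloric_limitE[OF assms(1) e2]) (rule that, assumption, blast)
  obtain T2 where T2: "0 < T2" "\<And>t x. t \<ge> T2 \<Longrightarrow> x \<in> U \<Longrightarrow> \<bar>v x t - k x\<bar> \<le> e / 2"
    by (rule caloric_limitE[OF assms(2) e2]) (rule that, assumption, blast)
  have "\<bar>u x t - v x t - (h x - k x)\<bar> \<le> e" if "t \<ge> max T1 T2" "x \<in> U" for x t
  proof -
    have "\<bar>(u x t - h x) - (v x t - k x)\<bar> \<le> e / 2 + e / 2"
      using T1(2)[of t x] T2(2)[of t x] that abs_triangle_ineq4[of "u x t - h x" "v x t - k x"] by linarith
    then show ?thesis by (simp add: algebra_simps)
  qed
  then show "\<exists>T>0. \<forall>t\<ge>T. \<forall>x\<in>U. \<bar>u x t - v x t - (h x - k x)\<bar> \<le> e"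
    using T1(1) by (intro exI[of _ "max T1 T2"]) auto
qed

lemma caloric_limit_const: "caloric_limit U (\<lambda>x t. c) (\<lambda>x. c)"
  by (auto simp: caloric_limit_def caloric_const case_prod_unfold intro!: exI[of _ 1])

lemma caloric_limit_minus: "caloric_limit U u h \<Longrightarrow> caloric_limit U (\<lambda>x t. - u x t) (\<lambda>x. - h x)"
  using caloric_limit_diff[OF caloric_limit_const[of U 0], of u h] by simp

lemma caloric_limit_translate:
  assumes "caloric_limit U u h"
  shows "caloric_limit {x. x + z \<in> U} (\<lambda>x t. u (x + z) t) (\<lambda>x. h (x + z))"
  unfolding caloric_limit_def
proof (intro conjI)
  show "caloric {x. x + z \<in> U} (\<lambda>x t. u (x + z) t)"
    using assms by (auto simp: caloric_limit_def intro: caloric_translate)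
  have "continuous_on ({x. x + z \<in> U} \<times> {0<..}) ((\<lambda>(x, t). u x t) \<circ> (\<lambda>p. (fst p + z, snd p)))"
    by (rule continuous_on_compose)
       (use assms in \<open>auto simp: caloric_limit_def intro!: continuous_intros elim!: continuous_on_subset\<close>)
  then show "continuous_on ({x. x + z \<in> U} \<times> {0<..}) (\<lambda>(x, t). u (x + z) t)"
    by (simp add: o_def case_prod_unfold)
  show "\<forall>\<epsilon>>0. \<exists>T>0. \<forall>t\<ge>T. \<forall>x\<in>{x. x + z \<in> U}. \<bar>u (x + z) t - h (x + z)\<bar> \<le> \<epsilon>"
    using assms unfolding caloric_limit_def by blast
qed

text \<open>For late times \<open>u - (c + e)\<close> is nonpositive on the boundary of \<open>D\<close>, hence nonpositive in \<open>D\<close> up to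
an error that decays in time.\<close>

lemma limit_maximum_principle:
  assumes "caloric_limit U u h" "open D" "bounded D" "closure D \<subseteq> U"
    and h: "\<And>x. x \<in> frontier D \<Longrightarrow> h x \<le> c" and x: "x \<in> D"
  shows "h x \<le> c"
proof (rule field_le_epsilon)
  fix e :: real assume e: "0 < e"
  obtain T where T: "0 < T" "\<And>t x. t \<ge> T \<Longrightarrow> x \<in> U \<Longrightarrow> \<bar>u x t - h x\<bar> \<le> e"
    by (rule caloric_limitE[OF assms(1) e]) (rule that, assumption, blast)
  define v where "v x t = u x t - (c + e)" for x t
  have cont: "continuous_on (closure D \<times> {0<..}) (\<lambda>(x, t). u x t)"
    using assms by (auto simp: caloric_limit_def elim!: continuous_on_subset)
  have "compact ((\<lambda>x. u x T) ` closure D)"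
  proof (rule compact_continuous_image)
    have "continuous_on (closure D) ((\<lambda>(x, t). u x t) \<circ> (\<lambda>x. (x, T)))"
      by (rule continuous_on_compose) (use T in \<open>auto intro!: continuous_intros continuous_on_subset[OF cont]\<close>)
    then show "continuous_on (closure D) (\<lambda>x. u x T)" by (simp add: o_def)
  qed (use assms in auto)
  then obtain B where B: "\<And>x. x \<in> closure D \<Longrightarrow> \<bar>u x T\<bar> \<le> B"
    by (force dest!: compact_imp_bounded simp: bounded_iff)
  define K where "K = \<bar>B\<bar> + \<bar>c\<bar> + e"
  obtain R where "\<forall>x\<in>D. norm x \<le> R" using assms(3) by (auto simp: bounded_iff)
  then have R: "D \<subseteq> cball 0 R" by auto
  have bound: "v x t \<le> K * (R\<^sup>2 + 1) * exp (- (2 * DIM('a) / (R\<^sup>2 + 1)) * (t - T))" if "T \<le> t" for t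
  proof (rule late_time_comparison[OF assms(2) R T(1) _ _ _ _ _ _ that])
    show "0 \<le> K" using \<open>0 < e\<close> by (simp add: K_def)
    show "caloric D v" unfolding v_def
      using assms closure_subset[of D] by (intro caloric_diff caloric_const) (auto simp: caloric_limit_def intro: caloric_subset)
    have "continuous_on (closure D \<times> {0<..}) (\<lambda>p. (\<lambda>(x, t). u x t) p - (c + e))"
      by (intro continuous_intros cont)
    then show "continuous_on (closure D \<times> {0<..}) (\<lambda>(x, t). v x t)"
      by (simp add: v_def case_prod_unfold)
    show "v x T \<le> K" if "x \<in> closure D" for x using B[OF that] \<open>0 < e\<close> by (simp add: v_def K_def)
    show "v x t \<le> 0" if "x \<in> frontier D" "T \<le> t" for x t
      using h[OF that(1)] T(2)[OF that(2), of x] that assms(4) by (auto simp: v_def frontier_def)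
    show "x \<in> closure D" using x closure_subset[of D] by auto
  qed
  have 1: "(v x \<longlongrightarrow> h x - (c + e)) at_top"
    unfolding v_def using assms x closure_subset[of D]
    by (intro tendsto_intros caloric_limit_tendsto[OF assms(1)]) auto
  have 2: "((\<lambda>t. K * (R\<^sup>2 + 1) * exp (- (2 * DIM('a) / (R\<^sup>2 + 1)) * (t - T))) \<longlongrightarrow> 0) at_top"
    by (rule decay_tendsto_0) (simp add: add_nonneg_pos)
  have "h x - (c + e) \<le> 0"
    by (rule tendsto_le[OF trivial_limit_at_top_linorder 2 1])
       (use bound in \<open>unfold eventually_at_top_linorder, blast\<close>)
  then show "h x \<le> c + e" by simp
qed

section \<open>Gradient estimate by reflection\<close>

text \<open>Reflection in the hyperplane through \<open>x\<^sub>0\<close> orthogonal to \<open>e\<close> changes the sign of the first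
derivative in the direction \<open>e\<close> and of nothing else.\<close>

lemma reflection_heat_data:
  fixes x\<^sub>0 e :: "'a::euclidean_space"
  assumes e: "e \<in> Basis" and hd: "heat_data U u ut D1 D2"
  defines "\<rho> \<equiv> \<lambda>x. x - (2 * ((x - x\<^sub>0) \<bullet> e)) *\<^sub>R e"
  shows "heat_data {x. \<rho> x \<in> U} (\<lambda>x t. u (\<rho> x) t) (\<lambda>x t. ut (\<rho> x) t)
     (\<lambda>i x t. (if i = e then -1 else 1) * D1 i (\<rho> x) t) (\<lambda>i x t. D2 i (\<rho> x) t)"
  unfolding heat_data_def
proof (intro ballI allI impI conjI)
  fix x i and t :: real assume x: "x \<in> {x. \<rho> x \<in> U}" and t: "0 < t" and i: "i \<in> (Basis :: 'a set)"
  define c :: real where "c = (if i = e then -1 else 1)"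
  have line: "\<rho> (x + s *\<^sub>R i) = \<rho> x + (c * s) *\<^sub>R i" for s
  proof (cases "i = e")
    case True
    then show ?thesis using e by (simp add: \<rho>_def c_def inner_add_left inner_diff_left algebra_simps) (simp flip: scaleR_add_left)
  next
    case False
    then have "i \<bullet> e = 0" using e i by (simp add: inner_Basis)
    then show ?thesis using False by (simp add: \<rho>_def c_def inner_add_left inner_diff_left)
  qed
  have chain: "((\<lambda>s. F (\<rho> (x + s *\<^sub>R i))) has_real_derivative D * c) (at 0)"
    if "((\<lambda>s. F (\<rho> x + s *\<^sub>R i)) has_real_derivative D) (at 0)" for F :: "'a \<Rightarrow> real" and D
    unfolding line
    by (rule DERIV_chain2[of "\<lambda>s. F (\<rho> x + s *\<^sub>R i)"]) (use that in \<open>auto intro!: derivative_eq_intros\<close>)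
  have px: "\<rho> x + 0 *\<^sub>R i \<in> U" using x by simp
  show "((\<lambda>s. u (\<rho> (x + s *\<^sub>R i)) t) has_real_derivative (if i = e then - 1 else 1) * D1 i (\<rho> x) t) (at 0)"
    using chain[of "\<lambda>y. u y t", OF heat_dataD(2)[OF hd t i px]] by (simp add: c_def mult.commute)
  have "((\<lambda>s. c * D1 i (\<rho> (x + s *\<^sub>R i)) t) has_real_derivative c * (D2 i (\<rho> x) t * c)) (at 0)"
    using chain[of "\<lambda>y. D1 i y t", OF heat_dataD(3)[OF hd t i px]] by (intro DERIV_cmult) simp
  moreover have "c * (D2 i (\<rho> x) t * c) = D2 i (\<rho> x) t" by (simp add: c_def)
  ultimately show "((\<lambda>s. (if i = e then - 1 else 1) * D1 i (\<rho> (x + s *\<^sub>R i)) t) has_real_derivative D2 i (\<rho> x) t) (at 0)"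
    by (cases "i = e") (simp_all add: c_def)
next
  fix x and t :: real assume x: "x \<in> {x. \<rho> x \<in> U}" and t: "0 < t"
  show "((\<lambda>s. u (\<rho> x) s) has_real_derivative ut (\<rho> x) t) (at t)"
    using heat_dataD(1)[OF hd t, of "\<rho> x"] x by simp
qed

lemma caloric_reflection:
  fixes x\<^sub>0 e :: "'a::euclidean_space"
  assumes "e \<in> Basis" "caloric U u"
  shows "caloric {x. x - (2 * ((x - x\<^sub>0) \<bullet> e)) *\<^sub>R e \<in> U} (\<lambda>x t. u (x - (2 * ((x - x\<^sub>0) \<bullet> e)) *\<^sub>R e) t)"
proof -
  obtain ut D1 D2 where hd: "heat_data U u ut D1 D2" and eq: "\<forall>x\<in>U. \<forall>t>0. ut x t = (\<Sum>i\<in>Basis. D2 i x t)"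
    using assms(2) unfolding caloric_def by blast
  show ?thesis unfolding caloric_def
    by (rule exI, rule exI, rule exI, rule conjI, rule reflection_heat_data[OF assms(1) hd])
       (simp add: eq)
qed

text \<open>A harmonic polynomial: the Laplacians of \<open>\<parallel>x - x\<^sub>0\<parallel>\<^sup>2\<close> and of \<open>N * ((x - x\<^sub>0) \<bullet> e)\<^sup>2\<close> cancel. On
the half ball in the direction \<open>e\<close> it is nonnegative, it is at least one on the spherical part of
the boundary, and it grows at most linearly along the axis.\<close>

definition half_ball_barrier :: "'a::euclidean_space \<Rightarrow> 'a \<Rightarrow> real \<Rightarrow> 'a \<Rightarrow> real" where
  "half_ball_barrier x\<^sub>0 e r x = ((norm (x - x\<^sub>0))\<^sup>2 + DIM('a) * (r * ((x - x\<^sub>0) \<bullet> e) - ((x - x\<^sub>0) \<bullet> e)\<^sup>2)) / r\<^sup>2"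

lemma caloric_half_ball_barrier:
  fixes x\<^sub>0 e :: "'a::euclidean_space"
  assumes e: "e \<in> Basis"
  shows "caloric U (\<lambda>x t. c * half_ball_barrier x\<^sub>0 e r x)"
proof -
  let ?N = "real DIM('a)"
  define D1 where "D1 i x = c * ((2 * ((x - x\<^sub>0) \<bullet> i) + ?N * (r * (i \<bullet> e) - 2 * ((x - x\<^sub>0) \<bullet> e) * (i \<bullet> e))) / r\<^sup>2)" for i x
  define D2 where "D2 i = c * ((2 - ?N * 2 * (i \<bullet> e)) / r\<^sup>2)" for i
  have "heat_data U (\<lambda>x t. c * half_ball_barrier x\<^sub>0 e r x) (\<lambda>x t. 0) (\<lambda>i x t. D1 i x) (\<lambda>i x t. D2 i)"
    unfolding heat_data_def
  proof (intro ballI allI impI conjI)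
    fix x i assume i: "i \<in> (Basis :: 'a set)"
    show "((\<lambda>s. c * half_ball_barrier x\<^sub>0 e r (x + s *\<^sub>R i)) has_real_derivative D1 i x) (at 0)"
      unfolding half_ball_barrier_def norm_sq_along_line[OF i] D1_def inner_diff_left inner_add_left
      by (intro DERIV_cmult DERIV_cdivide) (auto intro!: derivative_eq_intros simp: algebra_simps)
    have "i \<bullet> i = 1" "(i \<bullet> e) * (i \<bullet> e) = i \<bullet> e" using i e by (auto simp: inner_Basis)
    then show "((\<lambda>s. D1 i (x + s *\<^sub>R i)) has_real_derivative D2 i) (at 0)"
      unfolding D1_def D2_def inner_diff_left inner_add_left
      by (intro DERIV_cmult DERIV_cdivide) (auto intro!: derivative_eq_intros simp: algebra_simps)
  qed simp
  moreover have "(\<Sum>i\<in>Basis. D2 i) = 0"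
  proof -
    have "(\<Sum>i\<in>Basis. i \<bullet> e) = 1" using e by (simp add: inner_Basis)
    then have "(\<Sum>i\<in>(Basis::'a set). 2 - ?N * 2 * (i \<bullet> e)) = 0"
      by (simp add: sum_subtractf flip: sum_distrib_left)
    then show ?thesis unfolding D2_def by (simp flip: sum_divide_distrib sum_distrib_left)
  qed
  ultimately show ?thesis unfolding caloric_def by (intro exI conjI) auto
qed

lemma half_ball_barrier_bounds:
  fixes x\<^sub>0 e :: "'a::euclidean_space"
  assumes "0 < r" "e \<in> Basis" "x \<in> cball x\<^sub>0 r" "0 \<le> (x - x\<^sub>0) \<bullet> e"
  shows "0 \<le> half_ball_barrier x\<^sub>0 e r x" and "dist x\<^sub>0 x = r \<Longrightarrow> 1 \<le> half_ball_barrier x\<^sub>0 e r x"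
proof -
  have "(x - x\<^sub>0) \<bullet> e \<le> r"
    using Basis_le_norm[OF assms(2), of "x - x\<^sub>0"] assms(3) by (simp add: dist_norm norm_minus_commute)
  then have "((x - x\<^sub>0) \<bullet> e)\<^sup>2 \<le> r * ((x - x\<^sub>0) \<bullet> e)"
    unfolding power2_eq_square using assms(4) by (intro mult_right_mono) auto
  then have *: "0 \<le> DIM('a) * (r * ((x - x\<^sub>0) \<bullet> e) - ((x - x\<^sub>0) \<bullet> e)\<^sup>2)" by simp
  then show "0 \<le> half_ball_barrier x\<^sub>0 e r x" unfolding half_ball_barrier_def by (intro divide_nonneg_nonneg add_nonneg_nonneg) auto
  assume "dist x\<^sub>0 x = r"
  then have "norm (x - x\<^sub>0) = r" by (simp add: dist_norm norm_minus_commute)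
  then show "1 \<le> half_ball_barrier x\<^sub>0 e r x"
    unfolding half_ball_barrier_def using * assms(1) by (simp add: le_divide_eq)
qed

lemma half_ball_barrier_axis:
  fixes x\<^sub>0 e :: "'a::euclidean_space" and \<tau> :: real
  assumes "0 < r" "e \<in> Basis"
  shows "half_ball_barrier x\<^sub>0 e r (x\<^sub>0 + \<tau> *\<^sub>R e) \<le> DIM('a) * \<tau> / r"
proof -
  have "half_ball_barrier x\<^sub>0 e r (x\<^sub>0 + \<tau> *\<^sub>R e) = (DIM('a) * r * \<tau> - (DIM('a) - 1) * \<tau>\<^sup>2) / r\<^sup>2"
    using assms by (simp add: half_ball_barrier_def algebra_simps of_nat_diff DIM_positive Suc_leI)
  also have "\<dots> \<le> DIM('a) * r * \<tau> / r\<^sup>2" by (intro divide_right_mono) auto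
  also have "\<dots> = DIM('a) * \<tau> / r" using assms by (simp add: power2_eq_square)
  finally show ?thesis .
qed

text \<open>The difference between \<open>u\<close> and its mirror image solves the heat equation in a half ball, vanishes
on the flat part of the boundary and is bounded by about \<open>2 * K\<close> on the spherical part. The multiple
\<open>2 * (K + d)\<close> of the barrier therefore dominates it for late times, up to a decaying error.\<close>

lemma symmetric_gradient_bound:
  fixes x\<^sub>0 e :: "'a::euclidean_space"
  assumes lim: "caloric_limit U u h" and r: "0 < r" "cball x\<^sub>0 r \<subseteq> U"
    and K: "\<And>x. x \<in> cball x\<^sub>0 r \<Longrightarrow> \<bar>h x\<bar> \<le> K" and e: "e \<in> Basis" and \<tau>: "0 \<le> \<tau>" "\<tau> < r"
  shows "h (x\<^sub>0 + \<tau> *\<^sub>R e) - h (x\<^sub>0 - \<tau> *\<^sub>R e) \<le> 2 * K * DIM('a) * \<tau> / r"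
proof (cases "\<tau> = 0")
  case False
  then have "0 < \<tau>" using \<tau> by simp
  let ?N = "real DIM('a)"
  have K0: "0 \<le> K" using K[of x\<^sub>0] r by simp
  define \<rho> where "\<rho> x = x - (2 * ((x - x\<^sub>0) \<bullet> e)) *\<^sub>R e" for x
  define V where "V = {x \<in> ball x\<^sub>0 r. 0 < (x - x\<^sub>0) \<bullet> e}"
  have \<rho>_dist: "dist x\<^sub>0 (\<rho> x) = dist x\<^sub>0 x" for x
  proof -
    have "(norm (\<rho> x - x\<^sub>0))\<^sup>2 = (norm (x - x\<^sub>0))\<^sup>2"
      using norm_sq_along_line[OF e, of x "- (2 * ((x - x\<^sub>0) \<bullet> e))" x\<^sub>0] by (simp add: \<rho>_def power2_eq_square)
    then show ?thesis by (simp add: dist_norm norm_minus_commute)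
  qed
  have open_V: "open V"
  proof -
    have "V = ball x\<^sub>0 r \<inter> {x. x\<^sub>0 \<bullet> e < x \<bullet> e}" by (auto simp: V_def inner_diff_left)
    then show ?thesis by (auto intro!: open_Int open_Collect_less continuous_intros)
  qed
  have cl_V: "closure V \<subseteq> cball x\<^sub>0 r \<inter> {x. 0 \<le> (x - x\<^sub>0) \<bullet> e}"
    by (rule closure_minimal) (auto simp: V_def intro!: closed_Int closed_Collect_le continuous_intros)
  have fr_V: "dist x\<^sub>0 x = r \<or> (x - x\<^sub>0) \<bullet> e = 0" if "x \<in> frontier V" for x
    using that cl_V open_V by (force simp: frontier_def interior_open V_def)
  have bnd: "h (x\<^sub>0 + \<tau> *\<^sub>R e) - h (x\<^sub>0 - \<tau> *\<^sub>R e) \<le> 2 * (K + d) * (?N * \<tau> / r)" if d: "0 < d" for d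
  proof -
    obtain T where T: "0 < T" "\<And>t x. t \<ge> T \<Longrightarrow> x \<in> U \<Longrightarrow> \<bar>u x t - h x\<bar> \<le> d"
      by (rule caloric_limitE[OF lim d]) (rule that, assumption, blast)
    define c where "c = 2 * (K + d)"
    have c0: "0 \<le> c" using K0 d by (simp add: c_def)
    define v where "v x t = u x t - u (\<rho> x) t - c * half_ball_barrier x\<^sub>0 e r x" for x t
    have uK: "\<bar>u x t\<bar> \<le> K + d" if "x \<in> cball x\<^sub>0 r" "T \<le> t" for x t
      using T(2)[OF that(2), of x] K[OF that(1)] r(2) that(1) by (auto simp: abs_le_iff)
    have u2: "u x t - u (\<rho> x) t \<le> c" if "x \<in> cball x\<^sub>0 r" "T \<le> t" for x t
      using uK[OF that] uK[of "\<rho> x" t] that by (simp add: \<rho>_dist c_def abs_le_iff)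
    have VU: "V \<subseteq> U" "V \<subseteq> {x. \<rho> x \<in> U}"
      using r(2) \<rho>_dist by (auto simp: V_def subset_iff)
    have x: "x\<^sub>0 + \<tau> *\<^sub>R e \<in> V" using \<open>0 < \<tau>\<close> \<tau> e by (simp add: V_def dist_norm)
    have bound: "v (x\<^sub>0 + \<tau> *\<^sub>R e) t \<le> c * (r\<^sup>2 + 1) * exp (- (2 * DIM('a) / (r\<^sup>2 + 1)) * (t - T))" if "T \<le> t" for t
    proof (rule late_time_comparison[OF open_V _ T(1) c0 _ _ _ _ _ that])
      show "V \<subseteq> cball x\<^sub>0 r" by (auto simp: V_def)
      show "caloric V v" unfolding v_def
        using lim caloric_reflection[OF e, of U u x\<^sub>0] VU e
        by (intro caloric_diff caloric_half_ball_barrier) (auto simp: caloric_limit_def \<rho>_def intro: caloric_subset)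
      have sub: "closure V \<times> {0<..} \<subseteq> U \<times> {0<..}" "(\<lambda>p. (\<rho> (fst p), snd p)) ` (closure V \<times> {0<..}) \<subseteq> U \<times> {0<..}"
        using cl_V r(2) \<rho>_dist by (auto simp: subset_iff)
      have cu: "continuous_on (U \<times> {0<..}) (\<lambda>(x, t). u x t)" using lim by (simp add: caloric_limit_def)
      have cont_\<rho>: "continuous_on (closure V \<times> {0<..}) (\<lambda>p. (\<rho> (fst p), snd p :: real))"
        unfolding \<rho>_def by (intro continuous_intros)
      have cont_u\<rho>: "continuous_on (closure V \<times> {0<..}) ((\<lambda>(x, t). u x t) \<circ> (\<lambda>p. (\<rho> (fst p), snd p)))"
        by (intro continuous_on_compose cont_\<rho> continuous_on_subset[OF cu sub(2)])
      have "continuous_on (closure V \<times> {0<..}) (\<lambda>p. (\<lambda>(x, t). u x t) p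
          - ((\<lambda>(x, t). u x t) \<circ> (\<lambda>p. (\<rho> (fst p), snd p))) p - c * half_ball_barrier x\<^sub>0 e r (fst p))"
        unfolding half_ball_barrier_def using r(1)
        by (intro continuous_on_diff cont_u\<rho> continuous_on_subset[OF cu sub(1)]) (auto intro!: continuous_intros)
      then show "continuous_on (closure V \<times> {0<..}) (\<lambda>(x, t). v x t)"
        by (simp add: v_def case_prod_unfold o_def)
      show "v x T \<le> c" if "x \<in> closure V" for x
      proof -
        have "0 \<le> c * half_ball_barrier x\<^sub>0 e r x"
          using cl_V that c0 by (intro mult_nonneg_nonneg half_ball_barrier_bounds(1)[OF r(1) e]) auto
        then show ?thesis using u2[of x T] cl_V that by (auto simp: v_def)
      qed
      show "v x t \<le> 0" if x: "x \<in> frontier V" and t: "T \<le> t" for x t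
      proof -
        have xc: "x \<in> cball x\<^sub>0 r" "0 \<le> (x - x\<^sub>0) \<bullet> e" using x cl_V by (auto simp: frontier_def)
        show ?thesis
        proof (cases "(x - x\<^sub>0) \<bullet> e = 0")
          case True
          then have "0 \<le> c * half_ball_barrier x\<^sub>0 e r x" "\<rho> x = x"
            using half_ball_barrier_bounds(1)[OF r(1) e xc] c0 by (auto simp: \<rho>_def)
          then show ?thesis by (simp add: v_def)
        next
          case False
          then have "c * 1 \<le> c * half_ball_barrier x\<^sub>0 e r x"
            using half_ball_barrier_bounds(2)[OF r(1) e xc] fr_V[OF x] c0 by (intro mult_left_mono) auto
          then show ?thesis using u2[OF xc(1) t] by (simp add: v_def)
        qed
      qed
      show "x\<^sub>0 + \<tau> *\<^sub>R e \<in> closure V" using x closure_subset by blast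
    qed
    have \<rho>x: "\<rho> (x\<^sub>0 + \<tau> *\<^sub>R e) = x\<^sub>0 - \<tau> *\<^sub>R e"
      using e by (simp add: \<rho>_def algebra_simps) (simp flip: scaleR_add_left)
    have lim1: "(v (x\<^sub>0 + \<tau> *\<^sub>R e) \<longlongrightarrow> h (x\<^sub>0 + \<tau> *\<^sub>R e) - h (x\<^sub>0 - \<tau> *\<^sub>R e) - c * half_ball_barrier x\<^sub>0 e r (x\<^sub>0 + \<tau> *\<^sub>R e)) at_top"
      unfolding v_def \<rho>x using x VU \<rho>x by (intro tendsto_intros caloric_limit_tendsto[OF lim]) auto
    have lim2: "((\<lambda>t. c * (r\<^sup>2 + 1) * exp (- (2 * DIM('a) / (r\<^sup>2 + 1)) * (t - T))) \<longlongrightarrow> 0) at_top"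
      by (rule decay_tendsto_0) (simp add: add_nonneg_pos)
    have "h (x\<^sub>0 + \<tau> *\<^sub>R e) - h (x\<^sub>0 - \<tau> *\<^sub>R e) - c * half_ball_barrier x\<^sub>0 e r (x\<^sub>0 + \<tau> *\<^sub>R e) \<le> 0"
      by (rule tendsto_le[OF trivial_limit_at_top_linorder lim2 lim1])
         (use bound in \<open>unfold eventually_at_top_linorder, blast\<close>)
    moreover have "c * half_ball_barrier x\<^sub>0 e r (x\<^sub>0 + \<tau> *\<^sub>R e) \<le> c * (?N * \<tau> / r)"
      using half_ball_barrier_axis[OF r(1) e] c0 by (intro mult_left_mono) auto
    ultimately show ?thesis by (simp add: c_def)
  qed
  have "h (x\<^sub>0 + \<tau> *\<^sub>R e) - h (x\<^sub>0 - \<tau> *\<^sub>R e) \<le> 2 * K * (?N * \<tau> / r)"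
  proof (rule tendsto_lowerbound[where F = "at_right 0"])
    have "((\<lambda>d. 2 * (K + d) * (?N * \<tau> / r)) \<longlongrightarrow> 2 * (K + 0) * (?N * \<tau> / r)) (at_right 0)"
      by (intro tendsto_intros)
    then show "((\<lambda>d. 2 * (K + d) * (?N * \<tau> / r)) \<longlongrightarrow> 2 * K * (?N * \<tau> / r)) (at_right 0)" by simp
    show "\<forall>\<^sub>F d in at_right 0. h (x\<^sub>0 + \<tau> *\<^sub>R e) - h (x\<^sub>0 - \<tau> *\<^sub>R e) \<le> 2 * (K + d) * (?N * \<tau> / r)"
      using bnd by (auto simp: eventually_at_right_less intro!: eventually_mono[OF eventually_at_right_less])
  qed simp
  then show ?thesis by (simp add: mult_ac)
qed simp

section \<open>Unique continuation\<close>

text \<open>The increment is decomposed along the coordinate directions. The step in the direction \<open>i\<close> is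
centred at the midpoint \<open>c\<close> of two successive points of the path, and these are mirror images of
each other.\<close>

lemma gradient_bound:
  fixes x z :: "'a::euclidean_space"
  assumes lim: "caloric_limit U u h" and r: "0 < r" "cball x (2 * r) \<subseteq> U"
    and K: "\<And>y. y \<in> cball x (2 * r) \<Longrightarrow> \<bar>h y\<bar> \<le> K" and z: "DIM('a) * norm z \<le> r"
  shows "\<bar>h (x + z) - h x\<bar> \<le> K * ((real DIM('a))\<^sup>2 * norm z / r)"
proof -
  let ?N = "real DIM('a)"
  have K0: "0 \<le> K" using K[of x] r by (simp add: abs_le_iff)
  have N1: "1 \<le> ?N" by (simp add: DIM_positive Suc_leI)
  define p where "p B = x + (\<Sum>i\<in>B. (z \<bullet> i) *\<^sub>R i)" for B
  have "B \<subseteq> Basis \<longrightarrow> \<bar>h (p B) - h x\<bar> \<le> card B * (K * (?N * norm z / r))" if "finite B" for B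
    using that
  proof (induction B rule: finite_induct)
    case empty
    then show ?case by (simp add: p_def)
  next
    case (insert i B)
    show ?case
    proof
      assume B: "insert i B \<subseteq> Basis"
      then have i: "i \<in> Basis" by simp
      define \<tau> where "\<tau> = \<bar>z \<bullet> i\<bar> / 2"
      define s where "s = sgn (z \<bullet> i)"
      define c where "c = p B + ((z \<bullet> i) / 2) *\<^sub>R i"
      have zi: "\<bar>z \<bullet> i\<bar> \<le> norm z" using Basis_le_norm[OF i] by simp
      have "1 * norm z \<le> ?N * norm z" using N1 by (intro mult_right_mono) auto
      then have zr: "norm z \<le> r" using z by simp
      have "norm (\<Sum>j\<in>B. (z \<bullet> j) *\<^sub>R j) \<le> (\<Sum>j\<in>B. norm z)"
        using B by (intro sum_norm_le) (auto simp: Basis_le_norm subset_iff)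
      then have 1: "norm (\<Sum>j\<in>B. (z \<bullet> j) *\<^sub>R j) \<le> card B * norm z" by simp
      have "card (insert i B) \<le> DIM('a)" using B by (intro card_mono) auto
      then have "real (card B) + 1 \<le> ?N" using insert.hyps by simp
      then have "(real (card B) + 1) * norm z \<le> ?N * norm z" by (intro mult_right_mono) auto
      then have 2: "card B * norm z + norm z \<le> r" using z by (simp add: algebra_simps)
      have "norm (((z \<bullet> i) / 2) *\<^sub>R i) \<le> norm z" using i zi by simp
      then have "norm (c - x) \<le> r"
        using 1 2 norm_triangle_ineq[of "\<Sum>j\<in>B. (z \<bullet> j) *\<^sub>R j" "((z \<bullet> i) / 2) *\<^sub>R i"]
        unfolding c_def p_def by (simp add: add.assoc)
      then have sub: "cball c r \<subseteq> cball x (2 * r)"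
        by (subst cball_subset_cball_iff) (auto simp: dist_norm)
      have \<tau>: "0 \<le> \<tau>" "\<tau> < r" using zi zr r(1) by (auto simp: \<tau>_def)
      have a: "h (c + \<tau> *\<^sub>R i) - h (c - \<tau> *\<^sub>R i) \<le> 2 * K * ?N * \<tau> / r"
        by (rule symmetric_gradient_bound[OF lim r(1) _ _ i \<tau>]) (use sub r(2) K in auto)
      have b: "- h (c + \<tau> *\<^sub>R i) - - h (c - \<tau> *\<^sub>R i) \<le> 2 * K * ?N * \<tau> / r"
        by (rule symmetric_gradient_bound[OF caloric_limit_minus[OF lim] r(1) _ _ i \<tau>]) (use sub r(2) K in auto)
      \<comment> \<open>The sign of \<open>z \<bullet> i\<close> decides which end is which.\<close>
      have ends: "{c + \<tau> *\<^sub>R i, c - \<tau> *\<^sub>R i} = {p (insert i B), p B}"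
      proof -
        define q where "q = (z \<bullet> i) / 2"
        have zq: "z \<bullet> i = q + q" by (simp add: q_def)
        have "p (insert i B) = p B + (z \<bullet> i) *\<^sub>R i" using insert.hyps by (simp add: p_def add_ac)
        also have "\<dots> = (p B + q *\<^sub>R i) + q *\<^sub>R i" by (simp only: zq scaleR_add_left add.assoc)
        finally have 1: "c + q *\<^sub>R i = p (insert i B)" "c - q *\<^sub>R i = p B"
          unfolding c_def q_def[symmetric] by simp_all
        have "\<tau> = q \<or> \<tau> = - q" by (simp add: \<tau>_def q_def abs_if)
        then show ?thesis
        proof
          assume t: "\<tau> = q"
          show ?thesis unfolding t 1 ..
        next
          assume t: "\<tau> = - q"
          have 2: "c + (- q) *\<^sub>R i = p B" "c - (- q) *\<^sub>R i = p (insert i B)" using 1 by simp_all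
          show ?thesis unfolding t 2 by (rule insert_commute)
        qed
      qed
      have "\<bar>h (p (insert i B)) - h (p B)\<bar> \<le> 2 * K * ?N * \<tau> / r"
        using a b ends unfolding doubleton_eq_iff by (auto simp: abs_le_iff)
      also have "\<dots> \<le> K * (?N * norm z / r)"
      proof -
        have "K * ?N * (2 * \<tau>) \<le> K * ?N * norm z" using zi K0 by (intro mult_left_mono) (auto simp: \<tau>_def)
        then have "K * ?N * (2 * \<tau>) / r \<le> K * ?N * norm z / r" using r(1) by (intro divide_right_mono) auto
        then show ?thesis by (simp add: mult_ac)
      qed
      finally have "\<bar>h (p (insert i B)) - h (p B)\<bar> \<le> K * (?N * norm z / r)" .
      moreover have "\<bar>h (p B) - h x\<bar> \<le> card B * (K * (?N * norm z / r))" using insert.IH B by simp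
      moreover have "real (card (insert i B)) * (K * (?N * norm z / r))
          = real (card B) * (K * (?N * norm z / r)) + K * (?N * norm z / r)"
      proof -
        have cc: "real (card (insert i B)) = real (card B) + 1" using insert.hyps by simp
        show ?thesis unfolding cc by (simp only: distrib_right mult_1_left)
      qed
      ultimately show "\<bar>h (p (insert i B)) - h x\<bar> \<le> card (insert i B) * (K * (?N * norm z / r))" by linarith
    qed
  qed
  from this[of Basis] have "\<bar>h (p Basis) - h x\<bar> \<le> ?N * (K * (?N * norm z / r))" by simp
  moreover have "p Basis = x + z" by (simp add: p_def euclidean_representation)
  moreover have "?N * (K * (?N * norm z / r)) = K * (?N\<^sup>2 * norm z / r)"
    by (simp add: power2_eq_square)
  ultimately show ?thesis by metis
qed

text \<open>A first difference of an equilibrium is again an equilibrium, on a domain that shrinks by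
\<open>3 * r\<close>: \<open>2 * r\<close> is used up by the gradient estimate and \<open>r\<close> covers the translation.\<close>

lemma iterated_difference_bound:
  fixes x z :: "'a::euclidean_space"
  assumes "caloric_limit U u h" and r: "0 < r" "cball x (3 * real k * r) \<subseteq> U"
    and "\<And>y. y \<in> cball x (3 * real k * r) \<Longrightarrow> \<bar>h y\<bar> \<le> K" and z: "DIM('a) * norm z \<le> r"
  shows "\<bar>(dif ^^ k) (\<lambda>i. h (x + real i *\<^sub>R z)) 0\<bar> \<le> K * ((real DIM('a))\<^sup>2 * norm z / r) ^ k"
  using assms(1) r(2) assms(4)
proof (induction k arbitrary: U u h K)
  case 0
  then show ?case using r(1) by simp
next
  case (Suc k)
  let ?U = "{y \<in> U. y + z \<in> U}" and ?q = "(real DIM('a))\<^sup>2 * norm z / r"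
  have zr: "norm z \<le> r"
  proof -
    have "1 * norm z \<le> real DIM('a) * norm z" by (intro mult_right_mono) (simp_all add: DIM_positive Suc_leI)
    then show ?thesis using z by simp
  qed
  have lim: "caloric_limit ?U (\<lambda>y t. u (y + z) t - u y t) (\<lambda>y. h (y + z) - h y)"
    by (rule caloric_limit_diff; rule caloric_limit_subset[OF caloric_limit_translate[OF Suc.prems(1)]]
        caloric_limit_subset[OF Suc.prems(1)]) auto
  have grow: "cball y s \<subseteq> cball x (3 * real (Suc k) * r)" if "y \<in> cball x (3 * real k * r)" "s \<le> 3 * r" for y s
  proof
    fix w assume "w \<in> cball y s"
    then have "dist x w \<le> 3 * real k * r + 3 * r" using that dist_triangle[of x w y] by simp
    then show "w \<in> cball x (3 * real (Suc k) * r)" by (simp add: algebra_simps)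
  qed
  have "\<bar>(dif ^^ k) (\<lambda>i. h (x + real i *\<^sub>R z + z) - h (x + real i *\<^sub>R z)) 0\<bar> \<le> K * ?q * ?q ^ k"
  proof (rule Suc.IH[OF lim])
    show "cball x (3 * real k * r) \<subseteq> ?U"
    proof
      fix y assume y: "y \<in> cball x (3 * real k * r)"
      have "y \<in> cball y r" "y + z \<in> cball y r" using zr r(1) by (auto simp: dist_norm)
      moreover have "cball y r \<subseteq> U" using grow[OF y, of r] r(1) Suc.prems(2) by (simp add: order_trans)
      ultimately show "y \<in> ?U" by blast
    qed
    fix y assume y: "y \<in> cball x (3 * real k * r)"
    show "\<bar>h (y + z) - h y\<bar> \<le> K * ?q"
    proof (rule gradient_bound[OF Suc.prems(1) r(1) _ _ z])
      have sub: "cball y (2 * r) \<subseteq> cball x (3 * real (Suc k) * r)" using r(1) by (intro grow[OF y]) simp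
      then show "cball y (2 * r) \<subseteq> U" using Suc.prems(2) by (rule order_trans)
      show "\<bar>h w\<bar> \<le> K" if "w \<in> cball y (2 * r)" for w
        using that sub by (intro Suc.prems(3)) blast
    qed
  qed
  moreover have "(\<lambda>i. h (x + real i *\<^sub>R z + z) - h (x + real i *\<^sub>R z)) = dif (\<lambda>i. h (x + real i *\<^sub>R z))"
    by (rule ext) (simp add: dif_def scaleR_add_left add_ac)
  ultimately show ?case by (simp add: funpow_Suc_right mult.assoc del: funpow.simps)
qed

text \<open>This is the spatial counterpart of \<open>vanishing_extends_past\<close>. The differences of order \<open>k\<close> use
balls of radius \<open>r / (3 * k)\<close>, so that the gradient estimate gains the factor
\<open>3 * N\<^sup>2 * \<sigma> \<le> 1 / 8\<close> in each of the \<open>k\<close> differences, against \<open>4 ^ k\<close> from extrapolation.\<close>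

lemma line_extension:
  fixes x v :: "'a::euclidean_space"
  assumes lim: "caloric_limit U u h" and K: "\<And>y. y \<in> U \<Longrightarrow> \<bar>h y\<bar> \<le> K"
    and r: "0 < r" "norm v \<le> r" and \<sigma>: "0 < \<sigma>" "\<sigma> \<le> L" "\<sigma> \<le> 1 / (24 * (real DIM('a))\<^sup>2)"
    and zero: "\<And>s. 0 \<le> s \<Longrightarrow> s \<le> L \<Longrightarrow> h (x + s *\<^sub>R v) = 0"
    and U: "\<And>s. 0 \<le> s \<Longrightarrow> s \<le> L \<Longrightarrow> cball (x + s *\<^sub>R v) r \<subseteq> U"
  shows "h (x + (L + \<sigma>) *\<^sub>R v) = 0"
proof (rule zero_if_geometric_bound[where C = K and q = "1 / 2"])
  fix k :: nat assume k: "k \<ge> 1"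
  let ?N = "real DIM('a)"
  define z where "z = (\<sigma> / real k) *\<^sub>R v"
  define p where "p i = x + (L - \<sigma> + real i * (\<sigma> / real k)) *\<^sub>R v" for i :: nat
  have N1: "1 \<le> ?N" by (simp add: DIM_positive Suc_leI)
  have K0: "0 \<le> K" using K[of x] U[of 0] \<sigma> r by (force simp: abs_le_iff)
  have range: "0 \<le> L - \<sigma> + real i * (\<sigma> / real k)" "L - \<sigma> + real i * (\<sigma> / real k) \<le> L" if "i \<le> k" for i
  proof -
    have "real i * (\<sigma> / real k) \<le> real k * (\<sigma> / real k)"
      using that \<sigma> by (intro mult_right_mono) auto
    also have "\<dots> = \<sigma>" using k by simp
    finally show "L - \<sigma> + real i * (\<sigma> / real k) \<le> L" by simp
    have "0 \<le> real i * (\<sigma> / real k)" using \<sigma> by simp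
    then show "0 \<le> L - \<sigma> + real i * (\<sigma> / real k)" using \<sigma>(2) by simp
  qed
  have nz: "norm z \<le> \<sigma> / real k * r"
    using r \<sigma> by (simp add: z_def) (intro divide_right_mono mult_left_mono, auto)
  define \<rho> where "\<rho> = r / (3 * real k)"
  have \<rho>: "0 < \<rho>" "3 * real k * \<rho> = r" using r k by (auto simp: \<rho>_def)
  have small: "?N\<^sup>2 * norm z / \<rho> \<le> 1 / 8"
  proof -
    have "?N\<^sup>2 * norm z \<le> ?N\<^sup>2 * (\<sigma> / real k * r)" using nz by (intro mult_left_mono) auto
    also have "\<dots> = (?N\<^sup>2 * \<sigma>) * (3 * \<rho>)" using k by (simp add: \<rho>_def)
    also have "\<dots> \<le> (1 / 24) * (3 * \<rho>)"
      using \<sigma>(3) N1 \<rho> by (intro mult_right_mono) (auto simp: field_simps)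
    finally show ?thesis using \<rho> by (simp add: field_simps)
  qed
  have Nz: "?N * norm z \<le> \<rho>"
  proof -
    have "?N * norm z \<le> ?N\<^sup>2 * norm z"
      using N1 by (intro mult_right_mono) (auto simp: power2_eq_square)
    then show ?thesis using small \<rho> by (simp add: field_simps)
  qed
  have step: "p (i + j) = p i + real j *\<^sub>R z" for i j
    by (simp add: p_def z_def algebra_simps)
  have "\<bar>(dif ^^ k) (\<lambda>i. h (p i)) i\<bar> \<le> K * (1 / 8) ^ k" if "i \<le> k" for i
  proof -
    have "\<bar>(dif ^^ k) (\<lambda>j. h (p i + real j *\<^sub>R z)) 0\<bar> \<le> K * (?N\<^sup>2 * norm z / \<rho>) ^ k"
    proof (rule iterated_difference_bound[OF lim \<rho>(1) _ _ Nz])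
      show "cball (p i) (3 * real k * \<rho>) \<subseteq> U" unfolding \<rho>(2) p_def using range[OF that] by (intro U)
      then show "\<bar>h y\<bar> \<le> K" if "y \<in> cball (p i) (3 * real k * \<rho>)" for y using that K by auto
    qed
    also have "\<dots> \<le> K * (1 / 8) ^ k" using small K0 \<rho> by (intro mult_left_mono power_mono) auto
    finally show ?thesis using dif_shift[of k "\<lambda>i. h (p i)" i 0] by (simp add: step)
  qed
  moreover have "h (p i) = 0" if "i < k" for i
    unfolding p_def using range[of i] that by (intro zero) auto
  ultimately have "\<bar>h (p (2 * k))\<bar> \<le> K * (1 / 8) ^ k * 2 ^ (2 * k)"
    by (intro extrapolation_bound[of k k]) auto
  also have "\<dots> = K * (1 / 2) ^ k"
    by (simp add: power_mult power_mult_distrib[symmetric] mult.assoc)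
  also have "p (2 * k) = x + (L + \<sigma>) *\<^sub>R v" using k by (simp add: p_def)
  finally show "\<bar>h (x + (L + \<sigma>) *\<^sub>R v)\<bar> \<le> K * (1 / 2) ^ k" .
qed auto

text \<open>The admissible length \<open>\<sigma>\<close> of an extension depends neither on the direction nor on the length
already covered, so finitely many extensions reach the whole segment from \<open>x\<close> to \<open>y\<close>.\<close>

lemma vanishing_on_larger_ball:
  fixes x y :: "'a::euclidean_space"
  assumes lim: "caloric_limit U u h" and K: "\<And>y. y \<in> U \<Longrightarrow> \<bar>h y\<bar> \<le> K"
    and r: "0 < r" "cball x (2 * r) \<subseteq> U" and \<epsilon>: "0 < \<epsilon>" "\<And>y. y \<in> cball x \<epsilon> \<Longrightarrow> h y = 0"
    and y: "y \<in> cball x r"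
  shows "h y = 0"
proof -
  define v where "v = y - x"
  have v: "norm v \<le> r" using y by (simp add: v_def dist_norm norm_minus_commute)
  \<comment> \<open>The entry \<open>\<epsilon> / r\<close> puts the first piece of the segment inside the ball where \<open>h\<close> is zero.\<close>
  define \<sigma> where "\<sigma> = min (min 1 (\<epsilon> / r)) (1 / (24 * (real DIM('a))\<^sup>2))"
  have \<sigma>0: "0 < \<sigma>" using \<epsilon> r by (simp add: \<sigma>_def)
  have "\<forall>s. 0 \<le> s \<and> s \<le> \<sigma> * real (Suc j) \<and> s \<le> 1 \<longrightarrow> h (x + s *\<^sub>R v) = 0" for j
  proof (induction j)
    case 0
    show ?case
    proof (intro allI impI, elim conjE)
      fix s :: real assume s: "0 \<le> s" "s \<le> \<sigma> * real (Suc 0)"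
      have "s * norm v \<le> \<epsilon> / r * r" using s v r(1) \<epsilon> by (intro mult_mono) (auto simp: \<sigma>_def)
      then show "h (x + s *\<^sub>R v) = 0" using s r(1) by (intro \<epsilon>(2)) (simp add: dist_norm)
    qed
  next
    case (Suc j)
    show ?case
    proof (intro allI impI, elim conjE)
      fix s :: real assume s: "0 \<le> s" "s \<le> \<sigma> * real (Suc (Suc j))" "s \<le> 1"
      define L where "L = \<sigma> * real (Suc j)"
      show "h (x + s *\<^sub>R v) = 0"
      proof (cases "s \<le> L")
        case True
        then show ?thesis using Suc s by (simp add: L_def)
      next
        case False
        have L: "\<sigma> \<le> L" using \<sigma>0 by (simp add: L_def)
        have d: "0 < s - L" "s - L \<le> \<sigma>" using False s by (auto simp: L_def algebra_simps)
        have "h (x + (L + (s - L)) *\<^sub>R v) = 0"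
        proof (rule line_extension[OF lim K r(1) v d(1)])
          show "s - L \<le> 1 / (24 * (real DIM('a))\<^sup>2)" using d(2) by (simp add: \<sigma>_def)
          fix a assume a: "0 \<le> a" "a \<le> L"
          then show "h (x + a *\<^sub>R v) = 0" using Suc False s by (simp add: L_def)
          have "a * norm v \<le> 1 * r" using a False s v by (intro mult_mono) auto
          then have "cball (x + a *\<^sub>R v) r \<subseteq> cball x (2 * r)"
            using a r(1) by (subst cball_subset_cball_iff) (auto simp: dist_norm)
          then show "cball (x + a *\<^sub>R v) r \<subseteq> U" using r(2) by auto
        qed (use L d in auto)
        then show ?thesis by simp
      qed
    qed
  qed
  moreover obtain j where "1 / \<sigma> < real j" using reals_Archimedean2 by blast
  then have "1 \<le> \<sigma> * real (Suc j)" using \<sigma>0 by (simp add: field_simps)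
  ultimately have "h (x + 1 *\<^sub>R v) = 0" by (meson order_refl zero_le_one)
  then show ?thesis by (simp add: v_def)
qed

text \<open>The interior \<open>Z\<close> of the zero set is also closed in \<open>U\<close>: around a point of \<open>Z\<close> the function
vanishes on a ball whose radius depends only on the distance to the complement of \<open>U\<close>, so that the
balls around points of \<open>Z\<close> close to a given point of \<open>U\<close> cover a neighbourhood of that point.\<close>

lemma unique_continuation:
  fixes U :: "'a::euclidean_space set"
  assumes lim: "caloric_limit U u h" and K: "\<And>y. y \<in> U \<Longrightarrow> \<bar>h y\<bar> \<le> K"
    and U: "open U" "connected U"
    and D: "open D" "D \<noteq> {}" "D \<subseteq> U" "\<And>y. y \<in> D \<Longrightarrow> h y = 0" and x: "x \<in> U"
  shows "h x = 0"
proof -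
  define Z where "Z = {x \<in> U. \<exists>\<epsilon>>0. \<forall>y\<in>cball x \<epsilon>. h y = 0}"
  have zero_ball: "cball p (r / 2) \<subseteq> Z" if p: "p \<in> Z" and r: "0 < r" "cball p (2 * r) \<subseteq> U" for p r
  proof
    fix y assume y: "y \<in> cball p (r / 2)"
    obtain \<epsilon> where \<epsilon>: "0 < \<epsilon>" "\<And>y. y \<in> cball p \<epsilon> \<Longrightarrow> h y = 0" using p by (auto simp: Z_def)
    have "cball y (r / 2) \<subseteq> cball p r" using y by (subst cball_subset_cball_iff) (auto simp: dist_commute)
    then have "\<forall>q\<in>cball y (r / 2). h q = 0"
      using vanishing_on_larger_ball[OF lim K r \<epsilon>] by blast
    moreover have "y \<in> U" using y r by (auto simp: subset_iff)
    ultimately show "y \<in> Z" using r by (auto simp: Z_def intro!: exI[of _ "r / 2"])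
  qed
  have room: "\<exists>r>0. cball p (4 * r) \<subseteq> U" if "p \<in> U" for p
  proof -
    obtain e where "0 < e" "cball p e \<subseteq> U" using open_contains_cball_eq[OF U(1)] \<open>p \<in> U\<close> by metis
    then show ?thesis by (intro exI[of _ "e / 4"]) simp
  qed
  have "open Z"
  proof (unfold open_contains_cball, intro ballI)
    fix p assume p: "p \<in> Z"
    then have "p \<in> U" by (simp add: Z_def)
    from room[OF this] obtain r where r: "r > 0" "cball p (4 * r) \<subseteq> U" by blast
    then have "cball p (2 * r) \<subseteq> U" by (intro order_trans[OF _ r(2)] subset_cball) auto
    then show "\<exists>e>0. cball p e \<subseteq> Z" using zero_ball[OF p r(1)] r(1) by (intro exI[of _ "r / 2"]) auto
  qed
  moreover have "open (U - Z)"
  proof (unfold open_contains_cball, intro ballI)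
    fix p assume p: "p \<in> U - Z"
    then have "p \<in> U" by simp
    from room[OF this] obtain r where r: "r > 0" "cball p (4 * r) \<subseteq> U" by blast
    have "q \<notin> Z" if q: "q \<in> cball p (r / 2)" for q
    proof
      assume "q \<in> Z"
      have "cball q (2 * r) \<subseteq> cball p (4 * r)"
        using q r(1) by (subst cball_subset_cball_iff) (auto simp: dist_commute)
      then have "cball q (r / 2) \<subseteq> Z" using zero_ball[OF \<open>q \<in> Z\<close> r(1)] r(2) by blast
      then show False using p q by (auto simp: dist_commute subset_iff)
    qed
    moreover have "cball p (r / 2) \<subseteq> U" using r(1) by (intro order_trans[OF _ r(2)] subset_cball) auto
    ultimately show "\<exists>e>0. cball p e \<subseteq> U - Z" using r(1) by (intro exI[of _ "r / 2"]) auto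
  qed
  moreover have "Z \<inter> U \<noteq> {}"
  proof -
    obtain p where p: "p \<in> D" using D(2) by blast
    then obtain e where "0 < e" "cball p e \<subseteq> D" using open_contains_cball_eq[OF D(1)] by metis
    then have "p \<in> Z" using p D(3,4) by (auto simp: Z_def intro!: exI[of _ e])
    then show ?thesis by (auto simp: Z_def)
  qed
  ultimately have "U \<subseteq> Z"
    using connectedD[OF U(2), of Z "U - Z"] by (auto simp: Z_def)
  then have "x \<in> Z" using x by auto
  then show ?thesis by (force simp: Z_def)
qed

section \<open>The solution with time-independent boundary values\<close>

lemma heat_data_time_increment:
  assumes hd: "heat_data U u ut D1 D2" and "0 \<le> s"
  shows "heat_data U (\<lambda>x t. u x (t + s) - u x t) (\<lambda>x t. ut x (t + s) - ut x t)
     (\<lambda>i x t. D1 i x (t + s) - D1 i x t) (\<lambda>i x t. D2 i x (t + s) - D2 i x t)"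
proof (rule heat_data_diff[OF _ hd])
  show "heat_data U (\<lambda>x t. u x (t + s)) (\<lambda>x t. ut x (t + s)) (\<lambda>i x t. D1 i x (t + s)) (\<lambda>i x t. D2 i x (t + s))"
    using assms unfolding heat_data_def by (simp add: DERIV_shift[symmetric])
qed

lemma continuous_on_time_increment:
  assumes c: "continuous_on (S \<times> {0<..}) (\<lambda>(x, t). F x t :: real)" and "0 \<le> (s :: real)"
  shows "continuous_on (S \<times> {0<..}) (\<lambda>(x, t). F x (t + s) - F x t)"
proof -
  have "continuous_on (S \<times> {0<..}) ((\<lambda>(x, t). F x t) \<circ> (\<lambda>p. (fst p, snd p + s)))"
    by (intro continuous_on_compose continuous_intros continuous_on_subset[OF c]) (use \<open>0 \<le> s\<close> in auto)
  then have "continuous_on (S \<times> {0<..}) (\<lambda>p. ((\<lambda>(x, t). F x t) \<circ> (\<lambda>p. (fst p, snd p + s))) p - (\<lambda>(x, t). F x t) p)"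
    by (intro continuous_on_diff c)
  then show ?thesis by (simp add: o_def case_prod_unfold)
qed

lemma classical_heat_equation_data:
  assumes "classical_heat_equation \<Omega> u"
  obtains ut D1 D2 where "heat_data \<Omega> u ut D1 D2"
    "\<forall>x\<in>\<Omega>. \<forall>t>0. ut x t = (\<Sum>i\<in>Basis. D2 i x t)"
    "continuous_on (\<Omega> \<times> {0<..}) (\<lambda>(x, t). ut x t)"
    "\<forall>i\<in>Basis. continuous_on (\<Omega> \<times> {0<..}) (\<lambda>(x, t). D2 i x t)"
proof -
  obtain ut Du D2u where P: "\<forall>x\<in>\<Omega>. \<forall>t>0.
           ((\<lambda>s. u x s) has_real_derivative ut x t) (at t) \<and>
           (\<forall>i\<in>Basis. ((\<lambda>s. u (x + s *\<^sub>R i) t) has_real_derivative Du i x t) (at 0)) \<and>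
           (\<forall>i\<in>Basis. \<forall>j\<in>Basis.
              ((\<lambda>s. Du i (x + s *\<^sub>R j) t) has_real_derivative D2u i j x t) (at 0)) \<and>
           ut x t = (\<Sum>i\<in>Basis. D2u i i x t)"
    and cut: "continuous_on (\<Omega> \<times> {0<..}) (\<lambda>(x, t). ut x t)"
    and cD2: "\<forall>i\<in>Basis. \<forall>j\<in>Basis. continuous_on (\<Omega> \<times> {0<..}) (\<lambda>(x, t). D2u i j x t)"
    using assms unfolding classical_heat_equation_def by (elim exE conjE) (rule that)
  show ?thesis
  proof (rule that[of ut Du "\<lambda>i. D2u i i"])
    show "heat_data \<Omega> u ut Du (\<lambda>i. D2u i i)" using P unfolding heat_data_def by blast
    show "\<forall>x\<in>\<Omega>. \<forall>t>0. ut x t = (\<Sum>i\<in>Basis. D2u i i x t)" using P by blast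
    show "continuous_on (\<Omega> \<times> {0<..}) (\<lambda>(x, t). ut x t)" by (rule cut)
    show "\<forall>i\<in>Basis. continuous_on (\<Omega> \<times> {0<..}) (\<lambda>(x, t). D2u i i x t)" using cD2 by blast
  qed
qed

text \<open>Since the boundary values are independent of time, increments of \<open>u\<close> in time vanish on the
boundary. The bound \<open>K\<close> serves all increments at once.\<close>

lemma heat_solution_increment:
  assumes sol: "heat_solution \<Omega> f u"
  obtains K where "\<And>s. 0 \<le> s \<Longrightarrow> dirichlet_caloric \<Omega> (\<lambda>x t. u x (t + s) - u x t) K"
proof -
  have bdd: "bounded ((\<lambda>(x, t). u x t) ` (closure \<Omega> \<times> {0..} - frontier \<Omega> \<times> {0}))"
    and cont: "continuous_on (closure \<Omega> \<times> {0..} - frontier \<Omega> \<times> {0}) (\<lambda>(x, t). u x t)"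
    and f: "\<And>x t. x \<in> frontier \<Omega> \<Longrightarrow> 0 < t \<Longrightarrow> u x t = f x"
    and classical: "classical_heat_equation \<Omega> u"
    using sol unfolding heat_solution_def by blast+
  obtain K where K: "\<And>x t. x \<in> closure \<Omega> \<Longrightarrow> 0 < t \<Longrightarrow> \<bar>u x t\<bar> \<le> K"
    using bdd unfolding bounded_iff by force
  have c: "continuous_on (closure \<Omega> \<times> {0<..}) (\<lambda>(x, t). u x t)"
    by (rule continuous_on_subset[OF cont]) auto
  obtain ut D1 D2 where hd: "heat_data \<Omega> u ut D1 D2"
    and eq: "\<forall>x\<in>\<Omega>. \<forall>t>0. ut x t = (\<Sum>i\<in>Basis. D2 i x t)"
    and cut: "continuous_on (\<Omega> \<times> {0<..}) (\<lambda>(x, t). ut x t)"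
    and cD2: "\<forall>i\<in>Basis. continuous_on (\<Omega> \<times> {0<..}) (\<lambda>(x, t). D2 i x t)"
    by (rule classical_heat_equation_data[OF classical])
  show ?thesis
  proof (rule that[of "2 * K"])
    fix s :: real assume s: "0 \<le> s"
    show "dirichlet_caloric \<Omega> (\<lambda>x t. u x (t + s) - u x t) (2 * K)"
      unfolding dirichlet_caloric_def
    proof (intro conjI exI)
      show "heat_data \<Omega> (\<lambda>x t. u x (t + s) - u x t) (\<lambda>x t. ut x (t + s) - ut x t)
        (\<lambda>i x t. D1 i x (t + s) - D1 i x t) (\<lambda>i x t. D2 i x (t + s) - D2 i x t)"
        by (rule heat_data_time_increment[OF hd s])
      show "\<forall>x\<in>\<Omega>. \<forall>t>0. ut x (t + s) - ut x t = (\<Sum>i\<in>Basis. D2 i x (t + s) - D2 i x t)"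
        using s by (simp add: eq sum_subtractf)
      show "continuous_on (\<Omega> \<times> {0<..}) (\<lambda>(x, t). ut x (t + s) - ut x t)"
        by (rule continuous_on_time_increment[OF cut s])
      show "\<forall>i\<in>Basis. continuous_on (\<Omega> \<times> {0<..}) (\<lambda>(x, t). D2 i x (t + s) - D2 i x t)"
        using cD2 continuous_on_time_increment[OF _ s] by blast
      show "continuous_on (closure \<Omega> \<times> {0<..}) (\<lambda>(x, t). u x (t + s) - u x t)"
        by (rule continuous_on_time_increment[OF c s])
      show "\<forall>x\<in>frontier \<Omega>. \<forall>t>0. u x (t + s) - u x t = 0" using f s by simp
      show "\<forall>x\<in>closure \<Omega>. \<forall>t>0. \<bar>u x (t + s) - u x t\<bar> \<le> 2 * K"
      proof (intro ballI allI impI)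
        fix x and t :: real assume "x \<in> closure \<Omega>" "0 < t"
        then show "\<bar>u x (t + s) - u x t\<bar> \<le> 2 * K" using K[of x t] K[of x "t + s"] s by linarith
      qed
    qed
  qed
qed

text \<open>A \<open>k\<close>-th difference of the increment over the time \<open>a / k\<close> is a \<open>(k + 1)\<close>-st difference of \<open>u\<close>, so
\<open>time_difference_bound\<close> gives the hypothesis of \<open>vanishing_for_all_times\<close>.\<close>

lemma equality_for_all_times:
  assumes \<Omega>: "open \<Omega>" "bounded \<Omega>" and sol: "heat_solution \<Omega> f u"
    and xy: "x \<in> \<Omega>" "y \<in> \<Omega>" and "0 < b" and eq: "\<And>t. 0 < t \<Longrightarrow> t \<le> b \<Longrightarrow> u x t = u y t" and "0 < t"
  shows "u x t = u y t"
proof -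
  obtain K where K: "\<And>s. 0 \<le> s \<Longrightarrow> dirichlet_caloric \<Omega> (\<lambda>x t. u x (t + s) - u x t) K"
    using heat_solution_increment[OF sol] by blast
  have bound: "\<exists>C. \<forall>k\<ge>1. \<forall>t>5 * a. \<bar>(dif ^^ Suc k) (\<lambda>i. u z (t + real i * (a / real k))) 0\<bar> \<le> C / 5 ^ k"
    if a: "0 < a" and z: "z \<in> \<Omega>" for a z
  proof -
    obtain C where C: "\<And>w k t. dirichlet_caloric \<Omega> w K \<Longrightarrow> k \<ge> 1 \<Longrightarrow> 5 * a < t \<Longrightarrow>
        \<bar>(dif ^^ k) (\<lambda>i. w z (t + real i * (a / real k))) 0\<bar> \<le> C / 5 ^ k"
      by (rule time_difference_bound[OF \<Omega> a z, where K = K]) (rule that, blast)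
    show ?thesis
    proof (intro exI[of _ C] allI impI)
      fix k :: nat and t :: real assume k: "1 \<le> k" and t: "5 * a < t"
      have "dif (\<lambda>i. u z (t + real i * (a / real k)))
          = (\<lambda>i. u z (t + real i * (a / real k) + a / real k) - u z (t + real i * (a / real k)))"
        by (rule ext) (simp add: dif_def algebra_simps add_divide_distrib)
      then show "\<bar>(dif ^^ Suc k) (\<lambda>i. u z (t + real i * (a / real k))) 0\<bar> \<le> C / 5 ^ k"
        using C[OF K[of "a / real k"] k t] a by (simp add: funpow_Suc_right del: funpow.simps)
    qed
  qed
  have "u x t - u y t = 0"
  proof (rule vanishing_for_all_times[of "\<lambda>t. u x t - u y t", OF _ _ \<open>0 < b\<close> \<open>0 < t\<close>])
    fix a :: real assume "0 < a"
    obtain C where C: "\<forall>k\<ge>1. \<forall>t>5 * a. \<bar>(dif ^^ Suc k) (\<lambda>i. u x (t + real i * (a / real k))) 0\<bar> \<le> C / 5 ^ k"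
      using bound[OF \<open>0 < a\<close> xy(1)] by blast
    obtain C' where C': "\<forall>k\<ge>1. \<forall>t>5 * a. \<bar>(dif ^^ Suc k) (\<lambda>i. u y (t + real i * (a / real k))) 0\<bar> \<le> C' / 5 ^ k"
      using bound[OF \<open>0 < a\<close> xy(2)] by blast
    show "\<exists>C. \<forall>k\<ge>1. \<forall>t>5 * a.
      \<bar>(dif ^^ Suc k) (\<lambda>i. u x (t + real i * (a / real k)) - u y (t + real i * (a / real k))) 0\<bar> \<le> C / 5 ^ k"
    proof (intro exI[of _ "C + C'"] allI impI)
      fix k :: nat and t :: real assume kt: "1 \<le> k" "5 * a < t"
      have "\<bar>(dif ^^ Suc k) (\<lambda>i. u x (t + real i * (a / real k))) 0\<bar> \<le> C / 5 ^ k" using C kt by blast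
      moreover have "\<bar>(dif ^^ Suc k) (\<lambda>i. u y (t + real i * (a / real k))) 0\<bar> \<le> C' / 5 ^ k" using C' kt by blast
      ultimately show "\<bar>(dif ^^ Suc k) (\<lambda>i. u x (t + real i * (a / real k)) - u y (t + real i * (a / real k))) 0\<bar> \<le> (C + C') / 5 ^ k"
        unfolding dif_diff add_divide_distrib by linarith
    qed
  qed (use eq in auto)
  then show ?thesis by simp
qed

lemma limit_with_rate:
  fixes F g :: "real \<Rightarrow> real"
  assumes F: "\<And>t s. 1 \<le> t \<Longrightarrow> 0 \<le> s \<Longrightarrow> \<bar>F (t + s) - F t\<bar> \<le> g t" and g: "(g \<longlongrightarrow> 0) at_top"
  shows "\<exists>l. \<forall>t\<ge>1. \<bar>F t - l\<bar> \<le> g t"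
proof -
  have F': "\<bar>F s - F t\<bar> \<le> g t" if "1 \<le> t" "t \<le> s" for s t
    using F[of t "s - t"] that by simp
  have "Cauchy (\<lambda>n. F (1 + real n))"
  proof (rule CauchyI')
    fix e :: real assume "0 < e"
    then have "\<forall>\<^sub>F t in at_top. g t < e" using g by (rule order_tendstoD(2)[rotated])
    then obtain T where T: "\<And>t. t \<ge> T \<Longrightarrow> g t < e" by (auto simp: eventually_at_top_linorder)
    obtain M :: nat where M: "T < real M" using reals_Archimedean2 by blast
    have "dist (F (1 + real m)) (F (1 + real n)) < e" if "m \<ge> M" "n > m" for m n
    proof -
      have "g (1 + real m) < e" using M that by (intro T) linarith
      then show ?thesis using F'[of "1 + real m" "1 + real n"] that by (simp add: dist_real_def)
    qed
    then show "\<exists>M. \<forall>m\<ge>M. \<forall>n>m. dist (F (1 + real m)) (F (1 + real n)) < e" by blast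
  qed
  then obtain l where l: "(\<lambda>n. F (1 + real n)) \<longlonglongrightarrow> l" using Cauchy_convergent convergent_def by blast
  have "\<bar>F t - l\<bar> \<le> g t" if "1 \<le> t" for t
  proof (rule tendsto_upperbound)
    show "(\<lambda>n. \<bar>F t - F (1 + real n)\<bar>) \<longlonglongrightarrow> \<bar>F t - l\<bar>" by (intro tendsto_intros l)
    obtain M :: nat where M: "t < real M" using reals_Archimedean2 by blast
    have "\<bar>F t - F (1 + real n)\<bar> \<le> g t" if "n \<ge> M" for n
      using F'[OF \<open>1 \<le> t\<close>, of "1 + real n"] M that by (simp add: abs_minus_commute)
    then show "\<forall>\<^sub>F n in sequentially. \<bar>F t - F (1 + real n)\<bar> \<le> g t"
      unfolding eventually_sequentially by blast
  qed simp
  then show ?thesis by blast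
qed

text \<open>The increments \<open>u x (t + s) - u x t\<close> vanish on the boundary, hence decay uniformly in \<open>x\<close> and
\<open>s\<close>; so \<open>u\<close> is uniformly Cauchy as \<open>t \<rightarrow> \<infinity>\<close>.\<close>

lemma equilibrium:
  fixes \<Omega> :: "'a::euclidean_space set"
  assumes \<Omega>: "open \<Omega>" "bounded \<Omega>" and sol: "heat_solution \<Omega> f u"
  obtains h where "caloric_limit \<Omega> u h" "continuous_on (closure \<Omega>) h" "\<And>x. x \<in> frontier \<Omega> \<Longrightarrow> h x = f x"
proof -
  obtain K where K: "\<And>s. 0 \<le> s \<Longrightarrow> dirichlet_caloric \<Omega> (\<lambda>x t. u x (t + s) - u x t) K"
    using heat_solution_increment[OF sol] by blast
  obtain R where "\<forall>x\<in>\<Omega>. norm x \<le> R" using \<Omega>(2) by (auto simp: bounded_iff)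
  then have R: "\<Omega> \<subseteq> cball 0 R" by auto
  define g where "g t = \<bar>K\<bar> * (R\<^sup>2 + 1) * exp (- (2 * DIM('a) / (R\<^sup>2 + 1)) * (t - 1))" for t
  have g: "(g \<longlongrightarrow> 0) at_top" unfolding g_def
    by (rule decay_tendsto_0) (simp add: add_nonneg_pos)
  have inc: "\<bar>u x (t + s) - u x t\<bar> \<le> g t" if x: "x \<in> closure \<Omega>" and t: "1 \<le> t" and s: "0 \<le> s" for x t s
  proof -
    let ?w = "\<lambda>x t. u x (t + s) - u x t"
    have w: "caloric \<Omega> ?w" "continuous_on (closure \<Omega> \<times> {0<..}) (\<lambda>(x, t). ?w x t)"
      and w0: "\<And>x t. x \<in> frontier \<Omega> \<Longrightarrow> 0 < t \<Longrightarrow> ?w x t = 0"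
      and wK: "\<And>x t. x \<in> closure \<Omega> \<Longrightarrow> 0 < t \<Longrightarrow> \<bar>?w x t\<bar> \<le> K"
      using K[OF s] unfolding dirichlet_caloric_def caloric_def by blast+
    have "continuous_on (closure \<Omega> \<times> {0<..}) (\<lambda>p. - (\<lambda>(x, t). ?w x t) p)"
      by (intro continuous_on_minus w(2))
    then have w2: "continuous_on (closure \<Omega> \<times> {0<..}) (\<lambda>(x, t). - ?w x t)"
      by (simp only: case_prod_unfold)
    have "?w x t \<le> g t" unfolding g_def
      by (rule late_time_comparison[OF \<Omega>(1) R _ _ w])
         (use w0 wK x t in \<open>auto simp: abs_le_iff intro: order_trans[OF _ abs_ge_self]\<close>)
    moreover have "- ?w x t \<le> g t" unfolding g_def
      by (rule late_time_comparison[OF \<Omega>(1) R _ _ caloric_minus[OF w(1)] w2])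
         (use w0 wK x t in \<open>auto simp: abs_le_iff intro: order_trans[OF _ abs_ge_self]\<close>)
    ultimately show ?thesis by (simp add: abs_le_iff)
  qed
  have "\<forall>x\<in>closure \<Omega>. \<exists>l. \<forall>t\<ge>1. \<bar>u x t - l\<bar> \<le> g t"
  proof
    fix x assume x: "x \<in> closure \<Omega>"
    show "\<exists>l. \<forall>t\<ge>1. \<bar>u x t - l\<bar> \<le> g t" by (rule limit_with_rate[OF inc[OF x] g])
  qed
  then obtain h where h: "\<And>x t. x \<in> closure \<Omega> \<Longrightarrow> 1 \<le> t \<Longrightarrow> \<bar>u x t - h x\<bar> \<le> g t" by metis
  have late: "\<exists>T\<ge>1. \<forall>t\<ge>T. \<forall>x\<in>closure \<Omega>. \<bar>u x t - h x\<bar> < e" if "0 < e" for e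
  proof -
    have "\<forall>\<^sub>F t in at_top. g t < e" using g \<open>0 < e\<close> by (rule order_tendstoD(2))
    then obtain T where T: "\<And>t. t \<ge> T \<Longrightarrow> g t < e" by (auto simp: eventually_at_top_linorder)
    have "\<bar>u x t - h x\<bar> < e" if "max 1 T \<le> t" "x \<in> closure \<Omega>" for t x
      using h[OF that(2), of t] T[of t] that(1) by simp
    then show ?thesis by (intro exI[of _ "max 1 T"]) auto
  qed
  have cont: "continuous_on (closure \<Omega> \<times> {0..} - frontier \<Omega> \<times> {0}) (\<lambda>(x, t). u x t)"
    and f: "\<And>x t. x \<in> frontier \<Omega> \<Longrightarrow> 0 < t \<Longrightarrow> u x t = f x"
    and classical: "classical_heat_equation \<Omega> u"
    using sol unfolding heat_solution_def by blast+
  have cal: "caloric \<Omega> u"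
    using classical_heat_equation_data[OF classical] unfolding caloric_def by metis
  show ?thesis
  proof (rule that[of h])
    show "caloric_limit \<Omega> u h" unfolding caloric_limit_def
    proof (intro conjI cal allI impI)
      show "continuous_on (\<Omega> \<times> {0<..}) (\<lambda>(x, t). u x t)"
        by (rule continuous_on_subset[OF cont]) (use closure_subset[of \<Omega>] in auto)
      fix e :: real assume "0 < e"
      then obtain T where T: "T \<ge> 1" "\<forall>t\<ge>T. \<forall>x\<in>closure \<Omega>. \<bar>u x t - h x\<bar> < e" using late by blast
      then have "\<forall>t\<ge>T. \<forall>x\<in>\<Omega>. \<bar>u x t - h x\<bar> \<le> e"
        using closure_subset[of \<Omega>] by (meson less_imp_le subsetD)
      then show "\<exists>T>0. \<forall>t\<ge>T. \<forall>x\<in>\<Omega>. \<bar>u x t - h x\<bar> \<le> e" using T(1) by (intro exI[of _ T]) auto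
    qed
    show "continuous_on (closure \<Omega>) h"
    proof (rule uniform_limit_theorem)
      show "uniform_limit (closure \<Omega>) (\<lambda>t x. u x t) h at_top"
      proof (rule uniform_limitI)
        fix e :: real assume "0 < e"
        then obtain T where "\<forall>t\<ge>T. \<forall>x\<in>closure \<Omega>. \<bar>u x t - h x\<bar> < e" using late by blast
        then show "\<forall>\<^sub>F t in at_top. \<forall>x\<in>closure \<Omega>. dist (u x t) (h x) < e"
          unfolding eventually_at_top_linorder dist_real_def by blast
      qed
      have "continuous_on (closure \<Omega>) (\<lambda>x. u x t)" if "0 < t" for t
      proof -
        have "continuous_on (closure \<Omega>) ((\<lambda>(x, t). u x t) \<circ> (\<lambda>x. (x, t)))"
          by (intro continuous_on_compose continuous_intros continuous_on_subset[OF cont]) (use that in auto)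
        then show ?thesis by (simp add: o_def)
      qed
      then show "\<forall>\<^sub>F t in at_top. continuous_on (closure \<Omega>) (\<lambda>x. u x t)"
        by (auto intro: eventually_mono[OF eventually_gt_at_top[of 0]])
    qed simp
    show "h x = f x" if x: "x \<in> frontier \<Omega>" for x
    proof (rule ccontr)
      assume "h x \<noteq> f x"
      then have "0 < \<bar>f x - h x\<bar>" by simp
      from late[OF this] obtain T where T: "T \<ge> 1" "\<forall>t\<ge>T. \<forall>z\<in>closure \<Omega>. \<bar>u z t - h z\<bar> < \<bar>f x - h x\<bar>" by blast
      have "\<bar>u x T - h x\<bar> < \<bar>f x - h x\<bar>" using T(2) x by (auto simp: frontier_def)
      then show False using f[OF x, of T] T(1) by simp
    qed
  qed
qed

section \<open>Absence of stationary level surfaces\<close>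

theorem theorem1p6:
  fixes \<Omega> D Sp Sm G Greg Gsing :: "'a::euclidean_space set"
    and f :: "'a \<Rightarrow> real"
    and u :: "'a \<Rightarrow> real \<Rightarrow> real"
    and k :: nat and M :: "nat \<Rightarrow> 'a set"
  assumes "DIM('a) \<ge> 2"
    and "domain \<Omega>" and "bounded \<Omega>" and "C11_boundary \<Omega>"
    and "continuous_on (frontier \<Omega>) f"
    and "Sp = {x \<in> frontier \<Omega>. f x > 0}" and "Sm = {x \<in> frontier \<Omega>. f x < 0}"
    and "Sp \<noteq> {}" and "Sm \<noteq> {}"
    and "closure (Sp \<union> Sm) = frontier \<Omega>"
    and "G = {x \<in> closure \<Omega>. path_distance \<Omega> Sp x = path_distance \<Omega> Sm x}"
    and "Greg = {x \<in> G. unique_closest_point (frontier \<Omega>) x}"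
    and "Gsing = G - Greg"
    and "Greg = (\<Union>i<k. M i)" and "disjoint_family_on M {..<k}"
    and "\<forall>i<k. C1_hypersurface (M i)"
    and "hausdorff_measure (DIM('a) - 1) Gsing = 0"
    and "heat_solution \<Omega> f u"
    and "domain D" and "closure D \<subseteq> \<Omega>"
    and "C1_boundary D" and "interior_sphere_condition D"
  shows "\<not> (\<exists>b::ereal. 0 < b \<and>
           (\<exists>c::real \<Rightarrow> real. \<forall>x\<in>frontier D. \<forall>t. 0 < t \<and> ereal t < b \<longrightarrow> u x t = c t))"
proof
  assume "\<exists>b::ereal. 0 < b \<and>
           (\<exists>c::real \<Rightarrow> real. \<forall>x\<in>frontier D. \<forall>t. 0 < t \<and> ereal t < b \<longrightarrow> u x t = c t)"
  then obtain b c where b: "0 < (b::ereal)" and c: "\<And>x t. x \<in> frontier D \<Longrightarrow> 0 < t \<Longrightarrow> ereal t < b \<Longrightarrow> u x t = c t"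
    by blast
  have \<Omega>: "open \<Omega>" "connected \<Omega>" "bounded \<Omega>" and D: "open D" "D \<noteq> {}"
    using assms by (auto simp: domain_def)
  have sol: "heat_solution \<Omega> f u" and DU: "closure D \<subseteq> \<Omega>" by fact+
  have D\<Omega>: "D \<subseteq> \<Omega>" using DU closure_subset by blast
  have bD: "bounded D" using \<Omega>(3) D\<Omega> bounded_subset by blast
  have fr: "frontier D \<subseteq> \<Omega>" using DU by (auto simp: frontier_def)
  have "D \<noteq> UNIV" using bD not_bounded_UNIV by metis
  then obtain p where p: "p \<in> frontier D" using D(2) frontier_eq_empty[of D] by blast
  obtain h where lim: "caloric_limit \<Omega> u h" and ch: "continuous_on (closure \<Omega>) h"
    and hf: "\<And>x. x \<in> frontier \<Omega> \<Longrightarrow> h x = f x"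
    using equilibrium[OF \<Omega>(1,3) sol] by blast
  obtain b' where b': "0 < ereal b'" "ereal b' < b" using ereal_dense2[OF b] by blast
  have h_eq: "h x = h p" if x: "x \<in> frontier D" for x
  proof -
    have "u x t = u p t" if "0 < t" for t
    proof (rule equality_for_all_times[OF \<Omega>(1,3) sol _ _ _ _ that])
      show "u x t = u p t" if "0 < t" "t \<le> b'" for t
      proof -
        have "ereal t < b" using that b'(2) by (meson ereal_less_eq(3) le_less_trans)
        then show ?thesis using c[OF x] c[OF p] that by simp
      qed
    qed (use x p fr b' in auto)
    then have "\<forall>\<^sub>F t in at_top. u x t = u p t"
      by (auto intro: eventually_mono[OF eventually_gt_at_top[of 0]])
    then have "(u p \<longlongrightarrow> h x) at_top"
      using caloric_limit_tendsto[OF lim, of x] x fr tendsto_cong by blast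
    moreover have "(u p \<longlongrightarrow> h p) at_top" using caloric_limit_tendsto[OF lim, of p] p fr by blast
    ultimately show ?thesis using tendsto_unique trivial_limit_at_top_linorder by blast
  qed
  have hD: "h x = h p" if "x \<in> D" for x
  proof -
    have "h x \<le> h p"
      by (rule limit_maximum_principle[OF lim D(1) bD DU _ that]) (simp add: h_eq)
    moreover have "- h x \<le> - h p"
      by (rule limit_maximum_principle[OF caloric_limit_minus[OF lim] D(1) bD DU _ that]) (simp add: h_eq)
    ultimately show ?thesis by simp
  qed
  have "bounded (h ` closure \<Omega>)"
    using ch \<Omega>(3) by (intro compact_imp_bounded compact_continuous_image) auto
  then obtain B where B: "\<And>x. x \<in> closure \<Omega> \<Longrightarrow> \<bar>h x\<bar> \<le> B" by (auto simp: bounded_iff)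
  have "h x - h p = 0" if "x \<in> \<Omega>" for x
  proof (rule unique_continuation[OF caloric_limit_diff[OF lim caloric_limit_const] _ \<Omega>(1,2) D D\<Omega> _ that])
    show "\<bar>h y - h p\<bar> \<le> 2 * B" if "y \<in> \<Omega>" for y
    proof -
      have "y \<in> closure \<Omega>" "p \<in> closure \<Omega>" using that p fr closure_subset by auto
      from B[OF this(1)] B[OF this(2)] show ?thesis by linarith
    qed
    show "h y - h p = 0" if "y \<in> D" for y using hD[OF that] by simp
  qed
  then have "h x = h p" if "x \<in> closure \<Omega>" for x
    using continuous_constant_on_closure[OF ch, of "h p" x] that by simp
  then have f_const: "f x = h p" if "x \<in> frontier \<Omega>" for x
    using hf[OF that] that by (auto simp: frontier_def)
  obtain x y where "x \<in> frontier \<Omega>" "0 < f x" "y \<in> frontier \<Omega>" "f y < 0"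
    using assms(6-9) by blast
  then show False using f_const by fastforce
qed

end
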